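(* Let $\lambda\in P^+$ and $a_0,a_1\in\mathbb{C}$, and set $\chi=\chi_{a_0,a_1}$. 1) If $a_0\notin\mathbb{Z}$ or $a_1\notin\mathbb{Z}$, then $\overline{V(\lambda)}^{\chi}=\{0\}$. 2) If $a_0,a_1\in\mathbb{Z}$, then $$\dim\big(\overline{V(\lambda)}^{\chi}\big)=\begin{cases}1 & \text{if } \lambda(h_i)-|a_i|\in 2\mathbb{N}_0 \text{ for } i=0,1,\\ 0&\text{else.}\end{cases}$$
   Context: Let $e,f,h$ be the standard basis of the complex Lie algebra $\mathfrak{sl}_2$ and $(\cdot,\cdot)$ its symmetric invariant bilinear form with $(e,f)=1$. The affine Lie algebra is $\mathfrak g=\widehat{\mathfrak{sl}}_2=\mathbb{C}[t,t^{-1}]\otimes\mathfrak{sl}_2\oplus\mathbb{C}c\oplus\mathbb{C}d$ with $[t^m\otimes x,t^n\otimes y]=t^{m+n}\otimes[x,y]+m\delta_{m,-n}(x,y)c$, $[d,t^n\otimes x]=n\,t^n\otimes x$, $c$ central. Put $e_0=t\otimes f$, $f_0=t^{-1}\otimes e$, $h_0=-1\otimes h+c$, $e_1=1\otimes e$, $f_1=1\otimes f$, $h_1=1\otimes h$. The Chevalley involution $\hat\theta$ of $\mathfrak g$ is the Lie algebra automorphism with $\hat\theta(d)=-d$, $\hat\theta(e_j)=-f_j$, $\hat\theta(f_j)=-e_j$, $\hat\theta(h_j)=-h_j$ ($j=0,1$). Let $\mathfrak k=\{x\in\mathfrak g\mid\hat\theta(x)=x\}$; it is generated by $B_0=i(e_0-f_0)$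 and $B_1=i(e_1-f_1)$, $i$ the imaginary unit. For $a,b\in\mathbb{C}$, $\chi_{a,b}:\mathfrak k\to\mathbb{C}$ is the unique one-dimensional representation with $\chi_{a,b}(B_0)=a$, $\chi_{a,b}(B_1)=b$. Let $\mathfrak h=\mathrm{span}_{\mathbb C}\{h_0,h_1,d\}$, $P=\{\lambda\in\mathfrak h^*\mid\lambda(h_0),\lambda(h_1),\lambda(d)\in\mathbb{Z}\}$, $P^+=\{\lambda\in P\mid\lambda(h_0),\lambda(h_1)\in\mathbb{N}_0\}$. For $\lambda\in P^+$ let $V(\lambda)=\bigoplus_{\mu}V(\lambda)_\mu$ be the integrable irreducible highest weight $\mathfrak g$-module of highest weight $\lambda$ with its weight decomposition, and let $\overline{V(\lambda)}=\prod_{\mu\in P}V(\lambda)_\mu$, with the $\mathfrak g$-module structure extending that of $V(\lambda)$. For a left $\mathfrak g$-module $V$, $V^\chi=\{v\in V\mid xv=\chi(x)v\ \text{for all }x\in\mathfrak k\}$. *)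

theory Defs
  imports "HOL-Analysis.Analysis" "HOL-Library.Poly_Mapping" "HOL-Library.Function_Algebras"
begin

section \<open>The Lie algebra \<open>sl\<^sub>2\<close>\<close>

typedef sl2 = "{A :: complex^2^2. trace A = 0}"
  morphisms sl2_matrix Abs_sl2
  by (rule exI[of _ 0]) (simp add: trace_def)

setup_lifting type_definition_sl2

instantiation sl2 :: ab_group_add
begin

lift_definition zero_sl2 :: sl2 is 0 by (simp add: trace_def)
lift_definition plus_sl2 :: "sl2 \<Rightarrow> sl2 \<Rightarrow> sl2" is "(+)" by (simp add: trace_add)
lift_definition minus_sl2 :: "sl2 \<Rightarrow> sl2 \<Rightarrow> sl2" is "(-)" by (simp add: trace_sub)
lift_definition uminus_sl2 :: "sl2 \<Rightarrow> sl2" is uminus by (simp add: trace_def sum_negf)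

instance by standard (transfer; simp)+

end

lift_definition sl2_scale :: "complex \<Rightarrow> sl2 \<Rightarrow> sl2" is "\<lambda>a A. \<chi> i j. a * A $ i $ j"
  by (simp add: trace_def sum_2 flip: distrib_left)

lift_definition sl2_bracket :: "sl2 \<Rightarrow> sl2 \<Rightarrow> sl2" is "\<lambda>A B. A ** B - B ** A"
  by (metis trace_sub trace_mul_sym right_minus_eq)

text \<open>On \<open>sl\<^sub>2\<close> symmetric invariant bilinear forms are unique up to scalars; the trace form is
  the one with \<open>(e, f) = 1\<close>.\<close>

lift_definition sl2_form :: "sl2 \<Rightarrow> sl2 \<Rightarrow> complex" is "\<lambda>A B. trace (A ** B)" .

lift_definition sl2_e :: sl2 is "vector [vector [0, 1], vector [0, 0]]"
  by (simp add: trace_def sum_2)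
lift_definition sl2_f :: sl2 is "vector [vector [0, 0], vector [1, 0]]"
  by (simp add: trace_def sum_2)
lift_definition sl2_h :: sl2 is "vector [vector [1, 0], vector [0, -1]]"
  by (simp add: trace_def sum_2)

subsection \<open>Coordinates with respect to \<open>e, f, h\<close>\<close>

lift_definition coord_e :: "sl2 \<Rightarrow> complex" is "\<lambda>A. A $ 1 $ 2" .
lift_definition coord_f :: "sl2 \<Rightarrow> complex" is "\<lambda>A. A $ 2 $ 1" .
lift_definition coord_h :: "sl2 \<Rightarrow> complex" is "\<lambda>A. A $ 1 $ 1" .

lemma sl2_eq_iff:
  "x = y \<longleftrightarrow> coord_e x = coord_e y \<and> coord_f x = coord_f y \<and> coord_h x = coord_h y"
proof (transfer, goal_cases)
  case (1 A B)
  then have "A $ 2 $ 2 = - A $ 1 $ 1" "B $ 2 $ 2 = - B $ 1 $ 1"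
    by (simp_all add: trace_def sum_2 add_eq_0_iff2)
  then show ?case by (auto simp: vec_eq_iff forall_2)
qed

lemma coord_e_simps [simp]:
  "coord_e 0 = 0" "coord_e (x + y) = coord_e x + coord_e y"
  "coord_e (x - y) = coord_e x - coord_e y" "coord_e (- x) = - coord_e x"
  "coord_e (sl2_scale a x) = a * coord_e x"
  "coord_e sl2_e = 1" "coord_e sl2_f = 0" "coord_e sl2_h = 0"
  by (transfer; simp)+

lemma coord_f_simps [simp]:
  "coord_f 0 = 0" "coord_f (x + y) = coord_f x + coord_f y"
  "coord_f (x - y) = coord_f x - coord_f y" "coord_f (- x) = - coord_f x"
  "coord_f (sl2_scale a x) = a * coord_f x"
  "coord_f sl2_e = 0" "coord_f sl2_f = 1" "coord_f sl2_h = 0"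
  by (transfer; simp)+

lemma coord_h_simps [simp]:
  "coord_h 0 = 0" "coord_h (x + y) = coord_h x + coord_h y"
  "coord_h (x - y) = coord_h x - coord_h y" "coord_h (- x) = - coord_h x"
  "coord_h (sl2_scale a x) = a * coord_h x"
  "coord_h sl2_e = 0" "coord_h sl2_f = 0" "coord_h sl2_h = 1"
  by (transfer; simp)+

lemma coord_bracket [simp]:
  "coord_e (sl2_bracket x y) = 2 * (coord_h x * coord_e y - coord_e x * coord_h y)"
  "coord_f (sl2_bracket x y) = 2 * (coord_f x * coord_h y - coord_h x * coord_f y)"
  "coord_h (sl2_bracket x y) = coord_e x * coord_f y - coord_f x * coord_e y"
proof (transfer, goal_cases)
  case (1 A B)
  then have "A $ 2 $ 2 = - A $ 1 $ 1" "B $ 2 $ 2 = - B $ 1 $ 1"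
    by (simp_all add: trace_def sum_2 add_eq_0_iff2)
  then show ?case by (simp add: matrix_matrix_mult_def sum_2 algebra_simps)
next
  show "coord_f (sl2_bracket x y) = 2 * (coord_f x * coord_h y - coord_h x * coord_f y)"
  proof (transfer, goal_cases)
    case (1 A B)
    then have "A $ 2 $ 2 = - A $ 1 $ 1" "B $ 2 $ 2 = - B $ 1 $ 1"
      by (simp_all add: trace_def sum_2 add_eq_0_iff2)
    then show ?case by (simp add: matrix_matrix_mult_def sum_2 algebra_simps)
  qed
  show "coord_h (sl2_bracket x y) = coord_e x * coord_f y - coord_f x * coord_e y"
    by transfer (simp add: matrix_matrix_mult_def sum_2 algebra_simps)
qed

lemma sl2_form_coord:
  "sl2_form x y = 2 * coord_h x * coord_h y + coord_e x * coord_f y + coord_f x * coord_e y"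
proof (transfer, goal_cases)
  case (1 A B)
  then have "A $ 2 $ 2 = - A $ 1 $ 1" "B $ 2 $ 2 = - B $ 1 $ 1"
    by (simp_all add: trace_def sum_2 add_eq_0_iff2)
  then show ?case by (simp add: trace_def matrix_matrix_mult_def sum_2 algebra_simps)
qed

lemma coord_sum:
  "coord_e (sum g S) = (\<Sum>i\<in>S. coord_e (g i))"
  "coord_f (sum g S) = (\<Sum>i\<in>S. coord_f (g i))"
  "coord_h (sum g S) = (\<Sum>i\<in>S. coord_h (g i))"
  by (induction S rule: infinite_finite_induct; simp)+


section \<open>The affine Lie algebra\<close>

text \<open>The triple \<open>(X, u, v)\<close> stands for \<open>(\<Sum>\<^sub>n t\<^sup>n \<otimes> X\<^sub>n) + u c + v d\<close>.\<close>

type_synonym affine = "(int \<Rightarrow>\<^sub>0 sl2) \<times> complex \<times> complex"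

definition loop_scale :: "complex \<Rightarrow> (int \<Rightarrow>\<^sub>0 sl2) \<Rightarrow> (int \<Rightarrow>\<^sub>0 sl2)" where
  "loop_scale a X = Poly_Mapping.map (sl2_scale a) X"

definition affine_scale :: "complex \<Rightarrow> affine \<Rightarrow> affine" where
  "affine_scale a = (\<lambda>(X, u, v). (loop_scale a X, a * u, a * v))"

definition loop_bracket :: "(int \<Rightarrow>\<^sub>0 sl2) \<Rightarrow> (int \<Rightarrow>\<^sub>0 sl2) \<Rightarrow> (int \<Rightarrow>\<^sub>0 sl2)" where
  "loop_bracket X Y = (\<Sum>m\<in>Poly_Mapping.keys X. \<Sum>n\<in>Poly_Mapping.keys Y.
     Poly_Mapping.single (m + n) (sl2_bracket (Poly_Mapping.lookup X m) (Poly_Mapping.lookup Y n)))"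

definition loop_cocycle :: "(int \<Rightarrow>\<^sub>0 sl2) \<Rightarrow> (int \<Rightarrow>\<^sub>0 sl2) \<Rightarrow> complex" where
  "loop_cocycle X Y = (\<Sum>m\<in>Poly_Mapping.keys X.
     of_int m * sl2_form (Poly_Mapping.lookup X m) (Poly_Mapping.lookup Y (- m)))"

text \<open>The derivation \<open>t d/dt\<close>.\<close>

definition loop_deriv :: "(int \<Rightarrow>\<^sub>0 sl2) \<Rightarrow> (int \<Rightarrow>\<^sub>0 sl2)" where
  "loop_deriv X = (\<Sum>n\<in>Poly_Mapping.keys X.
     Poly_Mapping.single n (sl2_scale (of_int n) (Poly_Mapping.lookup X n)))"

definition affine_bracket :: "affine \<Rightarrow> affine \<Rightarrow> affine" where
  "affine_bracket = (\<lambda>(X, u, v) (Y, u', v').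
     (loop_bracket X Y + loop_scale v (loop_deriv Y) - loop_scale v' (loop_deriv X),
      loop_cocycle X Y, 0))"

definition loop :: "int \<Rightarrow> sl2 \<Rightarrow> affine" where
  "loop n x = (Poly_Mapping.single n x, 0, 0)"

definition affine_c :: affine where "affine_c = (0, 1, 0)"
definition affine_d :: affine where "affine_d = (0, 0, 1)"

definition e\<^sub>0 :: affine where "e\<^sub>0 = loop 1 sl2_f"
definition f\<^sub>0 :: affine where "f\<^sub>0 = loop (- 1) sl2_e"
definition h\<^sub>0 :: affine where "h\<^sub>0 = affine_c - loop 0 sl2_h"
definition e\<^sub>1 :: affine where "e\<^sub>1 = loop 0 sl2_e"
definition f\<^sub>1 :: affine where "f\<^sub>1 = loop 0 sl2_f"
definition h\<^sub>1 :: affine where "h\<^sub>1 = loop 0 sl2_h"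

lemma lookup_loop_scale [simp]:
  "Poly_Mapping.lookup (loop_scale a X) n = sl2_scale a (Poly_Mapping.lookup X n)"
  by (auto simp: loop_scale_def Poly_Mapping.map.rep_eq when_def sl2_eq_iff)

lemma affine_eq_iff:
  "x = y \<longleftrightarrow> (\<forall>n. Poly_Mapping.lookup (fst x) n = Poly_Mapping.lookup (fst y) n)
     \<and> fst (snd x) = fst (snd y) \<and> snd (snd x) = snd (snd y)"
  by (auto simp: prod_eq_iff intro: poly_mapping_eqI)

lemma affine_scale_sel [simp]:
  "fst (affine_scale a x) = loop_scale a (fst x)"
  "fst (snd (affine_scale a x)) = a * fst (snd x)"
  "snd (snd (affine_scale a x)) = a * snd (snd x)"
  by (simp_all add: affine_scale_def split_beta)

global_interpretation affine: vector_space affine_scale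
  by unfold_locales
     (simp_all add: affine_eq_iff sl2_eq_iff lookup_add algebra_simps)

lemma bracket_zero [simp]: "sl2_bracket 0 x = 0" "sl2_bracket x 0 = 0"
  by (simp_all add: sl2_eq_iff)

lemma sl2_scale_zero [simp]: "sl2_scale a 0 = 0" "sl2_scale 0 x = 0"
  by (simp_all add: sl2_eq_iff)

lemma form_zero [simp]: "sl2_form 0 x = 0" "sl2_form x 0 = 0"
  by (simp_all add: sl2_form_coord)

lemma lookup_loop_bracket:
  assumes "finite S" "Poly_Mapping.keys X \<subseteq> S"
  shows "Poly_Mapping.lookup (loop_bracket X Y) k =
    (\<Sum>m\<in>S. sl2_bracket (Poly_Mapping.lookup X m) (Poly_Mapping.lookup Y (k - m)))"
proof -
  have "(\<Sum>n\<in>Poly_Mapping.keys Y. Poly_Mapping.lookup (Poly_Mapping.single (m + n)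
      (sl2_bracket (Poly_Mapping.lookup X m) (Poly_Mapping.lookup Y n))) k)
    = sl2_bracket (Poly_Mapping.lookup X m) (Poly_Mapping.lookup Y (k - m))" for m
  proof -
    have "(\<Sum>n\<in>Poly_Mapping.keys Y. Poly_Mapping.lookup (Poly_Mapping.single (m + n)
        (sl2_bracket (Poly_Mapping.lookup X m) (Poly_Mapping.lookup Y n))) k)
      = (\<Sum>n\<in>Poly_Mapping.keys Y. if n = k - m then
          sl2_bracket (Poly_Mapping.lookup X m) (Poly_Mapping.lookup Y (k - m)) else 0)"
      by (rule sum.cong) (auto simp: lookup_single when_def)
    also have "\<dots> = sl2_bracket (Poly_Mapping.lookup X m) (Poly_Mapping.lookup Y (k - m))"
      by (auto simp: sum.delta in_keys_iff)
    finally show ?thesis .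
  qed
  then have "Poly_Mapping.lookup (loop_bracket X Y) k = (\<Sum>m\<in>Poly_Mapping.keys X.
      sl2_bracket (Poly_Mapping.lookup X m) (Poly_Mapping.lookup Y (k - m)))"
    by (simp add: loop_bracket_def lookup_sum)
  also have "\<dots> = (\<Sum>m\<in>S. sl2_bracket (Poly_Mapping.lookup X m) (Poly_Mapping.lookup Y (k - m)))"
    using assms by (intro sum.mono_neutral_left) (auto simp: in_keys_iff)
  finally show ?thesis .
qed

lemma loop_cocycle_superset:
  assumes "finite S" "Poly_Mapping.keys X \<subseteq> S"
  shows "loop_cocycle X Y = (\<Sum>m\<in>S.
    of_int m * sl2_form (Poly_Mapping.lookup X m) (Poly_Mapping.lookup Y (- m)))"
  unfolding loop_cocycle_def using assms
  by (intro sum.mono_neutral_left) (auto simp: in_keys_iff)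

lemma lookup_loop_deriv [simp]:
  "Poly_Mapping.lookup (loop_deriv X) n = sl2_scale (of_int n) (Poly_Mapping.lookup X n)"
  by (auto simp: loop_deriv_def lookup_sum lookup_single when_def sum.delta in_keys_iff)

lemma affine_bracket_sel [simp]:
  "fst (affine_bracket x y) = loop_bracket (fst x) (fst y)
     + loop_scale (snd (snd x)) (loop_deriv (fst y)) - loop_scale (snd (snd y)) (loop_deriv (fst x))"
  "fst (snd (affine_bracket x y)) = loop_cocycle (fst x) (fst y)"
  "snd (snd (affine_bracket x y)) = 0"
  by (simp_all add: affine_bracket_def split_beta)

lemma loop_bracket_diff:
  "loop_bracket (X - X') Y = loop_bracket X Y - loop_bracket X' Y"
  "loop_bracket Y (X - X') = loop_bracket Y X - loop_bracket Y X'"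
proof -
  let ?S = "Poly_Mapping.keys X \<union> Poly_Mapping.keys X' \<union> Poly_Mapping.keys (X - X')"
  have S: "finite ?S" "Poly_Mapping.keys X \<subseteq> ?S" "Poly_Mapping.keys X' \<subseteq> ?S"
    "Poly_Mapping.keys (X - X') \<subseteq> ?S" by auto
  note br = lookup_loop_bracket[OF S(1,2)] lookup_loop_bracket[OF S(1,3)] lookup_loop_bracket[OF S(1,4)]
  show "loop_bracket (X - X') Y = loop_bracket X Y - loop_bracket X' Y"
    by (rule poly_mapping_eqI)
      (auto simp: lookup_minus br sl2_eq_iff coord_sum sum_subtractf[symmetric] algebra_simps
        intro!: sum.cong)
  show "loop_bracket Y (X - X') = loop_bracket Y X - loop_bracket Y X'"
    by (rule poly_mapping_eqI)
      (auto simp: lookup_minus lookup_loop_bracket[OF finite_keys order_refl] sl2_eq_iff coord_sum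
        sum_subtractf[symmetric] algebra_simps intro!: sum.cong)
qed

lemma loop_cocycle_diff:
  "loop_cocycle (X - X') Y = loop_cocycle X Y - loop_cocycle X' Y"
  "loop_cocycle Y (X - X') = loop_cocycle Y X - loop_cocycle Y X'"
proof -
  let ?S = "Poly_Mapping.keys X \<union> Poly_Mapping.keys X' \<union> Poly_Mapping.keys (X - X')"
  have S: "finite ?S" "Poly_Mapping.keys X \<subseteq> ?S" "Poly_Mapping.keys X' \<subseteq> ?S"
    "Poly_Mapping.keys (X - X') \<subseteq> ?S" by auto
  note co = loop_cocycle_superset[OF S(1,2)] loop_cocycle_superset[OF S(1,3)] loop_cocycle_superset[OF S(1,4)]
  show "loop_cocycle (X - X') Y = loop_cocycle X Y - loop_cocycle X' Y"
    by (auto simp: lookup_minus co sl2_form_coord sum_subtractf[symmetric] algebra_simps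
        intro!: sum.cong)
  show "loop_cocycle Y (X - X') = loop_cocycle Y X - loop_cocycle Y X'"
    by (auto simp: lookup_minus loop_cocycle_def sl2_form_coord sum_subtractf[symmetric]
        algebra_simps intro!: sum.cong)
qed

lemma affine_bracket_diff:
  "affine_bracket (x - x') y = affine_bracket x y - affine_bracket x' y"
  "affine_bracket y (x - x') = affine_bracket y x - affine_bracket y x'"
  by (auto simp: affine_eq_iff loop_bracket_diff loop_cocycle_diff lookup_minus lookup_add
      sl2_eq_iff algebra_simps)

text \<open>The defining relations of the bracket.\<close>

lemma affine_bracket_loop:
  "affine_bracket (loop m x) (loop n y) = loop (m + n) (sl2_bracket x y)
     + affine_scale (if m = - n then of_int m * sl2_form x y else 0) affine_c"
proof -
  have 1: "Poly_Mapping.keys (Poly_Mapping.single m x) \<subseteq> {m}" by simp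
  show ?thesis
    unfolding affine_eq_iff
    by (auto simp: loop_def affine_c_def lookup_add lookup_minus lookup_loop_bracket[OF _ 1]
        loop_cocycle_superset[OF _ 1] lookup_single when_def)
qed

lemma affine_bracket_d:
  "affine_bracket affine_d (loop n x) = affine_scale (of_int n) (loop n x)"
  "affine_bracket (loop n x) affine_d = - affine_scale (of_int n) (loop n x)"
  "affine_bracket affine_d affine_d = 0"
  by (auto simp: affine_eq_iff loop_def affine_d_def lookup_add lookup_minus sl2_eq_iff
      lookup_single when_def
      lookup_loop_bracket[OF finite_keys order_refl] loop_cocycle_def)

lemma affine_bracket_c: "affine_bracket affine_c x = 0" "affine_bracket x affine_c = 0"
  by (auto simp: affine_eq_iff affine_c_def lookup_add lookup_minus sl2_eq_iff
      lookup_loop_bracket[OF finite_keys order_refl] loop_cocycle_def coord_sum)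

section \<open>The Chevalley involution and its fixed Lie algebra\<close>

definition lie_automorphism :: "(affine \<Rightarrow> affine) \<Rightarrow> bool" where
  "lie_automorphism \<phi> \<longleftrightarrow> Vector_Spaces.linear affine_scale affine_scale \<phi> \<and> bij \<phi>
     \<and> (\<forall>x y. \<phi> (affine_bracket x y) = affine_bracket (\<phi> x) (\<phi> y))"

definition is_chevalley :: "(affine \<Rightarrow> affine) \<Rightarrow> bool" where
  "is_chevalley \<phi> \<longleftrightarrow> lie_automorphism \<phi> \<and> \<phi> affine_d = - affine_d
     \<and> \<phi> e\<^sub>0 = - f\<^sub>0 \<and> \<phi> f\<^sub>0 = - e\<^sub>0 \<and> \<phi> h\<^sub>0 = - h\<^sub>0
     \<and> \<phi> e\<^sub>1 = - f\<^sub>1 \<and> \<phi> f\<^sub>1 = - e\<^sub>1 \<and> \<phi> h\<^sub>1 = - h\<^sub>1"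

definition chevalley :: "affine \<Rightarrow> affine" where
  "chevalley = (THE \<phi>. is_chevalley \<phi>)"

lift_definition sl2_theta :: "sl2 \<Rightarrow> sl2" is "\<lambda>A. - transpose A"
  by (simp add: trace_def transpose_def sum_negf)

lemma coord_theta [simp]:
  "coord_e (sl2_theta x) = - coord_f x" "coord_f (sl2_theta x) = - coord_e x"
  "coord_h (sl2_theta x) = - coord_h x"
  by (transfer; simp add: transpose_def)+

definition loop_theta :: "(int \<Rightarrow>\<^sub>0 sl2) \<Rightarrow> (int \<Rightarrow>\<^sub>0 sl2)" where
  "loop_theta X = (\<Sum>n\<in>Poly_Mapping.keys X.
     Poly_Mapping.single (- n) (sl2_theta (Poly_Mapping.lookup X n)))"

lemma lookup_loop_theta [simp]:
  "Poly_Mapping.lookup (loop_theta X) n = sl2_theta (Poly_Mapping.lookup X (- n))"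
proof -
  have "Poly_Mapping.lookup (loop_theta X) n = (\<Sum>k\<in>Poly_Mapping.keys X.
      if k = - n then sl2_theta (Poly_Mapping.lookup X (- n)) else 0)"
    unfolding loop_theta_def lookup_sum by (rule sum.cong) (auto simp: lookup_single when_def)
  also have "\<dots> = sl2_theta (Poly_Mapping.lookup X (- n))"
    by (auto simp: sum.delta in_keys_iff sl2_eq_iff)
  finally show ?thesis .
qed

definition affine_theta :: "affine \<Rightarrow> affine" where
  "affine_theta = (\<lambda>(X, u, v). (loop_theta X, - u, - v))"

lemma affine_theta_sel [simp]:
  "fst (affine_theta x) = loop_theta (fst x)"
  "fst (snd (affine_theta x)) = - fst (snd x)"
  "snd (snd (affine_theta x)) = - snd (snd x)"
  by (simp_all add: affine_theta_def split_beta)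

lemma affine_theta_bracket:
  "affine_theta (affine_bracket x y) = affine_bracket (affine_theta x) (affine_theta y)"
proof -
  let ?S = "Poly_Mapping.keys (fst x)"
  have keys: "Poly_Mapping.keys (loop_theta (fst x)) \<subseteq> uminus ` ?S"
    by (auto simp: in_keys_iff sl2_eq_iff intro!: image_eqI[where x = "- _"])
  have comm: "- i - k = - k - i" for i k :: int by simp
  have "Poly_Mapping.lookup (loop_bracket (loop_theta (fst x)) (loop_theta (fst y))) k
    = sl2_theta (Poly_Mapping.lookup (loop_bracket (fst x) (fst y)) (- k))" for k
    by (subst lookup_loop_bracket[OF _ keys], simp,
        subst lookup_loop_bracket[OF finite_keys order_refl])
      (auto simp: sl2_eq_iff coord_sum sum.reindex comm algebra_simps sum_negf[symmetric]
        intro!: sum.cong)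
  moreover have "loop_cocycle (loop_theta (fst x)) (loop_theta (fst y))
    = - loop_cocycle (fst x) (fst y)"
    by (subst loop_cocycle_superset[OF _ keys], simp)
      (auto simp: loop_cocycle_def sl2_form_coord sum.reindex algebra_simps sum_negf[symmetric]
        intro!: sum.cong)
  ultimately show ?thesis
    by (auto simp: affine_eq_iff lookup_add lookup_minus sl2_eq_iff algebra_simps)
qed

lemma affine_theta_involution: "affine_theta (affine_theta x) = x"
  by (simp add: affine_eq_iff sl2_eq_iff)

lemma linear_affine_theta: "Vector_Spaces.linear affine_scale affine_scale affine_theta"
  by (simp add: Vector_Spaces.linear_iff affine.vector_space_axioms affine_eq_iff sl2_eq_iff
      lookup_add algebra_simps)

lemma loop_add: "loop n (x + y) = loop n x + loop n y"
  by (simp add: loop_def single_add)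

lemma affine_scale_loop: "affine_scale a (loop n x) = loop n (sl2_scale a x)"
  by (simp add: affine_eq_iff loop_def lookup_single when_def)

lemma affine_expansion:
  "x = (\<Sum>n\<in>Poly_Mapping.keys (fst x). loop n (Poly_Mapping.lookup (fst x) n))
     + affine_scale (fst (snd x)) affine_c + affine_scale (snd (snd x)) affine_d"
  by (auto simp: affine_eq_iff lookup_add fst_sum snd_sum lookup_sum loop_def lookup_single
      when_def affine_c_def affine_d_def in_keys_iff)

lemma affine_generated:
  assumes S: "affine.subspace S"
    and bracket: "\<And>x y. x \<in> S \<Longrightarrow> y \<in> S \<Longrightarrow> affine_bracket x y \<in> S"
    and gen: "e\<^sub>0 \<in> S" "f\<^sub>0 \<in> S" "h\<^sub>0 \<in> S" "e\<^sub>1 \<in> S" "f\<^sub>1 \<in> S" "h\<^sub>1 \<in> S" "affine_d \<in> S"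
  shows "x \<in> S"
proof -
  have "h\<^sub>0 + h\<^sub>1 \<in> S" using gen S affine.subspace_add by blast
  then have c: "affine_c \<in> S" by (simp add: h\<^sub>0_def h\<^sub>1_def)
  have rescale: "loop n x \<in> S" if "loop n (sl2_scale a x) \<in> S" "a \<noteq> 0" for n x a
  proof -
    have "affine_scale (1 / a) (loop n (sl2_scale a x)) \<in> S"
      using that S affine.subspace_scale by blast
    moreover have "sl2_scale (1 / a) (sl2_scale a x) = x" using that by (simp add: sl2_eq_iff)
    ultimately show ?thesis by (simp add: affine_scale_loop)
  qed
  have br: "loop (m + n) (sl2_bracket x y) \<in> S" if "loop m x \<in> S" "loop n y \<in> S" for m n x y
  proof -
    have "affine_bracket (loop m x) (loop n y) - affine_scale
        (if m = - n then of_int m * sl2_form x y else 0) affine_c \<in> S"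
      using that c bracket S by (metis affine.subspace_diff affine.subspace_scale)
    then show ?thesis by (simp add: affine_bracket_loop)
  qed
  have he: "sl2_bracket sl2_h sl2_e = sl2_scale 2 sl2_e"
    and hf: "sl2_bracket sl2_h sl2_f = sl2_scale (- 2) sl2_f"
    and ef: "sl2_bracket sl2_e sl2_f = sl2_h" and fe: "sl2_bracket sl2_f sl2_e = sl2_scale (- 1) sl2_h"
    by (simp_all add: sl2_eq_iff)
  have zero: "loop 0 sl2_e \<in> S" "loop 0 sl2_f \<in> S" "loop 0 sl2_h \<in> S"
    using gen by (simp_all add: e\<^sub>1_def f\<^sub>1_def h\<^sub>1_def)
  have up: "loop 1 sl2_f \<in> S" and down: "loop (- 1) sl2_e \<in> S"
    using gen by (simp_all add: e\<^sub>0_def f\<^sub>0_def)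
  have up_h: "loop 1 sl2_h \<in> S" using br[OF zero(1) up] by (simp add: ef)
  have up_e: "loop 1 sl2_e \<in> S" using br[OF up_h zero(1)] by (auto simp: he intro: rescale)
  have down_h: "loop (- 1) sl2_h \<in> S"
    using br[OF zero(2) down] by (auto simp: fe intro: rescale)
  let ?L = "\<lambda>n. loop n sl2_e \<in> S \<and> loop n sl2_f \<in> S \<and> loop n sl2_h \<in> S"
  have down_f: "loop (- 1) sl2_f \<in> S"
    using br[OF down_h zero(2)] by (auto simp: hf intro: rescale)
  have step_up: "?L (1 + n)" if "?L n" for n
    using br[OF up_h, of n sl2_e] br[OF up_h, of n sl2_f] br[OF up_e, of n sl2_f] that
    by (auto simp: he hf ef intro: rescale)
  have step_down: "?L (- 1 + n)" if "?L n" for n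
    using br[OF down_h, of n sl2_e] br[OF down_h, of n sl2_f] br[OF down, of n sl2_f] that
    by (auto simp: he hf ef intro: rescale)
  have L: "?L n" for n
  proof (induction n rule: int_induct[where k = 0])
    case base then show ?case using zero by blast
  next
    case (step1 i) then show ?case using step_up[of i] by (simp add: add.commute)
  next
    case (step2 i) then show ?case using step_down[of i] by (simp add: algebra_simps)
  qed
  have loop: "loop n x \<in> S" for n x
  proof -
    have "x = sl2_scale (coord_e x) sl2_e + sl2_scale (coord_f x) sl2_f + sl2_scale (coord_h x) sl2_h"
      by (simp add: sl2_eq_iff)
    then have "loop n x = affine_scale (coord_e x) (loop n sl2_e)
        + affine_scale (coord_f x) (loop n sl2_f) + affine_scale (coord_h x) (loop n sl2_h)"
      by (metis affine_scale_loop loop_add)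
    then show ?thesis using L S by (simp add: affine.subspace_add affine.subspace_scale)
  qed
  show ?thesis
    by (subst affine_expansion[of x], intro affine.subspace_add[OF S] affine.subspace_scale[OF S]
        affine.subspace_sum[OF S] loop c gen)
qed

lemma is_chevalley_theta: "is_chevalley affine_theta"
proof -
  have "bij affine_theta" by (rule involuntory_imp_bij) (rule affine_theta_involution)
  then show ?thesis
    by (auto simp: is_chevalley_def lie_automorphism_def linear_affine_theta affine_theta_bracket
        affine_eq_iff e\<^sub>0_def f\<^sub>0_def h\<^sub>0_def e\<^sub>1_def f\<^sub>1_def h\<^sub>1_def loop_def affine_c_def affine_d_def
        lookup_single lookup_minus when_def sl2_eq_iff)
qed

lemma is_chevalley_unique:
  assumes "is_chevalley \<phi>" "is_chevalley \<psi>"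
  shows "\<phi> = \<psi>"
proof
  fix x
  have lin: "Vector_Spaces.linear affine_scale affine_scale \<phi>"
    "Vector_Spaces.linear affine_scale affine_scale \<psi>"
    using assms by (simp_all add: is_chevalley_def lie_automorphism_def)
  have "x \<in> {x. \<phi> x = \<psi> x}"
  proof (rule affine_generated)
    show "affine.subspace {x. \<phi> x = \<psi> x}"
      using lin by (simp add: Vector_Spaces.linear_iff affine.subspace_def)
        (metis affine.scale_zero_left)
  qed (use assms in \<open>auto simp: is_chevalley_def lie_automorphism_def\<close>)
  then show "\<phi> x = \<psi> x" by simp
qed

theorem chevalley_eq: "chevalley = affine_theta"
  unfolding chevalley_def using is_chevalley_theta is_chevalley_unique by blast

definition fixed_algebra :: "affine set" where
  "fixed_algebra = {x. chevalley x = x}"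

definition B\<^sub>0 :: affine where "B\<^sub>0 = affine_scale \<i> (e\<^sub>0 - f\<^sub>0)"
definition B\<^sub>1 :: affine where "B\<^sub>1 = affine_scale \<i> (e\<^sub>1 - f\<^sub>1)"

section \<open>One-dimensional representations of the fixed Lie algebra\<close>

text \<open>Only the values on \<open>fixed_algebra\<close> matter; the value \<open>0\<close> elsewhere makes the function
  unique. Existence is \<open>chi_is_rep\<close> below.\<close>

definition one_dim_rep :: "(affine \<Rightarrow> complex) \<Rightarrow> bool" where
  "one_dim_rep \<psi> \<longleftrightarrow>
     (\<forall>x\<in>fixed_algebra. \<forall>y\<in>fixed_algebra. \<psi> (x + y) = \<psi> x + \<psi> y)
   \<and> (\<forall>a. \<forall>x\<in>fixed_algebra. \<psi> (affine_scale a x) = a * \<psi> x)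
   \<and> (\<forall>x\<in>fixed_algebra. \<forall>y\<in>fixed_algebra. \<psi> (affine_bracket x y) = \<psi> x * \<psi> y - \<psi> y * \<psi> x)
   \<and> (\<forall>x. x \<notin> fixed_algebra \<longrightarrow> \<psi> x = 0)"

definition chi :: "complex \<Rightarrow> complex \<Rightarrow> affine \<Rightarrow> complex" where
  "chi a b = (THE \<psi>. one_dim_rep \<psi> \<and> \<psi> B\<^sub>0 = a \<and> \<psi> B\<^sub>1 = b)"

lemma fixed_algebra_iff:
  "x \<in> fixed_algebra \<longleftrightarrow> fst (snd x) = 0 \<and> snd (snd x) = 0 \<and>
     (\<forall>n. Poly_Mapping.lookup (fst x) n = sl2_theta (Poly_Mapping.lookup (fst x) (- n)))"
proof -
  have "x \<in> fixed_algebra \<longleftrightarrow> x = affine_theta x"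
    by (auto simp: fixed_algebra_def chevalley_eq)
  also have "\<dots> \<longleftrightarrow> (\<forall>n. Poly_Mapping.lookup (fst x) n
      = sl2_theta (Poly_Mapping.lookup (fst x) (- n))) \<and> fst (snd x) = 0 \<and> snd (snd x) = 0"
    by (subst affine_eq_iff)
      (simp only: affine_theta_sel lookup_loop_theta eq_neg_iff_add_eq_0 mult_2[symmetric]
        mult_eq_0_iff zero_neq_numeral[symmetric] simp_thms)
  finally show ?thesis by blast
qed

lemma fixed_algebra_subspace: "affine.subspace fixed_algebra"
  using linear_affine_theta affine_theta_involution
  by (simp add: fixed_algebra_def chevalley_eq affine.subspace_def Vector_Spaces.linear_iff)
    (metis affine.scale_zero_left)

lemma fixed_algebra_bracket:
  "x \<in> fixed_algebra \<Longrightarrow> y \<in> fixed_algebra \<Longrightarrow> affine_bracket x y \<in> fixed_algebra"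
  by (simp add: fixed_algebra_def chevalley_eq affine_theta_bracket)

text \<open>Evaluation at \<open>t = z\<close>. For \<open>z = 1\<close> and \<open>z = -1\<close> it maps the fixed Lie algebra
  to the abelian Lie algebra spanned by \<open>e - f\<close>.\<close>

definition ev :: "complex \<Rightarrow> (int \<Rightarrow>\<^sub>0 sl2) \<Rightarrow> sl2" where
  "ev z X = (\<Sum>n\<in>Poly_Mapping.keys X. sl2_scale (z powi n) (Poly_Mapping.lookup X n))"

lemma ev_superset:
  assumes "finite S" "Poly_Mapping.keys X \<subseteq> S"
  shows "ev z X = (\<Sum>n\<in>S. sl2_scale (z powi n) (Poly_Mapping.lookup X n))"
  unfolding ev_def using assms by (intro sum.mono_neutral_left) (auto simp: in_keys_iff)

lemma ev_add: "ev z (X + Y) = ev z X + ev z Y"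
proof -
  let ?S = "Poly_Mapping.keys X \<union> Poly_Mapping.keys Y"
  have "finite ?S" by simp
  note ev = ev_superset[OF this]
  show ?thesis
    by (subst (1 2 3) ev)
      (use Poly_Mapping.keys_add[of X Y] in
        \<open>auto simp: lookup_add sl2_eq_iff coord_sum sum.distrib algebra_simps\<close>)
qed

lemma ev_diff: "ev z (X - Y) = ev z X - ev z Y"
  by (metis ev_add diff_add_cancel add_diff_cancel_right')

lemma ev_scale: "ev z (loop_scale a X) = sl2_scale a (ev z X)"
proof -
  have "Poly_Mapping.keys (loop_scale a X) \<subseteq> Poly_Mapping.keys X"
    by (auto simp: in_keys_iff)
  from ev_superset[OF finite_keys this] show ?thesis
    by (simp add: ev_def sl2_eq_iff coord_sum sum_distrib_left algebra_simps)
qed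

lemma ev_single: "ev z (Poly_Mapping.single n x) = sl2_scale (z powi n) x"
  by (subst ev_superset[of "{n}"]) auto

lemma ev_zero: "ev z 0 = 0"
  by (simp add: ev_def)

lemma ev_sum: "ev z (sum g S) = (\<Sum>i\<in>S. ev z (g i))"
  by (induction S rule: infinite_finite_induct) (simp_all add: ev_add ev_zero)

lemma bracket_sum:
  "sl2_bracket (sum g S) (sum g' S') = (\<Sum>i\<in>S. \<Sum>j\<in>S'. sl2_bracket (g i) (g' j))"
proof -
  have L: "sl2_bracket (sum g S) y = (\<Sum>i\<in>S. sl2_bracket (g i) y)" for y
    by (induction S rule: infinite_finite_induct) (simp_all add: sl2_eq_iff algebra_simps)
  have R: "sl2_bracket x (sum g' S') = (\<Sum>j\<in>S'. sl2_bracket x (g' j))" for x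
    by (induction S' rule: infinite_finite_induct) (simp_all add: sl2_eq_iff algebra_simps)
  show ?thesis unfolding L unfolding R by (rule refl)
qed

lemma ev_bracket:
  assumes "z \<noteq> 0"
  shows "ev z (loop_bracket X Y) = sl2_bracket (ev z X) (ev z Y)"
proof -
  have "ev z (loop_bracket X Y) = (\<Sum>m\<in>Poly_Mapping.keys X. \<Sum>n\<in>Poly_Mapping.keys Y.
      sl2_bracket (sl2_scale (z powi m) (Poly_Mapping.lookup X m))
        (sl2_scale (z powi n) (Poly_Mapping.lookup Y n)))"
    unfolding loop_bracket_def ev_sum ev_single
    by (intro sum.cong refl) (use assms in \<open>simp add: sl2_eq_iff power_int_add algebra_simps\<close>)
  also have "\<dots> = sl2_bracket (ev z X) (ev z Y)"
    by (simp add: ev_def bracket_sum)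
  finally show ?thesis .
qed

lemma ev_fixed:
  assumes "x \<in> fixed_algebra" "z = 1 \<or> z = -1"
  shows "ev z (fst x) = sl2_theta (ev z (fst x))"
proof -
  let ?X = "fst x"
  let ?S = "Poly_Mapping.keys ?X"
  have sym: "Poly_Mapping.lookup ?X n = sl2_theta (Poly_Mapping.lookup ?X (- n))" for n
    using assms by (metis fixed_algebra_iff)
  have neg: "- n \<in> ?S" if "n \<in> ?S" for n
    using that sym[of n] by (auto simp: in_keys_iff sl2_eq_iff)
  have S: "uminus ` ?S = ?S"
    using neg by force
  have z: "z powi (- n) = z powi n" for n
    using assms by (auto simp: power_int_minus power_int_minus_left)
  have "ev z ?X = (\<Sum>n\<in>uminus ` ?S. sl2_scale (z powi n) (Poly_Mapping.lookup ?X n))"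
    by (simp add: S ev_def)
  also have "\<dots> = (\<Sum>n\<in>?S. sl2_scale (z powi n) (Poly_Mapping.lookup ?X (- n)))"
    by (subst sum.reindex) (auto simp: z)
  also have "\<dots> = (\<Sum>n\<in>?S. sl2_scale (z powi n) (sl2_theta (Poly_Mapping.lookup ?X n)))"
    by (subst sym) simp
  also have "\<dots> = sl2_theta (ev z ?X)"
    by (simp add: sl2_eq_iff ev_def coord_sum sum_negf)
  finally show ?thesis .
qed

lemma ev_fixed_coord:
  assumes "x \<in> fixed_algebra" "z = 1 \<or> z = -1"
  shows "coord_h (ev z (fst x)) = 0" "coord_f (ev z (fst x)) = - coord_e (ev z (fst x))"
  using arg_cong[OF ev_fixed[OF assms], of coord_h] arg_cong[OF ev_fixed[OF assms], of coord_f]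
  by (simp_all add: eq_neg_iff_add_eq_0 flip: mult_2)

lemma B_fixed: "B\<^sub>0 \<in> fixed_algebra" "B\<^sub>1 \<in> fixed_algebra"
  by (auto simp: B\<^sub>0_def B\<^sub>1_def fixed_algebra_iff e\<^sub>0_def f\<^sub>0_def e\<^sub>1_def f\<^sub>1_def loop_def
      lookup_minus lookup_single when_def sl2_eq_iff)

lemma one_dim_rep_exists: "\<exists>\<psi>. one_dim_rep \<psi> \<and> \<psi> B\<^sub>0 = a \<and> \<psi> B\<^sub>1 = b"
proof -
  define p q where "p = \<i> * (a - b) / 2" and "q = - \<i> * (a + b) / 2"
  define \<psi> where "\<psi> x = (if x \<in> fixed_algebra
    then p * coord_e (ev 1 (fst x)) + q * coord_e (ev (-1) (fst x)) else 0)" for x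
  have br: "ev z (fst (affine_bracket x y)) = 0"
    if "x \<in> fixed_algebra" "y \<in> fixed_algebra" "z = 1 \<or> z = -1" for x y z
  proof -
    have "fst (affine_bracket x y) = loop_bracket (fst x) (fst y)"
    proof -
      have "snd (snd x) = 0" "snd (snd y) = 0" using that by (metis fixed_algebra_iff)+
      then show ?thesis
        by (auto simp: sl2_eq_iff lookup_add lookup_minus intro!: poly_mapping_eqI)
    qed
    moreover have "z \<noteq> 0" using that by auto
    ultimately have "ev z (fst (affine_bracket x y)) = sl2_bracket (ev z (fst x)) (ev z (fst y))"
      by (simp add: ev_bracket)
    also have "\<dots> = 0"
      using that by (simp add: sl2_eq_iff ev_fixed_coord)
    finally show ?thesis .
  qed
  have "\<psi> (affine_bracket x y) = 0" if "x \<in> fixed_algebra" "y \<in> fixed_algebra" for x y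
    using that by (simp add: \<psi>_def br fixed_algebra_bracket del: affine_bracket_sel)
  then have "one_dim_rep \<psi>"
    by (simp add: one_dim_rep_def) (simp add: \<psi>_def fixed_algebra_bracket ev_add ev_scale
        affine.subspace_add[OF fixed_algebra_subspace]
        affine.subspace_scale[OF fixed_algebra_subspace] algebra_simps)
  moreover have "ev z (fst B\<^sub>0) = sl2_scale \<i> (sl2_scale z sl2_f - sl2_scale (inverse z) sl2_e)"
    "ev z (fst B\<^sub>1) = sl2_scale \<i> (sl2_e - sl2_f)" for z
    by (simp_all add: ev_diff B\<^sub>0_def B\<^sub>1_def ev_scale e\<^sub>0_def f\<^sub>0_def e\<^sub>1_def f\<^sub>1_def loop_def ev_single
        sl2_eq_iff power_int_minus)
  ultimately show ?thesis
    by (intro exI[of _ \<psi>]) (simp add: \<psi>_def B_fixed p_def q_def field_simps)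
qed

lemma one_dim_rep_unique:
  assumes \<psi>: "one_dim_rep \<psi>" and \<eta>: "one_dim_rep \<eta>"
    and B: "\<psi> B\<^sub>0 = \<eta> B\<^sub>0" "\<psi> B\<^sub>1 = \<eta> B\<^sub>1"
  shows "\<psi> = \<eta>"
proof
  fix x
  define S where "S = {x \<in> fixed_algebra. \<psi> x = \<eta> x}"
  define A where "A n = loop n sl2_e - loop (- n) sl2_f" for n
  define G where "G n = loop n sl2_h - loop (- n) sl2_h" for n
  note k_add = affine.subspace_add[OF fixed_algebra_subspace]
  note k_scale = affine.subspace_scale[OF fixed_algebra_subspace]
  have zero: "\<psi> 0 = 0" if "one_dim_rep \<psi>" for \<psi>
  proof -
    have "\<psi> (affine_scale 0 0) = 0 * \<psi> 0"
      using that affine.subspace_0[OF fixed_algebra_subspace] unfolding one_dim_rep_def by blast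
    then show ?thesis by simp
  qed
  have S: "affine.subspace S"
    unfolding affine.subspace_def S_def
  proof (intro conjI ballI allI)
    show "0 \<in> {x \<in> fixed_algebra. \<psi> x = \<eta> x}"
      using zero[OF \<psi>] zero[OF \<eta>] affine.subspace_0[OF fixed_algebra_subspace] by simp
    fix x assume x: "x \<in> {x \<in> fixed_algebra. \<psi> x = \<eta> x}"
    then show "affine_scale c x \<in> {x \<in> fixed_algebra. \<psi> x = \<eta> x}" for c
      using \<psi> \<eta> k_scale[of x c] unfolding one_dim_rep_def by force
    fix y assume "y \<in> {x \<in> fixed_algebra. \<psi> x = \<eta> x}"
    then show "x + y \<in> {x \<in> fixed_algebra. \<psi> x = \<eta> x}"
      using \<psi> \<eta> k_add[of x y] x unfolding one_dim_rep_def by force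
  qed
  have br: "affine_bracket x y \<in> S" if "x \<in> fixed_algebra" "y \<in> fixed_algebra" for x y
  proof -
    have "\<psi> (affine_bracket x y) = \<psi> x * \<psi> y - \<psi> y * \<psi> x"
      "\<eta> (affine_bracket x y) = \<eta> x * \<eta> y - \<eta> y * \<eta> x"
      using that \<psi> \<eta> unfolding one_dim_rep_def by blast+
    then show ?thesis using that by (simp add: S_def fixed_algebra_bracket)
  qed
  have Ak: "A n \<in> fixed_algebra" and Gk: "G n \<in> fixed_algebra" for n
    by (auto simp: A_def G_def fixed_algebra_iff loop_def lookup_minus lookup_single when_def
        sl2_eq_iff)
  have BS: "B\<^sub>0 \<in> S" "B\<^sub>1 \<in> S"
    using B B_fixed by (simp_all add: S_def)
  have "A 0 = affine_scale (- \<i>) B\<^sub>1"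
    by (auto simp: A_def B\<^sub>1_def e\<^sub>1_def f\<^sub>1_def)
  then have A0: "A 0 \<in> S"
    using affine.subspace_scale[OF S BS(2), of "- \<i>"] by (simp only:)
  have "A (- 1) = affine_scale \<i> B\<^sub>0"
    by (auto simp: A_def B\<^sub>0_def e\<^sub>0_def f\<^sub>0_def)
  then have A1: "A (- 1) \<in> S"
    using affine.subspace_scale[OF S BS(1), of \<i>] by (simp only:)
  have G: "affine_scale (- 1) (affine_bracket (A n) (A 0)) = G n" for n
    unfolding A_def G_def affine_bracket_diff affine_bracket_loop
    by (auto simp: affine_eq_iff loop_def affine_c_def
        lookup_minus lookup_add lookup_single when_def sl2_eq_iff sl2_form_coord)
  have GA: "affine_scale (1 / 2) (affine_bracket (G 1) (A n)) = A (n + 1) - A (n - 1)" for n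
    unfolding A_def G_def affine_bracket_diff affine_bracket_loop
    by (auto simp: affine_eq_iff loop_def affine_c_def
        lookup_minus lookup_add lookup_single when_def sl2_eq_iff sl2_form_coord)
  have GS: "G n \<in> S" for n
    using affine.subspace_scale[OF S br[OF Ak Ak], of "- 1" n 0] by (simp only: G)
  have AS: "A (n + 1) - A (n - 1) \<in> S" for n
    using affine.subspace_scale[OF S br[OF Gk Ak], of "1 / 2" 1 n] by (simp only: GA)
  have A: "A n \<in> S \<and> A (n - 1) \<in> S" for n
  proof (induction n rule: int_induct[where k = 0])
    case base then show ?case using A0 A1 by simp
  next
    case (step1 i) then show ?case
      using affine.subspace_add[OF S AS[of i], of "A (i - 1)"] by simp
  next
    case (step2 i) then show ?case
      using affine.subspace_diff[OF S _ AS[of "i - 1"], of "A i"] by simp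
  qed
  show "\<psi> x = \<eta> x"
  proof (cases "x \<in> fixed_algebra")
    case True
    let ?X = "Poly_Mapping.lookup (fst x)" and ?S = "Poly_Mapping.keys (fst x)"
    have sym: "?X n = sl2_theta (?X (- n))" for n
      using True by (metis fixed_algebra_iff)
    have "x = (\<Sum>n\<in>?S. affine_scale (coord_e (?X n)) (A n))
      + (\<Sum>n\<in>{n\<in>?S. n > 0}. affine_scale (coord_h (?X n)) (G n))" (is "_ = ?R")
    proof -
      have A: "coord_e (Poly_Mapping.lookup (fst (A n)) k) = (if n = k then 1 else 0)"
          "coord_f (Poly_Mapping.lookup (fst (A n)) k) = (if n = - k then - 1 else 0)"
          "coord_h (Poly_Mapping.lookup (fst (A n)) k) = 0" for n k
        by (auto simp: A_def loop_def lookup_minus lookup_single when_def)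
      have G: "coord_e (Poly_Mapping.lookup (fst (G n)) k) = 0"
          "coord_f (Poly_Mapping.lookup (fst (G n)) k) = 0"
          "coord_h (Poly_Mapping.lookup (fst (G n)) k)
            = (if n = k then 1 else 0) - (if n = - k then 1 else 0)" for n k
        by (auto simp: G_def loop_def lookup_minus lookup_single when_def)
      have R: "fst (snd ?R) = 0" "snd (snd ?R) = 0"
        by (simp_all add: snd_sum fst_sum A_def G_def loop_def)
      have RX: "Poly_Mapping.lookup (fst ?R) k = ?X k" for k
      proof -
        have "coord_e (Poly_Mapping.lookup (fst ?R) k)
            = (\<Sum>n\<in>?S. coord_e (?X n) * (if n = k then 1 else 0))"
          by (simp add: fst_sum lookup_add lookup_sum coord_sum A G)
        also have "\<dots> = (\<Sum>n\<in>?S. if n = k then coord_e (?X k) else 0)"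
          by (rule sum.cong) auto
        finally have e: "coord_e (Poly_Mapping.lookup (fst ?R) k) = \<dots>" .
        have "coord_f (Poly_Mapping.lookup (fst ?R) k)
            = (\<Sum>n\<in>?S. coord_e (?X n) * (if n = - k then - 1 else 0))"
          by (simp add: fst_sum lookup_add lookup_sum coord_sum A G)
        also have "\<dots> = (\<Sum>n\<in>?S. if n = - k then - coord_e (?X (- k)) else 0)"
          by (rule sum.cong) auto
        finally have f: "coord_f (Poly_Mapping.lookup (fst ?R) k) = \<dots>" .
        have "coord_h (Poly_Mapping.lookup (fst ?R) k)
            = (\<Sum>n\<in>{n\<in>?S. n > 0}. coord_h (?X n)
                * ((if n = k then 1 else 0) - (if n = - k then 1 else 0)))"
          by (simp add: fst_sum lookup_add lookup_sum coord_sum A G)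
        also have "\<dots> = (\<Sum>n\<in>{n\<in>?S. n > 0}. (if n = k then coord_h (?X k) else 0)
              - (if n = - k then coord_h (?X (- k)) else 0))"
          by (rule sum.cong) auto
        finally have h: "coord_h (Poly_Mapping.lookup (fst ?R) k) = \<dots>" .
        have "coord_e (Poly_Mapping.lookup (fst ?R) k) = coord_e (?X k)"
          "coord_f (Poly_Mapping.lookup (fst ?R) k) = - coord_e (?X (- k))"
          "coord_h (Poly_Mapping.lookup (fst ?R) k)
            = (if k > 0 then coord_h (?X k) else 0) - (if k < 0 then coord_h (?X (- k)) else 0)"
          unfolding e f h by (auto simp: sum_subtractf sum.delta in_keys_iff)
        moreover have "- coord_e (?X (- k)) = coord_f (?X k)"
          by (subst (2) sym) simp
        moreover have h: "- coord_h (?X (- k)) = coord_h (?X k)" for k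
          by (subst (2) sym) simp
        have "coord_h (?X 0) = 0"
          using h[of 0] by (simp add: neg_eq_iff_add_eq_0 flip: mult_2)
        then have "(if k > 0 then coord_h (?X k) else 0)
            - (if k < 0 then coord_h (?X (- k)) else 0) = coord_h (?X k)"
          using h[of k] by (cases "k = 0") auto
        ultimately show ?thesis
          unfolding sl2_eq_iff by (simp only:)
      qed
      have "fst (snd x) = 0" "snd (snd x) = 0"
        using True by (metis fixed_algebra_iff)+
      then show ?thesis
        by (subst affine_eq_iff) (simp only: R RX simp_thms)
    qed
    also have "\<dots> \<in> S"
      by (intro affine.subspace_add[OF S] affine.subspace_sum[OF S] affine.subspace_scale[OF S]
          GS A[THEN conjunct1])
    finally show ?thesis by (simp add: S_def)
  next
    case False
    then have "\<psi> x = 0" "\<eta> x = 0"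
      using \<psi> \<eta> unfolding one_dim_rep_def by blast+
    then show ?thesis by simp
  qed
qed

theorem chi_is_rep: "one_dim_rep (chi a b)" "chi a b B\<^sub>0 = a" "chi a b B\<^sub>1 = b"
proof -
  have "\<exists>!\<psi>. one_dim_rep \<psi> \<and> \<psi> B\<^sub>0 = a \<and> \<psi> B\<^sub>1 = b"
    by (rule ex_ex1I[OF one_dim_rep_exists]) (metis one_dim_rep_unique)
  from theI'[OF this] show "one_dim_rep (chi a b)" "chi a b B\<^sub>0 = a" "chi a b B\<^sub>1 = b"
    by (simp_all add: chi_def)
qed

section \<open>Weights\<close>

definition cartan :: "affine set" where
  "cartan = affine.span {h\<^sub>0, h\<^sub>1, affine_d}"

text \<open>A functional on \<open>cartan\<close> is represented by its extension by \<open>0\<close>, so that equality of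
  functionals is equality of HOL functions.\<close>

definition cartan_dual :: "(affine \<Rightarrow> complex) set" where
  "cartan_dual = {\<mu>. (\<forall>x\<in>cartan. \<forall>y\<in>cartan. \<mu> (x + y) = \<mu> x + \<mu> y)
     \<and> (\<forall>a. \<forall>x\<in>cartan. \<mu> (affine_scale a x) = a * \<mu> x) \<and> (\<forall>x. x \<notin> cartan \<longrightarrow> \<mu> x = 0)}"

definition weight_lattice :: "(affine \<Rightarrow> complex) set" where
  "weight_lattice = {\<mu> \<in> cartan_dual. \<mu> h\<^sub>0 \<in> \<int> \<and> \<mu> h\<^sub>1 \<in> \<int> \<and> \<mu> affine_d \<in> \<int>}"

definition dominant_weights :: "(affine \<Rightarrow> complex) set" where
  "dominant_weights = {\<mu> \<in> weight_lattice. \<mu> h\<^sub>0 \<in> \<nat> \<and> \<mu> h\<^sub>1 \<in> \<nat>}"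

section \<open>Modules\<close>

text \<open>The underlying vector space is the whole type \<open>'v\<close>, with scalar multiplication \<open>s\<close>.\<close>

definition affine_module ::
    "(complex \<Rightarrow> 'v \<Rightarrow> 'v) \<Rightarrow> (affine \<Rightarrow> 'v \<Rightarrow> 'v::ab_group_add) \<Rightarrow> bool" where
  "affine_module s \<rho> \<longleftrightarrow> vector_space s
     \<and> (\<forall>x. Vector_Spaces.linear s s (\<rho> x))
     \<and> (\<forall>x y v. \<rho> (x + y) v = \<rho> x v + \<rho> y v)
     \<and> (\<forall>a x v. \<rho> (affine_scale a x) v = s a (\<rho> x v))
     \<and> (\<forall>x y v. \<rho> (affine_bracket x y) v = \<rho> x (\<rho> y v) - \<rho> y (\<rho> x v))"

definition submodule ::
    "(complex \<Rightarrow> 'v \<Rightarrow> 'v) \<Rightarrow> (affine \<Rightarrow> 'v \<Rightarrow> 'v::ab_group_add) \<Rightarrow> 'v set \<Rightarrow> bool" where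
  "submodule s \<rho> U \<longleftrightarrow> module.subspace s U \<and> (\<forall>x. \<forall>u\<in>U. \<rho> x u \<in> U)"

definition irreducible_module ::
    "(complex \<Rightarrow> 'v \<Rightarrow> 'v) \<Rightarrow> (affine \<Rightarrow> 'v \<Rightarrow> 'v::ab_group_add) \<Rightarrow> bool" where
  "irreducible_module s \<rho> \<longleftrightarrow> affine_module s \<rho> \<and> (UNIV :: 'v set) \<noteq> {0}
     \<and> (\<forall>U. submodule s \<rho> U \<longrightarrow> U = {0} \<or> U = UNIV)"

definition weight_space ::
    "(complex \<Rightarrow> 'v \<Rightarrow> 'v) \<Rightarrow> (affine \<Rightarrow> 'v \<Rightarrow> 'v) \<Rightarrow> (affine \<Rightarrow> complex) \<Rightarrow> 'v set" where
  "weight_space s \<rho> \<mu> = {v. \<forall>h\<in>cartan. \<rho> h v = s (\<mu> h) v}"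

text \<open>The upper triangular subalgebra is generated by \<open>e\<^sub>0\<close> and \<open>e\<^sub>1\<close>.\<close>

definition highest_weight_vector ::
    "(complex \<Rightarrow> 'v \<Rightarrow> 'v) \<Rightarrow> (affine \<Rightarrow> 'v \<Rightarrow> 'v::ab_group_add) \<Rightarrow> (affine \<Rightarrow> complex) \<Rightarrow> 'v \<Rightarrow> bool"
  where
  "highest_weight_vector s \<rho> \<mu> v \<longleftrightarrow>
     v \<noteq> 0 \<and> v \<in> weight_space s \<rho> \<mu> \<and> \<rho> e\<^sub>0 v = 0 \<and> \<rho> e\<^sub>1 v = 0"

definition highest_weight_module ::
    "(complex \<Rightarrow> 'v \<Rightarrow> 'v) \<Rightarrow> (affine \<Rightarrow> 'v \<Rightarrow> 'v::ab_group_add) \<Rightarrow> (affine \<Rightarrow> complex) \<Rightarrow> bool" where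
  "highest_weight_module s \<rho> \<mu> \<longleftrightarrow> affine_module s \<rho> \<and> (\<exists>v. highest_weight_vector s \<rho> \<mu> v
     \<and> (\<forall>U. submodule s \<rho> U \<and> v \<in> U \<longrightarrow> U = UNIV))"

text \<open>Integrable in the sense of Kac: the Cartan subalgebra acts diagonalizably and the Chevalley
  generators act locally nilpotently.\<close>

definition integrable_module ::
    "(complex \<Rightarrow> 'v \<Rightarrow> 'v) \<Rightarrow> (affine \<Rightarrow> 'v \<Rightarrow> 'v::ab_group_add) \<Rightarrow> bool" where
  "integrable_module s \<rho> \<longleftrightarrow> affine_module s \<rho>
     \<and> module.span s (\<Union>\<mu>\<in>cartan_dual. weight_space s \<rho> \<mu>) = UNIV
     \<and> (\<forall>x\<in>{e\<^sub>0, f\<^sub>0, e\<^sub>1, f\<^sub>1}. \<forall>v. \<exists>n. (\<rho> x ^^ n) v = 0)"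

text \<open>\<open>(s, \<rho>)\<close> is a model of \<open>V(\<mu>)\<close>, which is determined up to isomorphism.\<close>

definition is_V ::
    "(complex \<Rightarrow> 'v \<Rightarrow> 'v) \<Rightarrow> (affine \<Rightarrow> 'v \<Rightarrow> 'v::ab_group_add) \<Rightarrow> (affine \<Rightarrow> complex) \<Rightarrow> bool" where
  "is_V s \<rho> \<mu> \<longleftrightarrow>
     integrable_module s \<rho> \<and> irreducible_module s \<rho> \<and> highest_weight_module s \<rho> \<mu>"

section \<open>The completion\<close>

text \<open>Elements of the product of the weight spaces are families indexed by the weight lattice,
  extended by \<open>0\<close>.\<close>

definition completion ::
    "(complex \<Rightarrow> 'v \<Rightarrow> 'v) \<Rightarrow> (affine \<Rightarrow> 'v \<Rightarrow> 'v::ab_group_add) \<Rightarrow> ((affine \<Rightarrow> complex) \<Rightarrow> 'v) set"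
  where
  "completion s \<rho> = {F. (\<forall>\<mu>\<in>weight_lattice. F \<mu> \<in> weight_space s \<rho> \<mu>)
     \<and> (\<forall>\<mu>. \<mu> \<notin> weight_lattice \<longrightarrow> F \<mu> = 0)}"

definition pointwise_scale :: "(complex \<Rightarrow> 'v \<Rightarrow> 'v) \<Rightarrow> complex \<Rightarrow> ('i \<Rightarrow> 'v) \<Rightarrow> ('i \<Rightarrow> 'v)" where
  "pointwise_scale s a F = (\<lambda>\<mu>. s a (F \<mu>))"

text \<open>The projection of \<open>V\<close> onto its \<open>\<mu>\<close>-weight space along the other weight spaces.\<close>

definition weight_projection ::
    "(complex \<Rightarrow> 'v \<Rightarrow> 'v) \<Rightarrow> (affine \<Rightarrow> 'v \<Rightarrow> 'v::ab_group_add) \<Rightarrow> (affine \<Rightarrow> complex) \<Rightarrow> 'v \<Rightarrow> 'v"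
  where
  "weight_projection s \<rho> \<mu> v = (THE w. w \<in> weight_space s \<rho> \<mu>
     \<and> v - w \<in> module.span s (\<Union>\<nu>\<in>cartan_dual - {\<mu>}. weight_space s \<rho> \<nu>))"

text \<open>The \<open>\<mu>\<close>-component of \<open>x F\<close> is the sum of the \<open>\<mu>\<close>-components of all \<open>x F\<^sub>\<nu>\<close>. Only finitely
  many of these are nonzero, since \<open>x\<close> has components in only finitely many root spaces.\<close>

definition completion_action ::
    "(complex \<Rightarrow> 'v \<Rightarrow> 'v) \<Rightarrow> (affine \<Rightarrow> 'v \<Rightarrow> 'v::ab_group_add)
      \<Rightarrow> affine \<Rightarrow> ((affine \<Rightarrow> complex) \<Rightarrow> 'v) \<Rightarrow> ((affine \<Rightarrow> complex) \<Rightarrow> 'v)" where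
  "completion_action s \<rho> x F = (\<lambda>\<mu>.
     \<Sum>\<nu> | \<nu> \<in> weight_lattice \<and> weight_projection s \<rho> \<mu> (\<rho> x (F \<nu>)) \<noteq> 0.
       weight_projection s \<rho> \<mu> (\<rho> x (F \<nu>)))"

definition rep_invariants ::
    "'w set \<Rightarrow> (complex \<Rightarrow> 'w \<Rightarrow> 'w) \<Rightarrow> (affine \<Rightarrow> 'w \<Rightarrow> 'w) \<Rightarrow> (affine \<Rightarrow> complex) \<Rightarrow> 'w set" where
  "rep_invariants W s act \<psi> = {w \<in> W. \<forall>x\<in>fixed_algebra. act x w = s (\<psi> x) w}"

definition completion_invariants ::
    "(complex \<Rightarrow> 'v \<Rightarrow> 'v) \<Rightarrow> (affine \<Rightarrow> 'v \<Rightarrow> 'v::ab_group_add) \<Rightarrow> (affine \<Rightarrow> complex)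
      \<Rightarrow> ((affine \<Rightarrow> complex) \<Rightarrow> 'v) set" where
  "completion_invariants s \<rho> \<psi> =
     rep_invariants (completion s \<rho>) (pointwise_scale s) (completion_action s \<rho>) \<psi>"

text \<open>The library's dimension of an infinite-dimensional space is \<open>0\<close>, so finite-dimensionality
  is demanded explicitly.\<close>

definition has_dim :: "(complex \<Rightarrow> 'w \<Rightarrow> 'w) \<Rightarrow> 'w::ab_group_add set \<Rightarrow> nat \<Rightarrow> bool" where
  "has_dim s W n \<longleftrightarrow> (\<exists>B. finite B \<and> W \<subseteq> module.span s B) \<and> vector_space.dim s W = n"

end

theory Submission
  imports Defs
begin

text \<open>An element of the completion is a family \<open>\<Phi>\<close> of weight vectors, and invariance under the
  whole fixed subalgebra amounts to the two equations given by \<open>B\<^sub>0\<close> and \<open>B\<^sub>1\<close>. These prescribe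
  \<open>e\<^sub>0 \<Phi>\<^sub>\<mu>\<close> and \<open>e\<^sub>1 \<Phi>\<^sub>\<mu>\<close> in terms of components of larger weight. As \<open>V(\<lambda>)\<close> has no singular vectors
  besides the highest weight vectors, \<open>\<Phi>\<close> is determined by \<open>\<Phi>\<^sub>\<lambda>\<close>. Along the string
  \<open>\<lambda> - j \<alpha>\<^sub>i\<close> the equations become a three-term recursion, whose generating function
  \<open>(1 + \<i>z)\<^sup>p (1 - \<i>z)\<^sup>q\<close> with \<open>p + q = \<lambda>(h\<^sub>i)\<close> and \<open>q - p = a\<^sub>i\<close> has to be a polynomial: this is the
  parity condition. Conversely, suppose that \<open>\<Phi>\<close> has been constructed above \<open>\<mu>\<close>. The prescribed values
  extend to a 1-cocycle of the upper triangular subalgebra in \<open>V(\<lambda>)\<close>, and the Casimir element provides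
  a homotopy showing that it is a coboundary as soon as \<open>|\<mu> + \<rho>|\<^sup>2 \<noteq> |\<lambda> + \<rho>|\<^sup>2\<close>. If the
  norms agree, a reflection argument leaves only \<open>\<mu> = \<lambda> - (\<lambda>(h\<^sub>i) + 1) \<alpha>\<^sub>i\<close>, where the prescribed value
  is zero by the parity condition. Thus no Verma module is needed.\<close>

section \<open>A three-term recursion\<close>

text \<open>The obstacle is that one new component has to meet both equations at once, and values
  prescribed separately for e_0 w and e_1 w are in general incompatible with the Serre relations.
  Here the prescribed values measure how an already constructed family fails to be invariant one
  step further down, so the brackets of the fixed subalgebra supply the compatibility for every root
  vector of the upper triangular subalgebra, imaginary roots included. The homotopy is the sum over
  dual bases from the Casimir element with its raising factors replaced by cocycle values; a raising
  generator applied to it reproduces the Casimir element acting on the prescribed value. The norms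
  matter only where a prescribed value is nonzero: the simple reflection of its weight is then a
  weight of V(lambda) with the same norm as lambda after the shift by rho, and lambda is the only
  such weight.\<close>

text \<open>If \<open>\<Phi>\<^sub>j\<close> denotes the component of an invariant at \<open>\<lambda> - j \<alpha>\<^sub>i\<close>, \<open>v\<close> the highest weight vector and
  \<open>l = \<lambda>(h\<^sub>i)\<close>, then \<open>\<Phi>\<^sub>j = string_coeff l (- \<i> a\<^sub>i) j * ((l - j)! / l!) f\<^sub>i\<^sup>j v\<close> for \<open>j \<le> l\<close>. With this
  normalization the recursion makes sense beyond \<open>j = l\<close>, and the generating function \<open>G\<close> satisfies
  \<open>(1 + z\<^sup>2) G' = (a + l z) G\<close>.\<close>

fun string_coeff :: "nat \<Rightarrow> complex \<Rightarrow> nat \<Rightarrow> complex" where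
  "string_coeff l a 0 = 1"
| "string_coeff l a (Suc 0) = a"
| "string_coeff l a (Suc (Suc j)) =
     ((of_nat l - of_nat j) * string_coeff l a j + a * string_coeff l a (Suc j)) / of_nat (j + 2)"

lemma string_coeff_Suc:
  "of_nat (Suc j) * string_coeff l a (Suc j)
    = (if j = 0 then 0 else (of_nat l - of_nat j + 1) * string_coeff l a (j - 1)) + a * string_coeff l a j"
proof (cases j)
  case (Suc i)
  have "of_nat (i + 2) \<noteq> (0::complex)" unfolding of_nat_eq_0_iff by simp
  then show ?thesis using Suc by (simp add: field_simps)
qed simp

text \<open>Comparison of coefficients. Since \<open>G\<close> is a polynomial, the hypothesis
  includes that the sequence terminates.\<close>

lemma string_coeff_ode:
  assumes "\<And>j. coeff G j = string_coeff l a j"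
  shows "[:1, 0, 1:] * pderiv G = [:a, of_nat l:] * G"
proof (rule poly_eqI)
  fix j
  consider "j = 0" | "j = 1" | i where "j = Suc (Suc i)" by (metis One_nat_def not0_implies_Suc)
  then show "coeff ([:1, 0, 1:] * pderiv G) j = coeff ([:a, of_nat l:] * G) j"
  proof cases
    case 3
    then show ?thesis using string_coeff_Suc[of "Suc (Suc i)" l a]
      by (simp add: coeff_pderiv assms algebra_simps del: string_coeff.simps)
  qed (use string_coeff_Suc[of 0 l a] string_coeff_Suc[of 1 l a] in
        \<open>simp_all add: coeff_pderiv assms algebra_simps del: string_coeff.simps\<close>)
qed

text \<open>The logarithmic derivative G'/G equals (a + c z) / ((z - r)(z + r)). Its residue at r is
  the order of the zero of G there. The proof avoids fractions by cancelling the power of z - r and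
  evaluating at r.\<close>

lemma ode_root_order:
  fixes G :: "complex poly"
  assumes ode: "[:- r, 1:] * [:r, 1:] * pderiv G = [:a, c:] * G" and G: "G \<noteq> 0" and r: "r \<noteq> 0"
  shows "2 * r * of_nat (order r G) = a + c * r"
proof -
  define n where "n = order r G"
  obtain H where H: "G = [:- r, 1:] ^ n * H" and "\<not> [:- r, 1:] dvd H"
    using order_decomp[OF G] n_def by blast
  then have Hr: "poly H r \<noteq> 0" by (simp add: poly_eq_0_iff_dvd)
  have d: "[:- r, 1:] * pderiv G = [:- r, 1:] ^ n * (smult (of_nat n) H + [:- r, 1:] * pderiv H)"
  proof (cases n)
    case (Suc k)
    have "pderiv ([:- r, 1:] ^ Suc k) = smult (of_nat (Suc k)) ([:- r, 1:] ^ k)"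
      unfolding pderiv_power_Suc by (simp add: pderiv_pCons del: of_nat_Suc)
    then show ?thesis unfolding H Suc pderiv_mult
      by (simp add: algebra_simps smult_add_right del: mult_pCons_left mult_pCons_right of_nat_Suc)
  qed (simp add: H)
  have "[:- r, 1:] ^ n * ([:r, 1:] * (smult (of_nat n) H + [:- r, 1:] * pderiv H))
    = [:r, 1:] * ([:- r, 1:] * pderiv G)"
    unfolding d by (simp only: ac_simps)
  also have "\<dots> = [:a, c:] * G" using ode by (simp only: ac_simps)
  also have "\<dots> = [:- r, 1:] ^ n * ([:a, c:] * H)" unfolding H by (simp only: ac_simps)
  finally have "[:r, 1:] * (smult (of_nat n) H + [:- r, 1:] * pderiv H) = [:a, c:] * H"
    using mult_left_cancel[of "[:- r, 1:] ^ n"] by simp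
  from arg_cong[OF this, of "\<lambda>P. poly P r"]
  have "2 * r * of_nat n * poly H r = (a + c * r) * poly H r"
    by (simp add: algebra_simps)
  then show ?thesis using Hr by (simp add: n_def)
qed

lemma linear_power_ode:
  fixes c d :: complex
  shows "[:c, d:] * pderiv ([:c, d:] ^ n) = smult (d * of_nat n) ([:c, d:] ^ n)"
proof (cases n)
  case (Suc k)
  have "smult (of_nat (Suc k)) P * [:d:] = smult (of_nat (Suc k) * d) P" for P :: "complex poly"
    by (simp add: mult.commute del: of_nat_Suc)
  moreover have "pderiv [:c, d:] = [:d:]" by (simp add: pderiv_pCons)
  ultimately have "pderiv ([:c, d:] ^ Suc k) = smult (of_nat (Suc k) * d) ([:c, d:] ^ k)"
    unfolding pderiv_power_Suc by (simp only:)
  then show ?thesis unfolding Suc by (simp only: power_Suc mult_smult_right ac_simps)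
qed simp

text \<open>If the sequence terminates, its generating polynomial can vanish at \<i> and - \<i> only
  to the orders p and q dictated by the differential equation, and orders are natural numbers.
  Conversely, the product with these orders solves the equation, and the recursion has only one
  solution starting with 1.\<close>

lemma string_coeff_terminates_iff:
  "string_coeff l (- \<i> * a) (Suc l) = 0 \<longleftrightarrow>
    (\<exists>p q::nat. of_nat l - a = 2 * of_nat p \<and> of_nat l + a = 2 * of_nat q)"
  (is "?g (Suc l) = 0 \<longleftrightarrow> ?R")
proof
  assume 0: "?g (Suc l) = 0"
  \<comment> \<open>A recursion with two predecessors normally needs two consecutive zeros. Here one
    zero at index l + 1 suffices, because the factor l - j vanishes at j = l.\<close>
  have step: "?g (Suc (Suc j)) = 0" if "?g j = 0 \<or> j = l" "?g (Suc j) = 0" for j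
    using that by auto
  have tail: "?g (Suc (l + j)) = 0 \<and> ?g (Suc (Suc (l + j))) = 0" for j
    by (induction j) (use 0 step[of l] step in \<open>simp_all del: string_coeff.simps\<close>)
  have tail: "?g j = 0" if "j > l" for j
    using that tail[of "j - Suc l"] by simp
  define G where "G = Poly (map ?g [0..<Suc l])"
  have G: "coeff G j = ?g j" for j
    using tail[of j] by (auto simp: G_def coeff_Poly_eq nth_default_def simp del: upt_Suc)
  then have "G \<noteq> 0" by (metis coeff_0 string_coeff.simps(1) zero_neq_one)
  have "[:- r, 1:] * [:r, 1:] * pderiv G = [:- \<i> * a, of_nat l:] * G" if "r * r = -1" for r
  proof -
    have "[:- r, 1:] * [:r, 1:] = [:1, 0, 1:]" using that by simp
    then show ?thesis using string_coeff_ode[OF G] by simp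
  qed
  from ode_root_order[OF this \<open>G \<noteq> 0\<close>, of \<i>] ode_root_order[OF this \<open>G \<noteq> 0\<close>, of "- \<i>"]
  have "\<i> * (2 * of_nat (order \<i> G)) = \<i> * (of_nat l - a)"
    "\<i> * (2 * of_nat (order (- \<i>) G)) = \<i> * (of_nat l + a)"
    by (simp_all add: algebra_simps)
  then have "of_nat l - a = 2 * of_nat (order \<i> G)" "of_nat l + a = 2 * of_nat (order (- \<i>) G)"
    by simp_all
  then show ?R by blast
next
  assume ?R
  then obtain p q :: nat where pq: "of_nat l - a = 2 * of_nat p" "of_nat l + a = 2 * of_nat q" by blast
  have "2 * of_nat l = (of_nat l - a) + (of_nat l + a)" by simp
  also have "\<dots> = 2 * of_nat (p + q)" unfolding pq by simp
  finally have "of_nat l = (of_nat (p + q) :: complex)" by (simp only: mult_cancel_left) simp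
  then have l: "l = p + q" using of_nat_eq_iff by blast
  have a: "a = of_nat q - of_nat p" using pq l by (simp add: algebra_simps)
  \<comment> \<open>The factor 1 + \<i> z vanishes at z = \<i>, so p is the order at \<i>, as in the
    other direction.\<close>
  define G where "G = [:1, \<i>:] ^ p * [:1, - \<i>:] ^ q"
  have d: "[:1, \<i>:] * pderiv ([:1, \<i>:] ^ p) = smult (\<i> * of_nat p) ([:1, \<i>:] ^ p)"
    "[:1, - \<i>:] * pderiv ([:1, - \<i>:] ^ q) = smult (- \<i> * of_nat q) ([:1, - \<i>:] ^ q)"
    by (simp_all only: linear_power_ode)
  have "[:1, 0, 1:] * pderiv G
    = ([:1, \<i>:] * pderiv ([:1, \<i>:] ^ p)) * ([:1, - \<i>:] * [:1, - \<i>:] ^ q)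
      + ([:1, \<i>:] * [:1, \<i>:] ^ p) * ([:1, - \<i>:] * pderiv ([:1, - \<i>:] ^ q))"
  proof -
    have "[:1, 0, 1:] = [:1, \<i>:] * [:1, - \<i>:]" by simp
    then show ?thesis unfolding G_def pderiv_mult by (simp only: algebra_simps)
  qed
  also have "\<dots> = (smult (\<i> * of_nat p) [:1, - \<i>:] + smult (- \<i> * of_nat q) [:1, \<i>:]) * G"
  proof -
    have *: "smult x P * (w * Q) + (u * P) * smult y Q = (smult x w + smult y u) * (P * Q)"
      for x y and u w P Q :: "complex poly"
      by (simp add: algebra_simps)
    show ?thesis unfolding d G_def by (rule *)
  qed
  also have "smult (\<i> * of_nat p) [:1, - \<i>:] + smult (- \<i> * of_nat q) [:1, \<i>:] = [:- \<i> * a, of_nat l:]"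
    by (simp add: a l algebra_simps)
  finally have ode: "[:1, 0, 1:] * pderiv G = [:- \<i> * a, of_nat l:] * G" .
  have G0: "coeff G 0 = 1" by (simp add: G_def coeff_mult_0 coeff_0_power)
  have "coeff G j = ?g j" for j
  proof (induction j rule: induct_nat_012)
    case 0
    show ?case by (simp add: G0)
  next
    case 1
    have "coeff ([:1, 0, 1:] * pderiv G) 0 = coeff ([:- \<i> * a, of_nat l:] * G) 0" by (simp only: ode)
    then show ?case
      by (simp add: coeff_pderiv coeff_mult_0 G0 algebra_simps)
  next
    case (ge2 j)
    have "of_nat (j + 2) \<noteq> (0::complex)" unfolding of_nat_eq_0_iff by simp
    moreover have "of_nat (j + 2) * coeff G (Suc (Suc j)) = (of_nat l - of_nat j) * coeff G j - \<i> * a * coeff G (Suc j)"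
      using arg_cong[OF ode, of "\<lambda>P. coeff P (Suc j)"]
      by (cases j) (simp_all add: coeff_pderiv algebra_simps)
    ultimately show ?case using ge2 by (simp add: field_simps)
  qed
  moreover have "degree G \<le> l"
    unfolding G_def l by (rule order_trans[OF degree_mult_le]) (simp add: add_mono degree_power_le[THEN order_trans])
  ultimately show "?g (Suc l) = 0" by (metis coeff_eq_0 le_imp_less_Suc)
qed

section \<open>Reflections and strings for \<open>sl\<^sub>2\<close>\<close>

text \<open>The index k counts lowering steps. The element h is present only through its eigenvalue
  b - 2 k on \<open>X k\<close>, so the mirror image of index k is b - k.\<close>

locale sl2_chain = vector_space s
  for s :: "complex \<Rightarrow> 'v \<Rightarrow> 'v::ab_group_add" +
  fixes e f :: "'v \<Rightarrow> 'v" and X :: "int \<Rightarrow> 'v set" and b :: int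
  assumes hom: "module_hom s s e" "module_hom s s f"
    and e_X: "x \<in> X k \<Longrightarrow> e x \<in> X (k - 1)"
    and f_X: "x \<in> X k \<Longrightarrow> f x \<in> X (k + 1)"
    and ef: "x \<in> X k \<Longrightarrow> e (f x) = f (e x) + s (of_int (b - 2 * k)) x"
begin

text \<open>Reversing the grading exchanges the two halves of a string, so the lower half of
  \<open>reflect\<close> follows from the upper one.\<close>

lemma swap: "sl2_chain s f e (\<lambda>k. X (- k)) (- b)"
proof unfold_locales
  fix x k assume x: "x \<in> X (- k)"
  show "f x \<in> X (- (k - 1))" using f_X[OF x] by (simp add: algebra_simps)
  show "e x \<in> X (- (k + 1))" using e_X[OF x] by (metis minus_add_distrib uminus_add_conv_diff add.commute)
  show "f (e x) = e (f x) + s (of_int (- b - 2 * k)) x"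
    by (simp add: ef[OF x] scale_left_diff_distrib scale_left_distrib scale_minus_left algebra_simps)
qed (use hom in \<open>auto simp: module_hom.add module_hom.scale\<close>)

lemma iterate_X: "x \<in> X k \<Longrightarrow> (f ^^ j) x \<in> X (k + int j)"
  by (induction j) (auto simp: algebra_simps dest: f_X)

lemma e_iterate:
  assumes "x \<in> X k" "e x = 0"
  shows "e ((f ^^ Suc j) x) = s (of_nat (Suc j) * of_int (b - 2 * k - int j)) ((f ^^ j) x)"
proof (induction j)
  case 0
  then show ?case using ef[OF assms(1)] assms(2) hom by (simp add: module_hom.zero)
next
  case (Suc j)
  have "e ((f ^^ Suc (Suc j)) x) = f (e ((f ^^ Suc j) x)) + s (of_int (b - 2 * (k + int (Suc j)))) ((f ^^ Suc j) x)"
    using ef[OF iterate_X[OF assms(1), of "Suc j"]] by simp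
  also have "\<dots> = s (of_nat (Suc j) * of_int (b - 2 * k - int j) + of_int (b - 2 * (k + int (Suc j)))) ((f ^^ Suc j) x)"
    unfolding Suc.IH using hom by (simp add: module_hom.scale scale_left_distrib)
  also have "of_nat (Suc j) * of_int (b - 2 * k - int j) + of_int (b - 2 * (k + int (Suc j)))
      = (of_nat (Suc (Suc j)) * of_int (b - 2 * k - int (Suc j)) :: complex)"
    by (simp add: algebra_simps)
  finally show ?case .
qed

lemma iterate_nonzero:
  assumes "x \<in> X k" "e x = 0" "x \<noteq> 0" "int j \<le> b - 2 * k"
  shows "(f ^^ j) x \<noteq> 0"
  using assms(4)
proof (induction j)
  case (Suc j)
  have "of_nat (Suc j) * of_int (b - 2 * k - int j) \<noteq> (0::complex)"
    unfolding mult_eq_0_iff of_nat_eq_0_iff of_int_eq_0_iff using Suc.prems by auto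
  then have "e ((f ^^ Suc j) x) \<noteq> 0"
    using Suc e_iterate[OF assms(1,2), of j] by (simp add: scale_eq_0_iff)
  then show ?case using hom by (metis module_hom.zero)
qed (use assms in simp)

text \<open>Climb from x with e to the last nonzero vector w, which is annihilated by e, and descend
  from w to the mirror index. The result is some vector of the reflected weight, not an image of x
  under a reflection operator.\<close>

lemma reflect_upward:
  assumes x: "x \<in> X k" "x \<noteq> 0" and e: "(e ^^ n) x = 0" and k: "2 * k \<le> b"
  shows "\<exists>y\<in>X (b - k). y \<noteq> 0"
proof -
  interpret sw: sl2_chain s f e "\<lambda>k. X (- k)" "- b" by (rule swap)
  define N where "N = (LEAST n. (e ^^ n) x = 0)"
  have N: "(e ^^ N) x = 0" unfolding N_def by (rule LeastI) (rule e)
  have "N \<noteq> 0" using N x by (cases N) auto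
  then obtain M where M: "N = Suc M" by (metis not0_implies_Suc)
  define w where "w = (e ^^ M) x"
  have w0: "w \<noteq> 0" using not_less_Least[of M "\<lambda>n. (e ^^ n) x = 0"] M N_def w_def by auto
  have we: "e w = 0" using N M w_def by simp
  have w: "w \<in> X (k - int M)"
    using sw.iterate_X[of x "- k" M] x by (simp add: w_def algebra_simps)
  \<comment> \<open>The distance from index k - M to b - k. It is nonnegative as 2 k \<le> b, and at
    most the string length b - 2 (k - M), within which iterates of f stay nonzero.\<close>
  let ?j = "nat (b - 2 * k + int M)"
  have "(f ^^ ?j) w \<noteq> 0"
    by (rule iterate_nonzero[OF w we w0]) (use k in auto)
  moreover have "(f ^^ ?j) w \<in> X (b - k)"
    using iterate_X[OF w, of ?j] k by simp
  ultimately show ?thesis by blast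
qed

lemma reflect:
  assumes x: "x \<in> X k" "x \<noteq> 0" and e: "(e ^^ n) x = 0" and f: "(f ^^ n') x = 0"
  shows "\<exists>y\<in>X (b - k). y \<noteq> 0"
proof (cases "2 * k \<le> b")
  case True
  then show ?thesis using reflect_upward[OF x e] by blast
next
  case False
  interpret sw: sl2_chain s f e "\<lambda>k. X (- k)" "- b" by (rule swap)
  show ?thesis using sw.reflect_upward[of x "- k" n'] False x f by simp
qed

text \<open>By induction e takes the same value on both sides, so their difference lies in the
  kernel of e, which is trivial at positive index. The bound j \<le> l keeps the factorial (l - j)!
  meaningful.\<close>

lemma string:
  fixes l :: nat and z :: "nat \<Rightarrow> 'v" and a :: complex
  assumes v: "v \<in> X 0" "e v = 0" and b: "b = int l"
    and sub: "\<And>k. subspace (X k)"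
    and inj: "\<And>j x. x \<in> X (int (Suc j)) \<Longrightarrow> e x = 0 \<Longrightarrow> x = 0"
    and z: "z 0 = v" "\<And>j. z j \<in> X (int j)"
    and rec: "\<And>j. j < J \<Longrightarrow> e (z (Suc j)) = (if j = 0 then 0 else f (z (j - 1))) + s a (z j)"
    and "j \<le> l" "j \<le> J"
  shows "z j = s (string_coeff l a j * fact (l - j) / fact l) ((f ^^ j) v)"
  using assms(9,10)
proof (induction j rule: less_induct)
  case (less j)
  show ?case
  proof (cases j)
    case 0
    then show ?thesis by (simp add: z)
  next
    case (Suc i)
    let ?c = "\<lambda>j. string_coeff l a j * fact (l - j) / fact l"
    let ?y = "\<lambda>j. (f ^^ j) v"
    have fact: "fact (l - i) = ((of_nat l - of_nat i) * fact (l - Suc i) :: complex)"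
      using less.prems Suc fact_reduce[of "l - i", where 'a = complex] by (simp add: of_nat_diff)
    have "e (s (?c j) (?y j)) = s (?c (Suc i) * (of_nat (Suc i) * of_int (b - int i))) (?y i)"
      unfolding Suc using e_iterate[OF v, of i] hom by (simp only: module_hom.scale scale_scale) simp
    also have "?c (Suc i) * (of_nat (Suc i) * of_int (b - int i))
        = (of_nat (Suc i) * string_coeff l a (Suc i)) * fact (l - i) / fact l"
      unfolding fact using less.prems Suc by (simp add: b algebra_simps add_divide_distrib diff_divide_distrib del: string_coeff.simps)
    also have "\<dots> = (if i = 0 then 0 else ?c (i - 1)) + a * ?c i"
    proof (cases i)
      case (Suc h)
      then have "l - h = Suc (l - i)" using less.prems \<open>j = Suc i\<close> by simp
      then have "fact (l - h) = ((of_nat l - of_nat i + 1) * fact (l - i) :: complex)"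
        using less.prems \<open>j = Suc i\<close> by (simp add: of_nat_diff algebra_simps)
      then have fact': "fact (l - h) = ((of_nat l - of_nat h) * fact (l - Suc h) :: complex)"
        using Suc by simp
      show ?thesis unfolding string_coeff_Suc using Suc
        by (simp add: fact' algebra_simps add_divide_distrib diff_divide_distrib del: string_coeff.simps)
    qed (simp add: string_coeff_Suc)
    also have "s \<dots> (?y i) = (if i = 0 then 0 else f (s (?c (i - 1)) (?y (i - 1)))) + s a (s (?c i) (?y i))"
      using hom by (cases i) (simp_all add: module_hom.scale scale_left_distrib del: string_coeff.simps)
    also have "\<dots> = (if i = 0 then 0 else f (z (i - 1))) + s a (z i)"
      using less.IH[of i] less.IH[of "i - 1"] less.prems Suc by simp
    also have "\<dots> = e (z j)"
      using rec[of i] less.prems Suc by simp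
    finally have "e (z j - s (?c j) (?y j)) = 0"
      using hom by (simp add: module_hom.diff)
    moreover have "z j - s (?c j) (?y j) \<in> X (int (Suc i))"
      using z(2)[of j] iterate_X[OF v(1), of j] sub[of "int j"] Suc
      by (metis add_0 subspace_diff subspace_scale)
    ultimately show ?thesis using inj by force
  qed
qed

end

section \<open>Graded modules over the affine Lie algebra\<close>

text \<open>The operators \<open>E n, F n, H n\<close> stand for the action of \<open>t\<^sup>n \<otimes> e, t\<^sup>n \<otimes> f, t\<^sup>n \<otimes> h\<close> and \<open>V m k\<close> for the
  weight space of \<open>\<lambda> - m \<alpha>\<^sub>0 - k \<alpha>\<^sub>1\<close>; the central element acts by the level \<open>l\<^sub>0 + l\<^sub>1\<close>. The Chevalley
  generators are \<open>e\<^sub>1 = E 0\<close>, \<open>f\<^sub>1 = F 0\<close>, \<open>e\<^sub>0 = F 1\<close> and \<open>f\<^sub>0 = E (- 1)\<close>.\<close>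

locale graded_affine_module = vector_space s
  for s :: "complex \<Rightarrow> 'v \<Rightarrow> 'v::ab_group_add" +
  fixes E F H :: "int \<Rightarrow> 'v \<Rightarrow> 'v" and V :: "int \<Rightarrow> int \<Rightarrow> 'v set" and l\<^sub>0 l\<^sub>1 :: nat and v :: 'v
  assumes hom: "module_hom s s (E n)" "module_hom s s (F n)" "module_hom s s (H n)"
    and EE: "E m (E n x) = E n (E m x)"
    and FF: "F m (F n x) = F n (F m x)"
    and EF: "E m (F n x) = F n (E m x) + H (m + n) x
      + s (if m = - n then of_int m * of_nat (l\<^sub>0 + l\<^sub>1) else 0) x"
    and HE: "H m (E n x) = E n (H m x) + s 2 (E (m + n) x)"
    and HF: "H m (F n x) = F n (H m x) - s 2 (F (m + n) x)"
    and subspace_V: "subspace (V m k)"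
    and E_V: "x \<in> V m k \<Longrightarrow> E n x \<in> V (m - n) (k - n - 1)"
    and F_V: "x \<in> V m k \<Longrightarrow> F n x \<in> V (m - n) (k - n + 1)"
    and H_V: "x \<in> V m k \<Longrightarrow> H n x \<in> V (m - n) (k - n)"
    and H_0: "x \<in> V m k \<Longrightarrow> H 0 x = s (of_int (int l\<^sub>1 + 2 * m - 2 * k)) x"
    and V_neg: "x \<in> V m k \<Longrightarrow> m < 0 \<or> k < 0 \<Longrightarrow> x = 0"
    and v_V: "v \<in> V 0 0" "v \<noteq> 0" and V_00: "x \<in> V 0 0 \<Longrightarrow> \<exists>c. x = s c v"
    and no_singular: "x \<in> V m k \<Longrightarrow> (m, k) \<noteq> (0, 0) \<Longrightarrow> E 0 x = 0 \<Longrightarrow> F 1 x = 0 \<Longrightarrow> x = 0"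
    and nilpotent: "\<exists>n. (E 0 ^^ n) x = 0" "\<exists>n. (F 0 ^^ n) x = 0"
      "\<exists>n. (F 1 ^^ n) x = 0" "\<exists>n. (E (- 1) ^^ n) x = 0"
begin

lemma hom_simps [simp]:
  "E n 0 = 0" "E n (x + y) = E n x + E n y" "E n (x - y) = E n x - E n y" "E n (- x) = - E n x"
  "E n (s c x) = s c (E n x)"
  "F n 0 = 0" "F n (x + y) = F n x + F n y" "F n (x - y) = F n x - F n y" "F n (- x) = - F n x"
  "F n (s c x) = s c (F n x)"
  "H n 0 = 0" "H n (x + y) = H n x + H n y" "H n (x - y) = H n x - H n y" "H n (- x) = - H n x"
  "H n (s c x) = s c (H n x)"
  by (simp_all add: hom[THEN module_hom.zero] hom[THEN module_hom.add] hom[THEN module_hom.diff]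
      hom[THEN module_hom.neg] hom[THEN module_hom.scale])

lemma hom_sum: "E n (sum g S) = (\<Sum>i\<in>S. E n (g i))" "F n (sum g S) = (\<Sum>i\<in>S. F n (g i))"
  "H n (sum g S) = (\<Sum>i\<in>S. H n (g i))"
  by (simp_all add: hom[THEN module_hom.sum])

text \<open>The diagram automorphism exchanges the two nodes of the Dynkin diagram.\<close>

lemma swap: "graded_affine_module s (\<lambda>n. F (n + 1)) (\<lambda>n. E (n - 1))
  (\<lambda>n x. s (if n = 0 then of_nat (l\<^sub>0 + l\<^sub>1) else 0) x - H n x) (\<lambda>m k. V k m) l\<^sub>1 l\<^sub>0 v"
proof (intro graded_affine_module.intro graded_affine_module_axioms.intro)
  show "vector_space s" by (rule vector_space_axioms)
  show "module_hom s s (E (n - 1))" "module_hom s s (F (n + 1))" for n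
    by (rule hom)+
  show "module_hom s s (\<lambda>x. s (if n = 0 then of_nat (l\<^sub>0 + l\<^sub>1) else 0) x - H n x)" for n
    by (rule module_hom.intro[OF module_axioms module_axioms], unfold_locales)
      (simp_all add: scale_right_distrib scale_right_diff_distrib mult.commute)
  fix m n k x
  show "F (m + 1) (F (n + 1) x) = F (n + 1) (F (m + 1) x)" by (rule FF)
  show "E (m - 1) (E (n - 1) x) = E (n - 1) (E (m - 1) x)" by (rule EE)
  \<comment> \<open>The index shifts change the cocycle factor m into m + 1. The additional copy of
    the level is absorbed by the new H at degree 0, which reflects h_0 = c - h_1.\<close>
  show "F (m + 1) (E (n - 1) x) = E (n - 1) (F (m + 1) x)
      + (s (if m + n = 0 then of_nat (l\<^sub>0 + l\<^sub>1) else 0) x - H (m + n) x)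
      + s (if m = - n then of_int m * of_nat (l\<^sub>1 + l\<^sub>0) else 0) x"
    unfolding EF[of "n - 1" "m + 1"]
    by (auto simp: add_eq_0_iff algebra_simps simp flip: scale_left_distrib scale_left_diff_distrib)
  show "s (if m = 0 then of_nat (l\<^sub>0 + l\<^sub>1) else 0) (F (n + 1) x) - H m (F (n + 1) x)
      = F (n + 1) (s (if m = 0 then of_nat (l\<^sub>0 + l\<^sub>1) else 0) x - H m x) + s 2 (F (m + n + 1) x)"
    by (simp add: HF algebra_simps)
  show "s (if m = 0 then of_nat (l\<^sub>0 + l\<^sub>1) else 0) (E (n - 1) x) - H m (E (n - 1) x)
      = E (n - 1) (s (if m = 0 then of_nat (l\<^sub>0 + l\<^sub>1) else 0) x - H m x) - s 2 (E (m + n - 1) x)"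
    by (simp add: HE algebra_simps)
  show "subspace (V k m)" by (rule subspace_V)
  show "v \<in> V 0 0" "v \<noteq> 0" by (rule v_V)+
  show "\<exists>n. (F (0 + 1) ^^ n) x = 0" "\<exists>n. (E (0 - 1) ^^ n) x = 0"
    "\<exists>n. (E (1 - 1) ^^ n) x = 0" "\<exists>n. (F (- 1 + 1) ^^ n) x = 0"
    using nilpotent[of x] by simp_all
  show "\<exists>c. x = s c v" if "x \<in> V 0 0" using that by (rule V_00)
  assume x: "x \<in> V k m"
  show "F (n + 1) x \<in> V (k - n - 1) (m - n)" "E (n - 1) x \<in> V (k - n + 1) (m - n)"
    using F_V[OF x, of "n + 1"] E_V[OF x, of "n - 1"] by (simp_all add: algebra_simps)
  show "s (if n = 0 then of_nat (l\<^sub>0 + l\<^sub>1) else 0) x - H n x \<in> V (k - n) (m - n)"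
    using H_V[OF x, of n] x subspace_V
    by (cases "n = 0") (simp_all add: subspace_diff subspace_scale subspace_neg)
  show "s (if 0 = (0::int) then of_nat (l\<^sub>0 + l\<^sub>1) else 0) x - H 0 x
      = s (of_int (int l\<^sub>0 + 2 * m - 2 * k)) x"
    unfolding H_0[OF x] scale_left_diff_distrib[symmetric] by (rule arg_cong[where f = "\<lambda>c. s c x"]) simp
  show "m < 0 \<or> k < 0 \<Longrightarrow> x = 0" using V_neg[OF x] by blast
  show "(m, k) \<noteq> (0, 0) \<Longrightarrow> F (0 + 1) x = 0 \<Longrightarrow> E (1 - 1) x = 0 \<Longrightarrow> x = 0"
    using no_singular[OF x] by auto
qed

subsection \<open>Weights\<close>

lemma sl2_chain_1: "sl2_chain s (E 0) (F 0) (V m) (int l\<^sub>1 + 2 * m)"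
proof (intro sl2_chain.intro sl2_chain_axioms.intro hom vector_space_axioms)
  fix x k assume x: "x \<in> V m k"
  show "E 0 x \<in> V m (k - 1)" "F 0 x \<in> V m (k + 1)" using E_V[OF x, of 0] F_V[OF x, of 0] by simp_all
  show "E 0 (F 0 x) = F 0 (E 0 x) + s (of_int (int l\<^sub>1 + 2 * m - 2 * k)) x"
    by (simp add: EF H_0[OF x])
qed

lemma reflect_1:
  assumes "x \<in> V m k" "x \<noteq> 0"
  shows "\<exists>y\<in>V m (int l\<^sub>1 + 2 * m - k). y \<noteq> 0"
proof -
  interpret sl2_chain s "E 0" "F 0" "V m" "int l\<^sub>1 + 2 * m" by (rule sl2_chain_1)
  show ?thesis using reflect[OF assms] nilpotent[of x] by blast
qed

lemma reflect_0:
  assumes "x \<in> V m k" "x \<noteq> 0"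
  shows "\<exists>y\<in>V (int l\<^sub>0 + 2 * k - m) k. y \<noteq> 0"
proof -
  interpret sw: graded_affine_module s "\<lambda>n. F (n + 1)" "\<lambda>n. E (n - 1)"
    "\<lambda>n x. s (if n = 0 then of_nat (l\<^sub>0 + l\<^sub>1) else 0) x - H n x" "\<lambda>m k. V k m" l\<^sub>1 l\<^sub>0 v
    by (rule swap)
  show ?thesis using sw.reflect_1 assms by blast
qed

text \<open>Half the difference of the values of the quadratic Casimir element at the highest weight
  \<open>\<lambda>\<close> and at \<open>\<lambda> - m \<alpha>\<^sub>0 - k \<alpha>\<^sub>1\<close>.\<close>

definition \<kappa> :: "int \<Rightarrow> int \<Rightarrow> int" where
  "\<kappa> m k = m * int l\<^sub>0 + k * int l\<^sub>1 - (m - k)\<^sup>2 + m + k"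

text \<open>If the weight is not dominant, a simple reflection raises it without changing its norm.\<close>

lemma weight_norm_le:
  assumes "x \<in> V m k" "x \<noteq> 0"
  shows "(m - k)\<^sup>2 \<le> m * int l\<^sub>0 + k * int l\<^sub>1"
  using assms
proof (induction "nat (m + k)" arbitrary: m k x rule: less_induct)
  case less
  have pos: "m \<ge> 0" "k \<ge> 0" using V_neg less.prems by force+
  consider "int l\<^sub>1 + 2 * m - 2 * k < 0" | "int l\<^sub>0 + 2 * k - 2 * m < 0"
    | "int l\<^sub>1 + 2 * m - 2 * k \<ge> 0" "int l\<^sub>0 + 2 * k - 2 * m \<ge> 0" by linarith
  then show ?case
  proof cases
    case 1
    obtain y where "y \<in> V m (int l\<^sub>1 + 2 * m - k)" "y \<noteq> 0" using reflect_1 less.prems by blast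
    then have "(m - (int l\<^sub>1 + 2 * m - k))\<^sup>2 \<le> m * int l\<^sub>0 + (int l\<^sub>1 + 2 * m - k) * int l\<^sub>1"
      using less.hyps[of m "int l\<^sub>1 + 2 * m - k"] 1 pos by fastforce
    then show ?thesis by (simp add: power2_eq_square algebra_simps)
  next
    case 2
    obtain y where "y \<in> V (int l\<^sub>0 + 2 * k - m) k" "y \<noteq> 0" using reflect_0 less.prems by blast
    then have "((int l\<^sub>0 + 2 * k - m) - k)\<^sup>2 \<le> (int l\<^sub>0 + 2 * k - m) * int l\<^sub>0 + k * int l\<^sub>1"
      using less.hyps[of "int l\<^sub>0 + 2 * k - m" k] 2 pos by fastforce
    then show ?thesis by (simp add: power2_eq_square algebra_simps)
  next
    case 3
    \<comment> \<open>For a dominant weight mu this is (lambda - mu, lambda + mu) \<ge> 0, where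
      lambda - mu = m alpha_0 + k alpha_1 and lambda + mu is dominant.\<close>
    have "0 \<le> m * (int l\<^sub>0 + (int l\<^sub>0 + 2 * k - 2 * m)) + k * (int l\<^sub>1 + (int l\<^sub>1 + 2 * m - 2 * k))"
      using 3 pos by simp
    then show ?thesis by (simp add: power2_eq_square algebra_simps)
  qed
qed

text \<open>The contribution m + k of rho to \<kappa> is positive at every weight other than the
  highest, and the rest of \<kappa> is nonnegative by \<open>weight_norm_le\<close>.\<close>

lemma \<kappa>_eq_0:
  assumes "x \<in> V m k" "x \<noteq> 0" "\<kappa> m k = 0"
  shows "m = 0 \<and> k = 0"
proof -
  have "m \<ge> 0" "k \<ge> 0" using V_neg assms by force+
  then show ?thesis using weight_norm_le[OF assms(1,2)] assms(3) unfolding \<kappa>_def by linarith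
qed

subsection \<open>The Casimir element\<close>

text \<open>Half of the normally ordered quadratic Casimir element without its Cartan part: a sum
  over dual bases with the lowering factor outside. The raising factors are replaced by arbitrary
  families, so that cocycles can be inserted as well as vectors. The factor 1/2 comes from (h, h) =
  2. The cut at M is harmless once the families vanish in large degrees.\<close>

definition casimir_sum ::
    "nat \<Rightarrow> (int \<Rightarrow> 'v) \<Rightarrow> (int \<Rightarrow> 'v) \<Rightarrow> (int \<Rightarrow> 'v) \<Rightarrow> 'v" where
  "casimir_sum M U\<^sub>e U\<^sub>f U\<^sub>h =
     (\<Sum>n\<le>M. F (- int n) (U\<^sub>e (int n)) + E (- int (Suc n)) (U\<^sub>f (int (Suc n)))
       + s (1 / 2) (H (- int (Suc n)) (U\<^sub>h (int (Suc n)))))"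

abbreviation casimir :: "nat \<Rightarrow> 'v \<Rightarrow> 'v" where
  "casimir M w \<equiv> casimir_sum M (\<lambda>n. E n w) (\<lambda>n. F n w) (\<lambda>n. H n w)"

text \<open>The hypotheses on \<open>U\<^sub>e\<close>, \<open>U\<^sub>f\<close>,
  \<open>U\<^sub>h\<close> are the cocycle identities for pairs with first member e_1. They hold for
  the coboundary of a vector and for the defects of a partial solution, and both cases are used. The
  correction terms telescope; the vanishing in degree M + 1 removes the far end and only
  \<open>H 0\<close> remains.\<close>

lemma casimir_sum_e1:
  assumes e: "\<And>n. n \<ge> 0 \<Longrightarrow> E 0 (U\<^sub>e n) = E n (U\<^sub>e 0)"
    and f: "\<And>n. n \<ge> 1 \<Longrightarrow> E 0 (U\<^sub>f n) = F n (U\<^sub>e 0) + U\<^sub>h n"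
    and h: "\<And>n. n \<ge> 1 \<Longrightarrow> E 0 (U\<^sub>h n) = H n (U\<^sub>e 0) - s 2 (U\<^sub>e n)"
    and M: "U\<^sub>e (int (Suc M)) = 0"
  shows "E 0 (casimir_sum M U\<^sub>e U\<^sub>f U\<^sub>h) = casimir M (U\<^sub>e 0) + H 0 (U\<^sub>e 0)"
proof -
  let ?w = "U\<^sub>e 0"
  have EH: "E 0 (H n x) = H n (E 0 x) - s 2 (E n x)" for n x
    using HE[of n 0 x] by simp
  have "E 0 (F (- int n) (U\<^sub>e (int n)) + E (- int (Suc n)) (U\<^sub>f (int (Suc n)))
       + s (1 / 2) (H (- int (Suc n)) (U\<^sub>h (int (Suc n)))))
    = (F (- int n) (E (int n) ?w) + E (- int (Suc n)) (F (int (Suc n)) ?w)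
       + s (1 / 2) (H (- int (Suc n)) (H (int (Suc n)) ?w)))
     + (H (- int n) (U\<^sub>e (int n)) - H (- int (Suc n)) (U\<^sub>e (int (Suc n))))" for n
    using e[of "int n"] f[of "int (Suc n)"] h[of "int (Suc n)"]
    by (simp add: EF EE[of 0] EH scale_right_diff_distrib del: of_nat_Suc)
  note step = this
  have "E 0 (casimir_sum M U\<^sub>e U\<^sub>f U\<^sub>h) = casimir M ?w
      + (\<Sum>n\<le>M. H (- int n) (U\<^sub>e (int n)) - H (- int (Suc n)) (U\<^sub>e (int (Suc n))))"
    unfolding casimir_sum_def hom_sum step by (rule sum.distrib)
  also have "(\<Sum>n\<le>M. H (- int n) (U\<^sub>e (int n)) - H (- int (Suc n)) (U\<^sub>e (int (Suc n)))) = H 0 ?w"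
    by (subst sum_telescope) (simp add: M del: of_nat_Suc)
  finally show ?thesis .
qed

lemma casimir_sum_e0:
  assumes e: "\<And>n. n \<ge> 0 \<Longrightarrow> F 1 (U\<^sub>e n) = E n (U\<^sub>f 1) - U\<^sub>h (n + 1)"
    and f: "\<And>n. n \<ge> 1 \<Longrightarrow> F 1 (U\<^sub>f n) = F n (U\<^sub>f 1)"
    and h: "\<And>n. n \<ge> 1 \<Longrightarrow> F 1 (U\<^sub>h n) = H n (U\<^sub>f 1) + s 2 (U\<^sub>f (n + 1))"
    and M: "U\<^sub>f (int (Suc (Suc M))) = 0"
  shows "F 1 (casimir_sum M U\<^sub>e U\<^sub>f U\<^sub>h)
    = casimir M (U\<^sub>f 1) + (s (of_nat (l\<^sub>0 + l\<^sub>1)) (U\<^sub>f 1) - H 0 (U\<^sub>f 1))"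
proof -
  let ?w = "U\<^sub>f 1"
  have FH: "F 1 (H (- int (Suc n)) x) = H (- int (Suc n)) (F 1 x) + s 2 (F (- int n) x)" for n x
    using HF[of "- int (Suc n)" 1 x] by simp
  \<comment> \<open>The cocycle contributes only to the bracket of t f with t^(-1) e, hence the
    level enters once, at n = 0.\<close>
  have FE: "F 1 (E (- int (Suc n)) x) = E (- int (Suc n)) (F 1 x) - H (- int n) x
      + (if n = 0 then s (of_nat (l\<^sub>0 + l\<^sub>1)) x else 0)" for n x
    using EF[of "- int (Suc n)" 1 x] by (simp add: algebra_simps)
  have "F 1 (F (- int n) (U\<^sub>e (int n)) + E (- int (Suc n)) (U\<^sub>f (int (Suc n)))
       + s (1 / 2) (H (- int (Suc n)) (U\<^sub>h (int (Suc n)))))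
    = (F (- int n) (E (int n) ?w) + E (- int (Suc n)) (F (int (Suc n)) ?w)
       + s (1 / 2) (H (- int (Suc n)) (H (int (Suc n)) ?w)))
     - (H (- int n) (U\<^sub>f (int (Suc n))) - H (- int (Suc n)) (U\<^sub>f (int (Suc (Suc n)))))
     + (if n = 0 then s (of_nat (l\<^sub>0 + l\<^sub>1)) ?w else 0)" for n
  proof -
    have "F 1 (U\<^sub>e (int n)) = E (int n) ?w - U\<^sub>h (int (Suc n))"
      "F 1 (U\<^sub>h (int (Suc n))) = H (int (Suc n)) ?w + s 2 (U\<^sub>f (int (Suc (Suc n))))"
      using e[of "int n"] h[of "int (Suc n)"] by (simp_all add: add.commute)
    then show ?thesis using f[of "int (Suc n)"]
      by (simp add: FF[of 1] FE FH scale_right_distrib del: of_nat_Suc) simp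
  qed
  note step = this
  have "F 1 (casimir_sum M U\<^sub>e U\<^sub>f U\<^sub>h) = casimir M ?w
      - (\<Sum>n\<le>M. H (- int n) (U\<^sub>f (int (Suc n))) - H (- int (Suc n)) (U\<^sub>f (int (Suc (Suc n)))))
      + (\<Sum>n\<le>M. if n = 0 then s (of_nat (l\<^sub>0 + l\<^sub>1)) ?w else 0)"
    unfolding casimir_sum_def hom_sum step by (simp only: sum.distrib sum_subtractf)
  also have "(\<Sum>n\<le>M. H (- int n) (U\<^sub>f (int (Suc n))) - H (- int (Suc n)) (U\<^sub>f (int (Suc (Suc n))))) = H 0 ?w"
    by (subst sum_telescope) (simp add: M del: of_nat_Suc, simp)
  finally show ?thesis by simp
qed

lemma casimir_sum_V:
  assumes "\<And>n. U\<^sub>e n \<in> V (m - n) (k - n - 1)" "\<And>n. U\<^sub>f n \<in> V (m - n) (k - n + 1)"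
    "\<And>n. U\<^sub>h n \<in> V (m - n) (k - n)"
  shows "casimir_sum M U\<^sub>e U\<^sub>f U\<^sub>h \<in> V m k"
proof -
  have "F (- n) (U\<^sub>e n) \<in> V m k" "E (- n) (U\<^sub>f n) \<in> V m k" "H (- n) (U\<^sub>h n) \<in> V m k" for n
    using F_V[OF assms(1), of "- n" n] E_V[OF assms(2), of "- n" n] H_V[OF assms(3), of "- n" n]
    by simp_all
  then show ?thesis unfolding casimir_sum_def
    by (intro subspace_sum subspace_add subspace_scale subspace_V) blast+
qed

lemma casimir_V:
  assumes "w \<in> V m k"
  shows "casimir M w \<in> V m k"
  by (rule casimir_sum_V) (use E_V F_V H_V assms in blast)+

text \<open>Induction on the height below the highest weight. By the two commutation lemmas both
  raising generators annihilate the difference of the sides, the Cartan terms making up the change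
  of \<kappa> between neighbouring weights. A singular vector below the top is zero.\<close>

lemma casimir_eq:
  assumes "w \<in> V m k" "m \<le> int M"
  shows "casimir M w = s (of_int (\<kappa> m k)) w"
  using assms
proof (induction "nat (m + k)" arbitrary: m k w rule: less_induct)
  case less
  show ?case
  proof (cases "m < 0 \<or> k < 0 \<or> (m, k) = (0, 0)")
    case True
    have "E n w = 0" "F (1 + n) w = 0" "H (1 + n) w = 0" if "n \<ge> 0" for n
      using that True V_neg[OF E_V[OF less.prems(1), of n]] V_neg[OF F_V[OF less.prems(1), of "1 + n"]]
        V_neg[OF H_V[OF less.prems(1), of "1 + n"]] V_neg[OF less.prems(1)] by force+
    then have "casimir M w = 0"
      by (simp add: casimir_sum_def)
    moreover have "s (of_int (\<kappa> m k)) w = 0"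
      using True V_neg[OF less.prems(1)] by (auto simp: \<kappa>_def)
    ultimately show ?thesis by simp
  next
    case False
    let ?x = "casimir M w - s (of_int (\<kappa> m k)) w"
    have zero: "E (int (Suc M)) w = 0" "F (int (Suc (Suc M))) w = 0"
      using V_neg[OF E_V[OF less.prems(1)]] V_neg[OF F_V[OF less.prems(1)]] less.prems(2) by force+
    have E0: "E 0 w \<in> V m (k - 1)" and F1: "F 1 w \<in> V (m - 1) k"
      using E_V[OF less.prems(1), of 0] F_V[OF less.prems(1), of 1] by simp_all
    have lt: "nat (m + (k - 1)) < nat (m + k)" "nat (m - 1 + k) < nat (m + k)" "m - 1 \<le> int M"
      using False less.prems(2) by auto
    have "E 0 (casimir M w) = casimir M (E 0 w) + H 0 (E 0 w)"
      by (rule casimir_sum_e1) (use zero HE[of _ 0 w] in \<open>simp_all add: EE[of 0] EF\<close>)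
    also have "\<dots> = s (of_int (\<kappa> m (k - 1) + (int l\<^sub>1 + 2 * m - 2 * (k - 1)))) (E 0 w)"
      using less.hyps[OF lt(1) E0 less.prems(2)] H_0[OF E0] by (simp add: scale_left_distrib)
    also have "\<kappa> m (k - 1) + (int l\<^sub>1 + 2 * m - 2 * (k - 1)) = \<kappa> m k"
      by (simp add: \<kappa>_def power2_eq_square algebra_simps)
    finally have 1: "E 0 ?x = 0" by simp
    have "F 1 (casimir M w) = casimir M (F 1 w) + (s (of_nat (l\<^sub>0 + l\<^sub>1)) (F 1 w) - H 0 (F 1 w))"
      by (rule casimir_sum_e0)
        (use zero HF[of _ 1 w] EF[of _ 1 w] in \<open>simp_all add: FF[of 1] algebra_simps\<close>)
    also have "\<dots> = s (of_int (\<kappa> (m - 1) k + (int (l\<^sub>0 + l\<^sub>1) - (int l\<^sub>1 + 2 * (m - 1) - 2 * k)))) (F 1 w)"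
      using less.hyps[OF lt(2) F1 lt(3)] H_0[OF F1]
      by (simp add: scale_left_distrib scale_left_diff_distrib)
    also have "\<kappa> (m - 1) k + (int (l\<^sub>0 + l\<^sub>1) - (int l\<^sub>1 + 2 * (m - 1) - 2 * k)) = \<kappa> m k"
      by (simp add: \<kappa>_def power2_eq_square algebra_simps)
    finally have 2: "F 1 ?x = 0" by simp
    have "?x \<in> V m k"
      using casimir_V less.prems subspace_V by (blast intro: subspace_diff subspace_scale)
    from no_singular[OF this _ 1 2] False show ?thesis by simp
  qed
qed

subsection \<open>Strings through the highest weight\<close>

text \<open>This is the value that the equation for \<open>B\<^sub>1\<close> prescribes for
  \<open>E 0\<close> just beyond the end of the alpha_1-string. It is a multiple of a nonzero
  vector, and the scalar vanishes exactly when the coefficient sequence terminates. Necessity and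
  existence both rest on this.\<close>

lemma string_end_1:
  assumes \<Phi>: "\<And>m k. \<Phi> m k \<in> V m k" "\<Phi> 0 0 = v"
    and rec: "\<And>k. 0 \<le> k \<Longrightarrow> k < int J \<Longrightarrow>
      E 0 (\<Phi> 0 (k + 1)) - F 0 (\<Phi> 0 (k - 1)) = s a (\<Phi> 0 k)"
    and J: "l\<^sub>1 \<le> J"
  shows "F 0 (\<Phi> 0 (int l\<^sub>1 - 1)) + s a (\<Phi> 0 (int l\<^sub>1))
      = s (of_nat (Suc l\<^sub>1) * string_coeff l\<^sub>1 a (Suc l\<^sub>1) / fact l\<^sub>1) ((F 0 ^^ l\<^sub>1) v)"
    and "(F 0 ^^ l\<^sub>1) v \<noteq> 0"
proof -
  interpret sl2_chain s "E 0" "F 0" "V 0" "int l\<^sub>1"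
    using sl2_chain_1[of 0] by simp
  have Ev: "E 0 v = 0" using V_neg[OF E_V[OF v_V(1), of 0]] by simp
  show "(F 0 ^^ l\<^sub>1) v \<noteq> 0" by (rule iterate_nonzero[OF v_V(1) Ev v_V(2)]) simp
  \<comment> \<open>On this string \<open>F 1\<close> leads to the first index -1, so a vector
    annihilated by \<open>E 0\<close> alone is already singular.\<close>
  have inj: "x = 0" if "x \<in> V 0 (int (Suc j))" "E 0 x = 0" for j x
    using that V_neg[OF F_V[OF that(1), of 1]] no_singular[OF that(1)] by simp
  have \<Phi>_neg: "\<Phi> 0 (- 1) = 0" using V_neg[OF \<Phi>(1)[of 0 "- 1"]] by simp
  have rec': "E 0 (\<Phi> 0 (int (Suc j))) = (if j = 0 then 0 else F 0 (\<Phi> 0 (int (j - 1)))) + s a (\<Phi> 0 (int j))"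
    if "j < J" for j
    using that rec[of "int j"] \<Phi>_neg by (cases j) (simp_all add: algebra_simps)
  note str = string[where z = "\<lambda>j. \<Phi> 0 (int j)" and J = J and a = a, OF v_V(1) Ev refl subspace_V inj _ _ rec']
  have \<Phi>_eq: "\<Phi> 0 (int j) = s (string_coeff l\<^sub>1 a j * fact (l\<^sub>1 - j) / fact l\<^sub>1) ((F 0 ^^ j) v)" if "j \<le> l\<^sub>1" for j
    using str[where j = j] that J \<Phi> by simp
  show "F 0 (\<Phi> 0 (int l\<^sub>1 - 1)) + s a (\<Phi> 0 (int l\<^sub>1))
      = s (of_nat (Suc l\<^sub>1) * string_coeff l\<^sub>1 a (Suc l\<^sub>1) / fact l\<^sub>1) ((F 0 ^^ l\<^sub>1) v)"
  proof (cases "l\<^sub>1 = 0")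
    case True
    then show ?thesis using \<Phi>_neg \<Phi>(2) by simp
  next
    case False
    then have l: "int l\<^sub>1 - 1 = int (l\<^sub>1 - 1)" by simp
    have "F 0 (\<Phi> 0 (int l\<^sub>1 - 1)) = s (string_coeff l\<^sub>1 a (l\<^sub>1 - 1) / fact l\<^sub>1) ((F 0 ^^ l\<^sub>1) v)"
      unfolding l \<Phi>_eq[of "l\<^sub>1 - 1", OF diff_le_self] using False by (cases l\<^sub>1) simp_all
    then show ?thesis
      unfolding string_coeff_Suc \<Phi>_eq[of l\<^sub>1, OF order_refl] using False
      by (simp add: add_divide_distrib flip: scale_left_distrib)
  qed
qed

lemma string_end_0:
  assumes \<Phi>: "\<And>m k. \<Phi> m k \<in> V m k" "\<Phi> 0 0 = v"
    and rec: "\<And>m. 0 \<le> m \<Longrightarrow> m < int J \<Longrightarrow>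
      F 1 (\<Phi> (m + 1) 0) - E (- 1) (\<Phi> (m - 1) 0) = s a (\<Phi> m 0)"
    and J: "l\<^sub>0 \<le> J"
  shows "E (- 1) (\<Phi> (int l\<^sub>0 - 1) 0) + s a (\<Phi> (int l\<^sub>0) 0)
      = s (of_nat (Suc l\<^sub>0) * string_coeff l\<^sub>0 a (Suc l\<^sub>0) / fact l\<^sub>0) ((E (- 1) ^^ l\<^sub>0) v)"
    and "(E (- 1) ^^ l\<^sub>0) v \<noteq> 0"
proof -
  interpret sw: graded_affine_module s "\<lambda>n. F (n + 1)" "\<lambda>n. E (n - 1)"
    "\<lambda>n x. s (if n = 0 then of_nat (l\<^sub>0 + l\<^sub>1) else 0) x - H n x" "\<lambda>m k. V k m" l\<^sub>1 l\<^sub>0 v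
    by (rule swap)
  note str = sw.string_end_1[of "\<lambda>m k. \<Phi> k m" J a]
  show "E (- 1) (\<Phi> (int l\<^sub>0 - 1) 0) + s a (\<Phi> (int l\<^sub>0) 0)
      = s (of_nat (Suc l\<^sub>0) * string_coeff l\<^sub>0 a (Suc l\<^sub>0) / fact l\<^sub>0) ((E (- 1) ^^ l\<^sub>0) v)"
    using str(1) \<Phi> rec J by simp
  show "(E (- 1) ^^ l\<^sub>0) v \<noteq> 0" using str(2) \<Phi> rec J by simp
qed

subsection \<open>The fixed subalgebra acting on families of weight vectors\<close>

text \<open>\<open>A_op n\<close> and the following \<open>G_op n\<close> are the actions of
  \<open>fix_A n\<close> and \<open>fix_G n\<close> on families. The argument shifts select the
  components that the root vectors carry into weight (m, k).\<close>

definition A_op :: "int \<Rightarrow> (int \<Rightarrow> int \<Rightarrow> 'v) \<Rightarrow> int \<Rightarrow> int \<Rightarrow> 'v" where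
  "A_op n \<Phi> m k = E n (\<Phi> (m + n) (k + n + 1)) - F (- n) (\<Phi> (m - n) (k - n - 1))"

definition G_op :: "int \<Rightarrow> (int \<Rightarrow> int \<Rightarrow> 'v) \<Rightarrow> int \<Rightarrow> int \<Rightarrow> 'v" where
  "G_op n \<Phi> m k = H n (\<Phi> (m + n) (k + n)) - H (- n) (\<Phi> (m - n) (k - n))"

lemma A_A_comm: "A_op m (A_op n \<Phi>) i k - A_op n (A_op m \<Phi>) i k = - G_op (m - n) \<Phi> i k"
  unfolding A_op_def G_op_def
  by (simp add: EF EE[of m n] FF[of "- m" "- n"] algebra_simps) 

lemma G_A_comm:
  "G_op m (A_op n \<Phi>) i k - A_op n (G_op m \<Phi>) i k = s 2 (A_op (m + n) \<Phi> i k - A_op (n - m) \<Phi> i k)"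
  unfolding A_op_def G_op_def
  by (simp add: HE HF algebra_simps)

lemma G_op_minus: "G_op (- n) \<Phi> m k = - G_op n \<Phi> m k"
  by (simp add: G_op_def)

text \<open>The value of the character on \<open>t\<^sup>n \<otimes> e - t\<^sup>-\<^sup>n \<otimes> f\<close>, with its values on \<open>e\<^sub>0 - f\<^sub>0\<close> and
  \<open>e\<^sub>1 - f\<^sub>1\<close> as parameters. These differ from the values on \<open>B\<^sub>0\<close> and \<open>B\<^sub>1\<close> by the factor
  \<open>- \<i>\<close>.\<close>

definition char_val :: "complex \<Rightarrow> complex \<Rightarrow> int \<Rightarrow> complex" where
  "char_val a\<^sub>0 a\<^sub>1 n = (if even n then a\<^sub>1 else - a\<^sub>0)"

definition defect :: "complex \<Rightarrow> complex \<Rightarrow> (int \<Rightarrow> int \<Rightarrow> 'v) \<Rightarrow> int \<Rightarrow> int \<Rightarrow> int \<Rightarrow> 'v" where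
  "defect a\<^sub>0 a\<^sub>1 \<Phi> n m k = A_op n \<Phi> m k - s (char_val a\<^sub>0 a\<^sub>1 n) (\<Phi> m k)"

text \<open>The filtration is by principal height m + k, which t^n e changes by 2 n + 1, t^n f by 2
  n - 1 and t^n h by 2 n.\<close>

definition vanish :: "int \<Rightarrow> (int \<Rightarrow> int \<Rightarrow> 'v) \<Rightarrow> bool" where
  "vanish j D \<longleftrightarrow> (\<forall>m k. m + k \<le> j \<longrightarrow> D m k = 0)"

lemma vanishD: "vanish j D \<Longrightarrow> m + k \<le> j \<Longrightarrow> D m k = 0"
  by (simp add: vanish_def)

lemma vanish_A: "vanish j D \<Longrightarrow> m + k \<le> j - \<bar>2 * n + 1\<bar> \<Longrightarrow> A_op n D m k = 0"
  by (simp add: vanish_def A_op_def)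

lemma vanish_G: "vanish j D \<Longrightarrow> m + k \<le> j - 2 * \<bar>n\<bar> \<Longrightarrow> G_op n D m k = 0"
  by (simp add: vanish_def G_op_def)

lemma A_op_defect:
  "A_op m (defect a\<^sub>0 a\<^sub>1 \<Phi> n) i k = A_op m (A_op n \<Phi>) i k - s (char_val a\<^sub>0 a\<^sub>1 n) (A_op m \<Phi> i k)"
  by (simp add: A_op_def[of m] defect_def scale_right_diff_distrib)

lemma G_op_defect:
  "G_op m (defect a\<^sub>0 a\<^sub>1 \<Phi> n) i k = G_op m (A_op n \<Phi>) i k - s (char_val a\<^sub>0 a\<^sub>1 n) (G_op m \<Phi> i k)"
  by (simp add: G_op_def defect_def scale_right_diff_distrib)

text \<open>The scalar terms of the two defects cancel in the commutator, so a bracket relation of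
  the fixed subalgebra becomes a relation between defects. This lemma and
  \<open>G_defect_comm\<close> are the source of the cocycle identities in
  \<open>extend_at\<close>.\<close>

lemma A_defect_comm:
  "A_op m (defect a\<^sub>0 a\<^sub>1 \<Phi> n) i k - A_op n (defect a\<^sub>0 a\<^sub>1 \<Phi> m) i k
    - s (char_val a\<^sub>0 a\<^sub>1 m) (defect a\<^sub>0 a\<^sub>1 \<Phi> n i k) + s (char_val a\<^sub>0 a\<^sub>1 n) (defect a\<^sub>0 a\<^sub>1 \<Phi> m i k)
    = - G_op (m - n) \<Phi> i k"
  unfolding A_op_defect A_A_comm[symmetric]
  by (simp add: defect_def scale_right_diff_distrib mult.commute)

lemma G_defect_comm:
  "G_op m (defect a\<^sub>0 a\<^sub>1 \<Phi> n) i k - A_op n (G_op m \<Phi>) i k + s (char_val a\<^sub>0 a\<^sub>1 n) (G_op m \<Phi> i k)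
    = s 2 (defect a\<^sub>0 a\<^sub>1 \<Phi> (m + n) i k - defect a\<^sub>0 a\<^sub>1 \<Phi> (n - m) i k)"
proof -
  have "char_val a\<^sub>0 a\<^sub>1 (m + n) = char_val a\<^sub>0 a\<^sub>1 (n - m)" by (simp add: char_val_def)
  then show ?thesis
    unfolding G_op_defect using G_A_comm[of m n \<Phi> i k]
    by (simp add: defect_def)
qed

text \<open>The equations for \<open>B\<^sub>0\<close> and \<open>B\<^sub>1\<close> up to some height imply those for the whole fixed
  subalgebra; an element of principal degree \<open>d\<close> costs \<open>d\<close> steps of height.\<close>

lemma
  assumes "vanish (N - 1) (defect a\<^sub>0 a\<^sub>1 \<Phi> 0)" "vanish (N - 1) (defect a\<^sub>0 a\<^sub>1 \<Phi> (- 1))"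
  shows vanish_defect: "vanish (N - \<bar>2 * n + 1\<bar>) (defect a\<^sub>0 a\<^sub>1 \<Phi> n)"
    and vanish_G_op: "vanish (N - 2 * \<bar>n\<bar>) (G_op n \<Phi>)"
proof -
  let ?\<delta> = "defect a\<^sub>0 a\<^sub>1 \<Phi>"
  \<comment> \<open>For n > 0, pairing 0 with - n rather than with n gains two steps of height,
    since the principal degree is then 2 n - 1. This gives the sharp bound that
    \<open>extend_at\<close> needs.\<close>
  have G: "vanish (N - 2 * int n) (G_op (int n) \<Phi>)" if "vanish (N - 2 * int n + 1) (?\<delta> (- int n))" for n
  proof (cases "n = 0")
    case True
    then show ?thesis by (simp add: vanish_def G_op_def)
  next
    case False
    have "G_op (int n) \<Phi> m k = 0" if "m + k \<le> N - 2 * int n" for m k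
      using A_defect_comm[of "- int n" a\<^sub>0 a\<^sub>1 \<Phi> 0 m k] that False
        vanish_A[OF assms(1), of m k "- int n"] vanish_A[OF \<open>vanish _ (?\<delta> (- int n))\<close>, of m k 0]
        vanishD[OF assms(1), of m k] vanishD[OF \<open>vanish _ (?\<delta> (- int n))\<close>, of m k]
      by (simp add: G_op_minus)
    then show ?thesis by (simp add: vanish_def)
  qed
  have G1: "vanish (N - 2) (G_op 1 \<Phi>)" using G[of 1] assms(2) by simp
  \<comment> \<open>The bracket of \<open>G 1\<close> with \<open>A n\<close> is twice the
    difference of the neighbours, so below the stated height the two neighbouring defects
    agree.\<close>
  have step: "vanish J (?\<delta> (n + 1)) \<longleftrightarrow> vanish J (?\<delta> (n - 1))"
    if "vanish (N - \<bar>2 * n + 1\<bar>) (?\<delta> n)" "J \<le> N - \<bar>2 * n + 1\<bar> - 2" for J n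
  proof -
    have "?\<delta> (n + 1) m k = ?\<delta> (n - 1) m k" if "m + k \<le> J" for m k
      using G_defect_comm[of 1 a\<^sub>0 a\<^sub>1 \<Phi> n m k] that \<open>J \<le> _\<close> vanish_G[OF \<open>vanish _ (?\<delta> n)\<close>, of m k 1]
        vanish_A[OF G1, of m k n] vanishD[OF G1, of m k] by (simp add: add.commute)
    then show ?thesis by (simp add: vanish_def)
  qed
  have mono: "vanish j D" if "vanish j' D" "j \<le> j'" for j j' D
    using that by (force simp: vanish_def)
  \<comment> \<open>The indices n and -1 - n have the same absolute principal degree 2 n + 1. Each
    step moves an index by two, so the induction carries both and looks two values back.\<close>
  have nat: "vanish (N - (2 * int n + 1)) (?\<delta> (int n)) \<and> vanish (N - (2 * int n + 1)) (?\<delta> (- 1 - int n))" for n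
  proof (induction n rule: induct_nat_012)
    case 0
    then show ?case using assms by simp
  next
    case 1
    then show ?case
      using step[of 0 "N - 3"] step[of "- 1" "N - 3"] assms mono[of "N - 1" _ "N - 3"] by simp
  next
    case (ge2 n)
    let ?n = "int (Suc n)"
    have "N - (2 * int (Suc (Suc n)) + 1) \<le> N - (2 * int n + 1)" by simp
    with ge2 show ?case
      using step[of ?n "N - (2 * int (Suc (Suc n)) + 1)"]
        step[of "- int n - 2" "N - (2 * int (Suc (Suc n)) + 1)"]
        mono[of "N - (2 * int n + 1)" _ "N - (2 * int (Suc (Suc n)) + 1)"]
      by (simp add: algebra_simps)
  qed
  show \<delta>: "vanish (N - \<bar>2 * n + 1\<bar>) (?\<delta> n)" for n
  proof (cases "n \<ge> 0")
    case True
    then show ?thesis using nat[of "nat n"] by simp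
  next
    case False
    then show ?thesis using nat[of "nat (- n - 1)"] by (simp add: algebra_simps)
  qed
  have G: "vanish (N - 2 * int n) (G_op (int n) \<Phi>)" for n
    by (cases "n = 0") (simp add: vanish_def G_op_def, use G[of n] \<delta>[of "- int n"] in \<open>simp add: algebra_simps\<close>)
  show "vanish (N - 2 * \<bar>n\<bar>) (G_op n \<Phi>)"
  proof (cases "n \<ge> 0")
    case True
    then show ?thesis using G[of "nat n"] by simp
  next
    case False
    then show ?thesis using G[of "nat (- n)"] by (simp add: vanish_def G_op_minus)
  qed
qed

lemma A_op_V: "(\<And>m k. \<Phi> m k \<in> V m k) \<Longrightarrow> A_op n \<Phi> m k \<in> V m k"
  unfolding A_op_def
  using E_V[of "\<Phi> (m + n) (k + n + 1)" "m + n" "k + n + 1" n]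
    F_V[of "\<Phi> (m - n) (k - n - 1)" "m - n" "k - n - 1" "- n"]
  by (simp add: subspace_diff subspace_V)

lemma G_op_V: "(\<And>m k. \<Phi> m k \<in> V m k) \<Longrightarrow> G_op n \<Phi> m k \<in> V m k"
  unfolding G_op_def
  using H_V[of "\<Phi> (m + n) (k + n)" "m + n" "k + n" n] H_V[of "\<Phi> (m - n) (k - n)" "m - n" "k - n" "- n"]
  by (simp add: subspace_diff subspace_V)

lemma defect_V: "(\<And>m k. \<Phi> m k \<in> V m k) \<Longrightarrow> defect a\<^sub>0 a\<^sub>1 \<Phi> n m k \<in> V m k"
  unfolding defect_def by (intro subspace_diff subspace_V subspace_scale A_op_V)

subsection \<open>Existence and uniqueness of equivariant families\<close>

text \<open>Equations at height up to N - 1 involve components only up to height N. Setting all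
  later components to zero makes the defects at height N equal, up to sign, to the values to be
  prescribed next.\<close>

definition partial_solution ::
    "complex \<Rightarrow> complex \<Rightarrow> nat \<Rightarrow> (int \<Rightarrow> int \<Rightarrow> 'v) \<Rightarrow> bool" where
  "partial_solution a\<^sub>0 a\<^sub>1 N \<Phi> \<longleftrightarrow> (\<forall>m k. \<Phi> m k \<in> V m k) \<and> \<Phi> 0 0 = v
     \<and> (\<forall>m k. m + k > int N \<longrightarrow> \<Phi> m k = 0)
     \<and> vanish (int N - 1) (defect a\<^sub>0 a\<^sub>1 \<Phi> 0) \<and> vanish (int N - 1) (defect a\<^sub>0 a\<^sub>1 \<Phi> (- 1))"

definition solution :: "complex \<Rightarrow> complex \<Rightarrow> (int \<Rightarrow> int \<Rightarrow> 'v) \<Rightarrow> bool" where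
  "solution a\<^sub>0 a\<^sub>1 \<Phi> \<longleftrightarrow> (\<forall>m k. \<Phi> m k \<in> V m k)
     \<and> (\<forall>m k. defect a\<^sub>0 a\<^sub>1 \<Phi> 0 m k = 0 \<and> defect a\<^sub>0 a\<^sub>1 \<Phi> (- 1) m k = 0)"

lemma solution_all:
  assumes "solution a\<^sub>0 a\<^sub>1 \<Phi>"
  shows "defect a\<^sub>0 a\<^sub>1 \<Phi> n m k = 0" "G_op n \<Phi> m k = 0"
proof -
  have v: "vanish (N - 1) (defect a\<^sub>0 a\<^sub>1 \<Phi> 0)" "vanish (N - 1) (defect a\<^sub>0 a\<^sub>1 \<Phi> (- 1))" for N
    using assms by (simp_all add: solution_def vanish_def)
  show "defect a\<^sub>0 a\<^sub>1 \<Phi> n m k = 0"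
    using vanish_defect[OF v, of "m + k + \<bar>2 * n + 1\<bar>" n] by (simp add: vanish_def)
  show "G_op n \<Phi> m k = 0"
    using vanish_G_op[OF v, of "m + k + 2 * \<bar>n\<bar>" n] by (simp add: vanish_def)
qed

lemma solution_unique:
  assumes sol: "solution a\<^sub>0 a\<^sub>1 \<Phi>" and 0: "\<Phi> 0 0 = 0"
  shows "\<Phi> m k = 0"
proof (induction "nat (m + k)" arbitrary: m k rule: less_induct)
  case less
  have \<Phi>: "\<Phi> m k \<in> V m k" for m k using sol by (simp add: solution_def)
  show ?case
  proof (cases "m < 0 \<or> k < 0 \<or> (m, k) = (0, 0)")
    case True
    then show ?thesis using V_neg[OF \<Phi>] 0 by blast
  next
    case False
    have z: "\<Phi> m' k' = 0" if "m' + k' < m + k" for m' k'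
      using that less.hyps[of m' k'] V_neg[OF \<Phi>, of m' k'] False by fastforce
    have "E 0 (\<Phi> m k) = 0"
      using solution_all(1)[OF sol, of 0 m "k - 1"] z by (simp add: defect_def A_op_def)
    moreover have "F 1 (\<Phi> m k) = 0"
      using solution_all(1)[OF sol, of "- 1" "m - 1" k] z by (simp add: defect_def A_op_def)
    ultimately show ?thesis using no_singular[OF \<Phi>] False by blast
  qed
qed

lemma solution_equations:
  assumes "solution a\<^sub>0 a\<^sub>1 \<Phi>"
  shows "E 0 (\<Phi> m (k + 1)) - F 0 (\<Phi> m (k - 1)) = s a\<^sub>1 (\<Phi> m k)"
    "F 1 (\<Phi> (m + 1) k) - E (- 1) (\<Phi> (m - 1) k) = s a\<^sub>0 (\<Phi> m k)"
  using solution_all(1)[OF assms, of 0 m k] solution_all(1)[OF assms, of "- 1" m k]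
  by (simp_all add: defect_def A_op_def char_val_def algebra_simps eq_neg_iff_add_eq_0)

text \<open>The reflection of lambda - (l_i + 1) alpha_i is lambda + alpha_i, which is not a weight.
  The component there vanishes, so the equation one step above forces the value at the end of the
  string to be zero.\<close>

lemma solution_necessary:
  assumes sol: "solution a\<^sub>0 a\<^sub>1 \<Phi>" and v: "\<Phi> 0 0 = v"
  shows "string_coeff l\<^sub>0 a\<^sub>0 (Suc l\<^sub>0) = 0" "string_coeff l\<^sub>1 a\<^sub>1 (Suc l\<^sub>1) = 0"
proof -
  have \<Phi>: "\<Phi> m k \<in> V m k" for m k using sol by (simp add: solution_def)
  note eqs = solution_equations[OF sol]
  have "\<Phi> 0 (int l\<^sub>1 + 1) = 0"
    using reflect_1[OF \<Phi>, of 0 "int l\<^sub>1 + 1"] V_neg[of _ 0 "- 1"] by fastforce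
  then have "F 0 (\<Phi> 0 (int l\<^sub>1 - 1)) + s a\<^sub>1 (\<Phi> 0 (int l\<^sub>1)) = 0"
    using eqs(1)[of 0 "int l\<^sub>1"] by (simp flip: eqs(1))
  then have "s (of_nat (Suc l\<^sub>1) * string_coeff l\<^sub>1 a\<^sub>1 (Suc l\<^sub>1) / fact l\<^sub>1) ((F 0 ^^ l\<^sub>1) v) = 0"
    using string_end_1(1)[of \<Phi> l\<^sub>1 a\<^sub>1, OF \<Phi> v eqs(1)] by simp
  then show "string_coeff l\<^sub>1 a\<^sub>1 (Suc l\<^sub>1) = 0"
    using string_end_1(2)[of \<Phi> l\<^sub>1 a\<^sub>1, OF \<Phi> v eqs(1)]
    by (simp add: scale_eq_0_iff del: string_coeff.simps of_nat_Suc)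
  have "\<Phi> (int l\<^sub>0 + 1) 0 = 0"
    using reflect_0[OF \<Phi>, of "int l\<^sub>0 + 1" 0] V_neg[of _ "- 1" 0] by fastforce
  then have "E (- 1) (\<Phi> (int l\<^sub>0 - 1) 0) + s a\<^sub>0 (\<Phi> (int l\<^sub>0) 0) = 0"
    using eqs(2)[of "int l\<^sub>0" 0] by (simp flip: eqs(2))
  then have "s (of_nat (Suc l\<^sub>0) * string_coeff l\<^sub>0 a\<^sub>0 (Suc l\<^sub>0) / fact l\<^sub>0) ((E (- 1) ^^ l\<^sub>0) v) = 0"
    using string_end_0(1)[of \<Phi> l\<^sub>0 a\<^sub>0, OF \<Phi> v eqs(2)] by simp
  then show "string_coeff l\<^sub>0 a\<^sub>0 (Suc l\<^sub>0) = 0"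
    using string_end_0(2)[of \<Phi> l\<^sub>0 a\<^sub>0, OF \<Phi> v eqs(2)]
    by (simp add: scale_eq_0_iff del: string_coeff.simps of_nat_Suc)
qed

text \<open>The negated defects form a 1-cocycle of the upper triangular subalgebra with values in the
  module. It is the coboundary of its image under \<open>casimir_sum\<close> divided by \<open>\<kappa>\<close>.\<close>

lemma extend_at:
  assumes part: "partial_solution a\<^sub>0 a\<^sub>1 N \<Phi>" and mk: "m + k = int N + 1"
    and c: "string_coeff l\<^sub>0 a\<^sub>0 (Suc l\<^sub>0) = 0" "string_coeff l\<^sub>1 a\<^sub>1 (Suc l\<^sub>1) = 0"
  shows "\<exists>w\<in>V m k. E 0 w = - defect a\<^sub>0 a\<^sub>1 \<Phi> 0 m (k - 1)
    \<and> F 1 w = defect a\<^sub>0 a\<^sub>1 \<Phi> (- 1) (m - 1) k"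
proof -
  let ?\<delta> = "defect a\<^sub>0 a\<^sub>1 \<Phi>"
  \<comment> \<open>Each value is placed in the weight space to which the root vector would send the
    sought vector w. The sign of \<open>U\<^sub>f\<close> differs because t^n f enters
    \<open>fix_A (- n)\<close> with coefficient -1.\<close>
  define U\<^sub>e where "U\<^sub>e n = - ?\<delta> n (m - n) (k - n - 1)" for n
  define U\<^sub>f where "U\<^sub>f n = ?\<delta> (- n) (m - n) (k - n + 1)" for n
  define U\<^sub>h where "U\<^sub>h n = - G_op n \<Phi> (m - n) (k - n)" for n
  have \<Phi>: "\<And>m k. \<Phi> m k \<in> V m k" and v: "\<Phi> 0 0 = v" and high: "\<And>m k. m + k > int N \<Longrightarrow> \<Phi> m k = 0"
    and v0: "vanish (int N - 1) (?\<delta> 0)" and v1: "vanish (int N - 1) (?\<delta> (- 1))"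
    using part by (simp_all add: partial_solution_def)
  note v\<delta> = vanish_defect[OF v0 v1]
  note vG = vanish_G_op[OF v0 v1]
  have UV: "U\<^sub>e n \<in> V (m - n) (k - n - 1)" "U\<^sub>f n \<in> V (m - n) (k - n + 1)" "U\<^sub>h n \<in> V (m - n) (k - n)" for n
    unfolding U\<^sub>e_def U\<^sub>f_def U\<^sub>h_def by (intro subspace_neg subspace_V defect_V G_op_V \<Phi>)+
  have U\<^sub>e0: "U\<^sub>e 0 \<in> V m (k - 1)" and U\<^sub>f1: "U\<^sub>f 1 \<in> V (m - 1) k" using UV(1)[of 0] UV(2)[of 1] by simp_all
  have goal: ?thesis if "w \<in> V m k" "E 0 w = U\<^sub>e 0" "F 1 w = U\<^sub>f 1" for w
    using that by (auto simp: U\<^sub>e_def U\<^sub>f_def)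
  \<comment> \<open>Here and in the next five identities the cocycle values are defects at the first
    height where they may fail. Everything at smaller height vanishes, in particular the terms with
    lowering operators and those with character values.\<close>
  have ee: "E 0 (U\<^sub>e n) = E n (U\<^sub>e 0)" if "n \<ge> 0" for n
    using A_defect_comm[of 0 a\<^sub>0 a\<^sub>1 \<Phi> n "m - n" "k - n - 2"] that mk
      vanishD[OF v\<delta>[of n], of "m - n" "k - n - 3"] vanishD[OF v0, of "m - 2 * n" "k - 2 * n - 3"]
      vanishD[OF v\<delta>[of n], of "m - n" "k - n - 2"] vanishD[OF v0, of "m - n" "k - n - 2"]
      vanishD[OF vG[of "- n"], of "m - n" "k - n - 2"]
    by (simp add: A_op_def U\<^sub>e_def algebra_simps)
  have ef: "E 0 (U\<^sub>f n) = F n (U\<^sub>e 0) + U\<^sub>h n" if "n \<ge> 1" for n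
    using A_defect_comm[of 0 a\<^sub>0 a\<^sub>1 \<Phi> "- n" "m - n" "k - n"] that mk
      vanishD[OF v\<delta>[of "- n"], of "m - n" "k - n - 1"] vanishD[OF v0, of "m - 2 * n" "k - 2 * n + 1"]
      vanishD[OF v\<delta>[of "- n"], of "m - n" "k - n"] vanishD[OF v0, of "m - n" "k - n"]
    by (simp add: A_op_def U\<^sub>e_def U\<^sub>f_def U\<^sub>h_def algebra_simps eq_neg_iff_add_eq_0)
  have eh: "E 0 (U\<^sub>h n) = H n (U\<^sub>e 0) - s 2 (U\<^sub>e n)" if "n \<ge> 1" for n
    using G_defect_comm[of n a\<^sub>0 a\<^sub>1 \<Phi> 0 "m - n" "k - n - 1"] that mk
      vanishD[OF v0, of "m - 2 * n" "k - 2 * n - 1"] vanishD[OF vG[of n], of "m - n" "k - n - 2"]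
      vanishD[OF vG[of n], of "m - n" "k - n - 1"] vanishD[OF v\<delta>[of "- n"], of "m - n" "k - n - 1"]
    by (simp add: A_op_def G_op_def[of n "?\<delta> 0"] U\<^sub>e_def U\<^sub>f_def U\<^sub>h_def algebra_simps)
  have fe: "F 1 (U\<^sub>e n) = E n (U\<^sub>f 1) - U\<^sub>h (n + 1)" if "n \<ge> 0" for n
    using A_defect_comm[of "- 1" a\<^sub>0 a\<^sub>1 \<Phi> n "m - n - 1" "k - n - 1"] that mk
      G_op_minus[of "n + 1" \<Phi> "m - n - 1" "k - n - 1"]
      vanishD[OF v\<delta>[of n], of "m - n - 2" "k - n - 1"] vanishD[OF v1, of "m - 2 * n - 1" "k - 2 * n - 2"]
      vanishD[OF v\<delta>[of n], of "m - n - 1" "k - n - 1"] vanishD[OF v1, of "m - n - 1" "k - n - 1"]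
    by (simp add: A_op_def U\<^sub>e_def U\<^sub>f_def U\<^sub>h_def algebra_simps)
  have ff: "F 1 (U\<^sub>f n) = F n (U\<^sub>f 1)" if "n \<ge> 1" for n
    using A_defect_comm[of "- 1" a\<^sub>0 a\<^sub>1 \<Phi> "- n" "m - n - 1" "k - n + 1"] that mk
      vanishD[OF v\<delta>[of "- n"], of "m - n - 2" "k - n + 1"] vanishD[OF v1, of "m - 2 * n - 1" "k - 2 * n + 2"]
      vanishD[OF v\<delta>[of "- n"], of "m - n - 1" "k - n + 1"] vanishD[OF v1, of "m - n - 1" "k - n + 1"]
      vanishD[OF vG[of "- 1 + n"], of "m - n - 1" "k - n + 1"]
    by (simp add: A_op_def U\<^sub>f_def algebra_simps)
  have fh: "F 1 (U\<^sub>h n) = H n (U\<^sub>f 1) + s 2 (U\<^sub>f (n + 1))" if "n \<ge> 1" for n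
    using G_defect_comm[of n a\<^sub>0 a\<^sub>1 \<Phi> "- 1" "m - n - 1" "k - n"] that mk
      vanishD[OF v1, of "m - 2 * n - 1" "k - 2 * n"] vanishD[OF vG[of n], of "m - n - 2" "k - n"]
      vanishD[OF vG[of n], of "m - n - 1" "k - n"] vanishD[OF v\<delta>[of "n - 1"], of "m - n - 1" "k - n"]
    by (simp add: A_op_def G_op_def[of n "?\<delta> (- 1)"] U\<^sub>f_def U\<^sub>h_def algebra_simps neg_eq_iff_add_eq_0)
  show ?thesis
  proof (cases "\<kappa> m k = 0")
    case False
    \<comment> \<open>For n > m the values have negative first weight index and vanish, so the
      truncated sums are complete.\<close>
    define M where "M = nat m"
    have M: "m \<le> int M" "m - 1 \<le> int M" by (simp_all add: M_def)
    let ?C = "casimir_sum M U\<^sub>e U\<^sub>f U\<^sub>h"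
    have "E 0 ?C = casimir M (U\<^sub>e 0) + H 0 (U\<^sub>e 0)"
      by (rule casimir_sum_e1) (use ee ef eh V_neg[OF UV(1), of "int (Suc M)"] M in auto)
    also have "\<dots> = s (of_int (\<kappa> m (k - 1) + (int l\<^sub>1 + 2 * m - 2 * (k - 1)))) (U\<^sub>e 0)"
      using casimir_eq[OF U\<^sub>e0 M(1)] H_0[OF U\<^sub>e0] by (simp add: scale_left_distrib)
    also have "\<kappa> m (k - 1) + (int l\<^sub>1 + 2 * m - 2 * (k - 1)) = \<kappa> m k"
      by (simp add: \<kappa>_def power2_eq_square algebra_simps)
    finally have 1: "E 0 ?C = s (of_int (\<kappa> m k)) (U\<^sub>e 0)" .
    have "F 1 ?C = casimir M (U\<^sub>f 1) + (s (of_nat (l\<^sub>0 + l\<^sub>1)) (U\<^sub>f 1) - H 0 (U\<^sub>f 1))"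
      by (rule casimir_sum_e0) (use fe ff fh V_neg[OF UV(2), of "int (Suc (Suc M))"] M in auto)
    also have "\<dots> = s (of_int (\<kappa> (m - 1) k + (int (l\<^sub>0 + l\<^sub>1) - (int l\<^sub>1 + 2 * (m - 1) - 2 * k)))) (U\<^sub>f 1)"
      using casimir_eq[OF U\<^sub>f1 M(2)] H_0[OF U\<^sub>f1]
      by (simp add: scale_left_distrib scale_left_diff_distrib)
    also have "\<kappa> (m - 1) k + (int (l\<^sub>0 + l\<^sub>1) - (int l\<^sub>1 + 2 * (m - 1) - 2 * k)) = \<kappa> m k"
      by (simp add: \<kappa>_def power2_eq_square algebra_simps)
    finally have 2: "F 1 ?C = s (of_int (\<kappa> m k)) (U\<^sub>f 1)" .
    show ?thesis
      by (rule goal[of "s (1 / of_int (\<kappa> m k)) ?C"])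
        (use 1 2 False casimir_sum_V[OF UV] subspace_V in \<open>simp_all add: subspace_scale\<close>)
  next
    case True
    have "U\<^sub>e 0 = 0"
    proof (rule ccontr)
      assume nz: "U\<^sub>e 0 \<noteq> 0"
      obtain y where y: "y \<in> V m (int l\<^sub>1 + 2 * m - (k - 1))" "y \<noteq> 0"
        using reflect_1[OF U\<^sub>e0 nz] by blast
      \<comment> \<open>Reflecting the weight of \<open>U\<^sub>e 0\<close>, which is mu + alpha_1,
        gives the rho-shifted reflection of mu itself. That operation preserves \<kappa>, so the
        reflected weight must be lambda.\<close>
      have "\<kappa> m (int l\<^sub>1 + 2 * m - (k - 1)) = \<kappa> m k"
        by (simp add: \<kappa>_def power2_eq_square algebra_simps)
      with \<kappa>_eq_0[OF y] True have m: "m = 0" and k: "k = int l\<^sub>1 + 1" by auto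
      then have l: "l\<^sub>1 = N" using mk by simp
      have eq: "E 0 (\<Phi> 0 (j + 1)) - F 0 (\<Phi> 0 (j - 1)) = s a\<^sub>1 (\<Phi> 0 j)" if "j < int l\<^sub>1" for j
        using vanishD[OF v0, of 0 j] that l by (simp add: defect_def A_op_def char_val_def)
      have "\<Phi> 0 (int l\<^sub>1 + 1) = 0" using high l by simp
      then have "U\<^sub>e 0 = F 0 (\<Phi> 0 (int l\<^sub>1 - 1)) + s a\<^sub>1 (\<Phi> 0 (int l\<^sub>1))"
        by (simp add: U\<^sub>e_def m k defect_def A_op_def char_val_def)
      also have "\<dots> = 0"
        using string_end_1(1)[of \<Phi> l\<^sub>1 a\<^sub>1, OF \<Phi> v eq order_refl] c by (simp del: string_coeff.simps)
      finally show False using nz by simp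
    qed
    moreover have "U\<^sub>f 1 = 0"
    proof (rule ccontr)
      assume nz: "U\<^sub>f 1 \<noteq> 0"
      obtain y where y: "y \<in> V (int l\<^sub>0 + 2 * k - (m - 1)) k" "y \<noteq> 0"
        using reflect_0[OF U\<^sub>f1 nz] by blast
      have "\<kappa> (int l\<^sub>0 + 2 * k - (m - 1)) k = \<kappa> m k"
        by (simp add: \<kappa>_def power2_eq_square algebra_simps)
      with \<kappa>_eq_0[OF y] True have k: "k = 0" and m: "m = int l\<^sub>0 + 1" by auto
      then have l: "l\<^sub>0 = N" using mk by simp
      have eq: "F 1 (\<Phi> (j + 1) 0) - E (- 1) (\<Phi> (j - 1) 0) = s a\<^sub>0 (\<Phi> j 0)" if "j < int l\<^sub>0" for j
        using vanishD[OF v1, of j 0] that l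
        by (simp add: defect_def A_op_def char_val_def algebra_simps eq_neg_iff_add_eq_0)
      have "\<Phi> (int l\<^sub>0 + 1) 0 = 0" using high l by simp
      then have "U\<^sub>f 1 = E (- 1) (\<Phi> (int l\<^sub>0 - 1) 0) + s a\<^sub>0 (\<Phi> (int l\<^sub>0) 0)"
        by (simp add: U\<^sub>f_def m k defect_def A_op_def char_val_def)
      also have "\<dots> = 0"
        using string_end_0(1)[of \<Phi> l\<^sub>0 a\<^sub>0, OF \<Phi> v eq order_refl] c by (simp del: string_coeff.simps)
      finally show False using nz by simp
    qed
    ultimately show ?thesis using goal[of 0] subspace_0[OF subspace_V] by simp
  qed
qed

text \<open>Each equation at height N contains just one component of height N + 1, so the new
  components can be chosen independently of each other.\<close>

lemma extend:
  assumes part: "partial_solution a\<^sub>0 a\<^sub>1 N \<Phi>"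
    and c: "string_coeff l\<^sub>0 a\<^sub>0 (Suc l\<^sub>0) = 0" "string_coeff l\<^sub>1 a\<^sub>1 (Suc l\<^sub>1) = 0"
  shows "\<exists>\<Psi>. partial_solution a\<^sub>0 a\<^sub>1 (Suc N) \<Psi> \<and> (\<forall>m k. m + k \<le> int N \<longrightarrow> \<Psi> m k = \<Phi> m k)"
proof -
  let ?\<delta> = "defect a\<^sub>0 a\<^sub>1 \<Phi>"
  have "\<exists>w. m + k = int N + 1 \<longrightarrow> w \<in> V m k \<and> E 0 w = - ?\<delta> 0 m (k - 1) \<and> F 1 w = ?\<delta> (- 1) (m - 1) k" for m k
    using extend_at[OF part _ c] by blast
  then obtain W where W: "\<And>m k. m + k = int N + 1 \<Longrightarrow>
      W m k \<in> V m k \<and> E 0 (W m k) = - ?\<delta> 0 m (k - 1) \<and> F 1 (W m k) = ?\<delta> (- 1) (m - 1) k"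
    by metis
  define \<Psi> where "\<Psi> m k = (if m + k = int N + 1 then W m k else \<Phi> m k)" for m k
  have \<Phi>: "\<And>m k. \<Phi> m k \<in> V m k" and v: "\<Phi> 0 0 = v" and high: "\<And>m k. m + k > int N \<Longrightarrow> \<Phi> m k = 0"
    and v0: "vanish (int N - 1) (?\<delta> 0)" and v1: "vanish (int N - 1) (?\<delta> (- 1))"
    using part by (simp_all add: partial_solution_def)
  have "defect a\<^sub>0 a\<^sub>1 \<Psi> 0 m k = 0" if "m + k \<le> int N" for m k
  proof (cases "m + k = int N")
    case True
    then show ?thesis using W[of m "k + 1"] high[of m "k + 1"]
      by (simp add: defect_def A_op_def \<Psi>_def)
  next
    case False
    then show ?thesis using vanishD[OF v0, of m k] that by (simp add: defect_def A_op_def \<Psi>_def)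
  qed
  moreover have "defect a\<^sub>0 a\<^sub>1 \<Psi> (- 1) m k = 0" if "m + k \<le> int N" for m k
  proof (cases "m + k = int N")
    case True
    then show ?thesis using W[of "m + 1" k] high[of "m + 1" k]
      by (simp add: defect_def A_op_def \<Psi>_def)
  next
    case False
    then show ?thesis using vanishD[OF v1, of m k] that by (simp add: defect_def A_op_def \<Psi>_def)
  qed
  ultimately have "partial_solution a\<^sub>0 a\<^sub>1 (Suc N) \<Psi>"
    using \<Phi> W v high by (auto simp: partial_solution_def vanish_def \<Psi>_def)
  then show ?thesis by (auto simp: \<Psi>_def)
qed

lemma solution_exists:
  assumes c: "string_coeff l\<^sub>0 a\<^sub>0 (Suc l\<^sub>0) = 0" "string_coeff l\<^sub>1 a\<^sub>1 (Suc l\<^sub>1) = 0"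
  shows "\<exists>\<Phi>. solution a\<^sub>0 a\<^sub>1 \<Phi> \<and> \<Phi> 0 0 = v"
proof -
  define \<Phi>\<^sub>0 where "\<Phi>\<^sub>0 m k = (if m = 0 \<and> k = 0 then v else 0)" for m k :: int
  have "partial_solution a\<^sub>0 a\<^sub>1 0 \<Phi>\<^sub>0"
    using V_neg[OF E_V[OF v_V(1), of 0]] V_neg[OF F_V[OF v_V(1), of 1]] v_V(1) subspace_0[OF subspace_V]
    by (auto simp: partial_solution_def vanish_def defect_def A_op_def \<Phi>\<^sub>0_def)
  then obtain f where f: "\<And>N. partial_solution a\<^sub>0 a\<^sub>1 N (f N)"
    and agree: "\<And>N m k. m + k \<le> int N \<Longrightarrow> f (Suc N) m k = f N m k"
    using dependent_nat_choice[of "partial_solution a\<^sub>0 a\<^sub>1"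
        "\<lambda>N \<Phi> \<Psi>. \<forall>m k. m + k \<le> int N \<longrightarrow> \<Psi> m k = \<Phi> m k"] extend[OF _ c]
    by blast
  \<comment> \<open>A component is settled at the stage equal to its own height.\<close>
  define \<Phi> where "\<Phi> m k = f (nat (m + k)) m k" for m k
  have eq: "\<Phi> m k = f N m k" if "m + k \<le> int N" for m k N
    using that
  proof (induction N)
    case 0
    then show ?case by (simp add: \<Phi>_def)
  next
    case (Suc N)
    show ?case
    proof (cases "m + k \<le> int N")
      case True
      then show ?thesis using Suc.IH agree by simp
    next
      case False
      then have "nat (m + k) = Suc N" using Suc.prems by simp
      then show ?thesis by (simp add: \<Phi>_def)
    qed
  qed
  have "defect a\<^sub>0 a\<^sub>1 \<Phi> n m k = 0" if n: "n = 0 \<or> n = - 1" for n m k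
  proof -
    let ?N = "nat (m + k + 1)"
    have "defect a\<^sub>0 a\<^sub>1 \<Phi> n m k = defect a\<^sub>0 a\<^sub>1 (f ?N) n m k"
      using n by (auto simp: defect_def A_op_def eq[where N = ?N])
    also have "\<dots> = 0"
      using f[of ?N] n by (auto simp: partial_solution_def vanish_def)
    finally show ?thesis .
  qed
  then have "solution a\<^sub>0 a\<^sub>1 \<Phi>"
    using f by (simp add: solution_def \<Phi>_def partial_solution_def)
  moreover have "\<Phi> 0 0 = v"
    using f[of 0] by (simp add: \<Phi>_def partial_solution_def)
  ultimately show ?thesis by blast
qed

end

section \<open>The fixed subalgebra\<close>

definition fix_A :: "int \<Rightarrow> affine" where "fix_A n = loop n sl2_e - loop (- n) sl2_f"
definition fix_G :: "int \<Rightarrow> affine" where "fix_G n = loop n sl2_h - loop (- n) sl2_h"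

lemma fix_A_fixed: "fix_A n \<in> fixed_algebra" and fix_G_fixed: "fix_G n \<in> fixed_algebra"
  by (auto simp: fix_A_def fix_G_def fixed_algebra_iff loop_def lookup_minus lookup_single when_def
      sl2_eq_iff)

lemma affine_bracket_fix:
  "affine_bracket (fix_A n) (fix_A 0) = - fix_G n"
  "affine_bracket (fix_G 1) (fix_A n) = affine_scale 2 (fix_A (n + 1) - fix_A (n - 1))"
  unfolding fix_A_def fix_G_def affine_bracket_diff affine_bracket_loop
  by (auto simp: affine_eq_iff loop_def affine_c_def lookup_minus lookup_add lookup_single when_def
      sl2_eq_iff sl2_form_coord)

lemma B_fix: "fix_A 0 = affine_scale (- \<i>) B\<^sub>1" "fix_A (- 1) = affine_scale \<i> B\<^sub>0"
  by (auto simp: fix_A_def B\<^sub>0_def B\<^sub>1_def e\<^sub>0_def f\<^sub>0_def e\<^sub>1_def f\<^sub>1_def)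

lemma loop_decomp: "loop n x = affine_scale (coord_e x) (loop n sl2_e)
    + affine_scale (coord_f x) (loop n sl2_f) + affine_scale (coord_h x) (loop n sl2_h)"
  by (auto simp: affine_eq_iff loop_def lookup_add lookup_single when_def sl2_eq_iff)

lemma affine_spanned:
  assumes S: "affine.subspace S"
    and gen: "\<And>n. loop n sl2_e \<in> S" "\<And>n. loop n sl2_f \<in> S" "\<And>n. loop n sl2_h \<in> S"
      "affine_c \<in> S" "affine_d \<in> S"
  shows "x \<in> S"
proof -
  have "loop n y \<in> S" for n y
    by (subst loop_decomp) (intro affine.subspace_add[OF S] affine.subspace_scale[OF S] gen)
  then show ?thesis
    by (subst affine_expansion[of x]) (intro affine.subspace_add[OF S] affine.subspace_scale[OF S]
        affine.subspace_sum[OF S] gen)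
qed

lemma affine_theta_linear:
  "affine_theta (x + y) = affine_theta x + affine_theta y"
  "affine_theta (affine_scale a x) = affine_scale a (affine_theta x)"
  using linear_affine_theta unfolding Vector_Spaces.linear_iff by blast+

text \<open>A fixed x is half of x + theta(x), so it is enough to symmetrize the spanning elements
  of the affine algebra.\<close>

lemma fixed_algebra_spanned:
  assumes S: "affine.subspace S" and gen: "\<And>n. fix_A n \<in> S" "\<And>n. fix_G n \<in> S"
    and x: "x \<in> fixed_algebra"
  shows "x \<in> S"
proof -
  have "x \<in> {x. x + affine_theta x \<in> S}"
  proof (rule affine_spanned)
    have 0: "affine_theta 0 = 0" using affine_theta_linear(2)[of 0 0] by simp
    have add: "(x + y) + affine_theta (x + y) = (x + affine_theta x) + (y + affine_theta y)" for x y
      by (simp add: affine_theta_linear)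
    have scale: "affine_scale a x + affine_theta (affine_scale a x) = affine_scale a (x + affine_theta x)" for a x
      by (simp add: affine_theta_linear affine.scale_right_distrib)
    show "affine.subspace {x. x + affine_theta x \<in> S}"
      by (rule affine.subspaceI)
        (simp_all only: mem_Collect_eq add scale 0 affine.subspace_0[OF S] affine.subspace_add[OF S]
          affine.subspace_scale[OF S] add_0)
    fix n
    have "loop n sl2_e + affine_theta (loop n sl2_e) = fix_A n"
      "loop n sl2_f + affine_theta (loop n sl2_f) = - fix_A (- n)"
      "loop n sl2_h + affine_theta (loop n sl2_h) = fix_G n"
      "affine_c + affine_theta affine_c = 0" "affine_d + affine_theta affine_d = 0"
      by (auto simp: affine_eq_iff loop_def lookup_add lookup_minus lookup_single when_def sl2_eq_iff
          fix_A_def fix_G_def affine_c_def affine_d_def)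
    then show "loop n sl2_e \<in> {x. x + affine_theta x \<in> S}" "loop n sl2_f \<in> {x. x + affine_theta x \<in> S}"
      "loop n sl2_h \<in> {x. x + affine_theta x \<in> S}" "affine_c \<in> {x. x + affine_theta x \<in> S}"
      "affine_d \<in> {x. x + affine_theta x \<in> S}"
      using gen affine.subspace_neg[OF S] affine.subspace_0[OF S] by simp_all
  qed
  then have "affine_scale (1 / 2) (x + x) \<in> S"
    using x affine.subspace_scale[OF S] by (simp add: fixed_algebra_def chevalley_eq)
  moreover have "affine_scale (1 / 2) (x + x) = x"
    by (simp add: affine.scale_right_distrib flip: affine.scale_left_distrib)
  ultimately show ?thesis by simp
qed

lemma one_dim_rep_simps:
  assumes "one_dim_rep \<psi>"
  shows "x \<in> fixed_algebra \<Longrightarrow> y \<in> fixed_algebra \<Longrightarrow> \<psi> (x + y) = \<psi> x + \<psi> y"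
    "x \<in> fixed_algebra \<Longrightarrow> \<psi> (affine_scale a x) = a * \<psi> x"
    "x \<in> fixed_algebra \<Longrightarrow> y \<in> fixed_algebra \<Longrightarrow> \<psi> (affine_bracket x y) = 0"
    "\<psi> 0 = 0" "x \<in> fixed_algebra \<Longrightarrow> \<psi> (- x) = - \<psi> x"
    "x \<in> fixed_algebra \<Longrightarrow> y \<in> fixed_algebra \<Longrightarrow> \<psi> (x - y) = \<psi> x - \<psi> y"
proof -
  show add: "\<psi> (x + y) = \<psi> x + \<psi> y" if "x \<in> fixed_algebra" "y \<in> fixed_algebra" for x y
    using assms that by (simp add: one_dim_rep_def)
  show scale: "\<psi> (affine_scale a x) = a * \<psi> x" if "x \<in> fixed_algebra" for a x
    using assms that by (simp add: one_dim_rep_def)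
  show "\<psi> (affine_bracket x y) = 0" if "x \<in> fixed_algebra" "y \<in> fixed_algebra" for x y
    using assms that by (simp add: one_dim_rep_def)
  show "\<psi> 0 = 0" using scale[of 0 0] affine.subspace_0[OF fixed_algebra_subspace] by simp
  show neg: "\<psi> (- x) = - \<psi> x" if "x \<in> fixed_algebra" for x
    using scale[OF that, of "- 1"] by simp
  show "\<psi> (x - y) = \<psi> x - \<psi> y" if "x \<in> fixed_algebra" "y \<in> fixed_algebra" for x y
    using add[OF that(1) affine.subspace_neg[OF fixed_algebra_subspace that(2)]] neg[OF that(2)] by simp
qed

text \<open>A character kills brackets. Both \<open>fix_G n\<close> and
  \<open>fix_A (n + 1) - fix_A (n - 1)\<close> are multiples of brackets, so only the parity of n
  matters.\<close>

lemma chi_fix: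
  "chi a b (fix_A n) = (if even n then - \<i> * b else \<i> * a)" "chi a b (fix_G n) = 0"
proof -
  note rep = one_dim_rep_simps[OF chi_is_rep(1)[of a b]]
  have "chi a b (- fix_G n) = 0"
    unfolding affine_bracket_fix(1)[symmetric] by (intro rep fix_A_fixed)
  then show "chi a b (fix_G n) = 0" using rep(5)[OF fix_G_fixed] by simp
  have step: "chi a b (fix_A (n + 1)) = chi a b (fix_A (n - 1))" for n
  proof -
    have "chi a b (affine_scale 2 (fix_A (n + 1) - fix_A (n - 1))) = 0"
      unfolding affine_bracket_fix(2)[symmetric] by (intro rep fix_A_fixed fix_G_fixed)
    then show ?thesis
      using rep(2)[OF affine.subspace_diff[OF fixed_algebra_subspace fix_A_fixed fix_A_fixed]]
        rep(6)[OF fix_A_fixed fix_A_fixed] by simp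
  qed
  have "(chi a b (fix_A n) = (if even n then - \<i> * b else \<i> * a))
      \<and> (chi a b (fix_A (n - 1)) = (if even n then \<i> * a else - \<i> * b))"
  proof (induction n rule: int_induct[where k = 0])
    case base
    show ?case by (simp add: B_fix rep(2,5) B_fixed chi_is_rep affine.subspace_scale[OF fixed_algebra_subspace])
  next
    case (step1 i)
    then show ?case using step[of i] by simp
  next
    case (step2 i)
    then show ?case using step[of "i - 1"] by (auto split: if_splits)
  qed
  then show "chi a b (fix_A n) = (if even n then - \<i> * b else \<i> * a)" by blast
qed

section \<open>The roots\<close>

text \<open>The simple roots are extended to the whole algebra, so that their linearity needs no
  membership in \<open>cartan\<close>.\<close>

definition alpha1 :: "affine \<Rightarrow> complex" where
  "alpha1 x = 2 * coord_h (Poly_Mapping.lookup (fst x) 0)"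

text \<open>The coefficient of d is the null root alpha_0 + alpha_1.\<close>

definition alpha0 :: "affine \<Rightarrow> complex" where
  "alpha0 x = snd (snd x) - alpha1 x"

lemma alpha_linear:
  "alpha1 (x + y) = alpha1 x + alpha1 y" "alpha1 (affine_scale a x) = a * alpha1 x"
  "alpha0 (x + y) = alpha0 x + alpha0 y" "alpha0 (affine_scale a x) = a * alpha0 x"
  by (simp_all add: alpha1_def alpha0_def lookup_add algebra_simps)

lemma alpha_values:
  "alpha0 h\<^sub>0 = 2" "alpha0 h\<^sub>1 = - 2" "alpha0 affine_d = 1"
  "alpha1 h\<^sub>0 = - 2" "alpha1 h\<^sub>1 = 2" "alpha1 affine_d = 0"
  by (simp_all add: alpha1_def alpha0_def h\<^sub>0_def h\<^sub>1_def affine_d_def affine_c_def loop_def lookup_minus)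

lemma cartan_gens: "h\<^sub>0 \<in> cartan" "h\<^sub>1 \<in> cartan" "affine_d \<in> cartan" "affine_c \<in> cartan"
proof -
  show *: "h\<^sub>0 \<in> cartan" "h\<^sub>1 \<in> cartan" "affine_d \<in> cartan"
    by (auto simp: cartan_def intro: affine.span_base)
  have "h\<^sub>0 + h\<^sub>1 \<in> cartan" using * unfolding cartan_def by (blast intro: affine.span_add)
  then show "affine_c \<in> cartan" by (simp add: h\<^sub>0_def h\<^sub>1_def)
qed

lemma cartan_fst:
  assumes "x \<in> cartan"
  shows "\<exists>a. fst x = Poly_Mapping.single 0 (sl2_scale a sl2_h)"
  using assms unfolding cartan_def
proof (induction rule: affine.span_induct_alt)
  case base
  then show ?case by (intro exI[of _ 0]) simp
next
  case (step c y z)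
  then obtain a where a: "fst z = Poly_Mapping.single 0 (sl2_scale a sl2_h)" by blast
  obtain a' where a': "fst y = Poly_Mapping.single 0 (sl2_scale a' sl2_h)"
  proof -
    have "fst h\<^sub>0 = Poly_Mapping.single 0 (sl2_scale (- 1) sl2_h)"
      "fst h\<^sub>1 = Poly_Mapping.single 0 (sl2_scale 1 sl2_h)"
      "fst affine_d = Poly_Mapping.single 0 (sl2_scale 0 sl2_h)"
      by (auto simp: h\<^sub>0_def h\<^sub>1_def affine_d_def affine_c_def loop_def lookup_minus lookup_single when_def
          sl2_eq_iff intro!: poly_mapping_eqI)
    then show ?thesis using step(1) that by blast
  qed
  have "fst (affine_scale c y + z) = Poly_Mapping.single 0 (sl2_scale (c * a' + a) sl2_h)"
    by (auto simp: a a' lookup_add lookup_single when_def sl2_eq_iff algebra_simps intro!: poly_mapping_eqI)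
  then show ?case by blast
qed

lemma cartan_bracket:
  assumes "x \<in> cartan"
  shows "affine_bracket x (loop n sl2_e) = affine_scale (of_int n * alpha0 x + of_int (n + 1) * alpha1 x) (loop n sl2_e)"
    "affine_bracket x (loop n sl2_f) = affine_scale (of_int n * alpha0 x + of_int (n - 1) * alpha1 x) (loop n sl2_f)"
    "affine_bracket x (loop n sl2_h) = affine_scale (of_int n * alpha0 x + of_int n * alpha1 x) (loop n sl2_h)"
proof -
  obtain a where a: "fst x = Poly_Mapping.single 0 (sl2_scale a sl2_h)" using cartan_fst[OF assms] by blast
  have k: "Poly_Mapping.keys (Poly_Mapping.single 0 (sl2_scale a sl2_h)) \<subseteq> {0}" by simp
  have "affine_bracket x (loop n y)
      = loop n (sl2_scale (of_int n * snd (snd x)) y + sl2_bracket (sl2_scale a sl2_h) y)" for y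
    by (auto simp: affine_eq_iff lookup_loop_bracket[OF _ k] loop_cocycle_superset[OF _ k] loop_def
        lookup_add lookup_minus lookup_single when_def a sl2_eq_iff)
  then show "affine_bracket x (loop n sl2_e) = affine_scale (of_int n * alpha0 x + of_int (n + 1) * alpha1 x) (loop n sl2_e)"
    "affine_bracket x (loop n sl2_f) = affine_scale (of_int n * alpha0 x + of_int (n - 1) * alpha1 x) (loop n sl2_f)"
    "affine_bracket x (loop n sl2_h) = affine_scale (of_int n * alpha0 x + of_int n * alpha1 x) (loop n sl2_h)"
    by (auto simp: affine_scale_loop alpha0_def alpha1_def a sl2_eq_iff algebra_simps intro!: arg_cong[where f = "loop n"])
qed

section \<open>The irreducible module \<open>V(\<lambda>)\<close>\<close>

locale standard_module = vector_space s
  for s :: "complex \<Rightarrow> 'v \<Rightarrow> 'v::ab_group_add" +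
  fixes \<rho> :: "affine \<Rightarrow> 'v \<Rightarrow> 'v" and lam :: "affine \<Rightarrow> complex"
  assumes dominant: "lam \<in> dominant_weights" and is_V: "is_V s \<rho> lam"
begin

lemma rho_hom: "module_hom s s (\<rho> x)"
  using is_V unfolding is_V_def irreducible_module_def affine_module_def Vector_Spaces.linear_iff
  by (simp add: module_hom_iff module_iff_vector_space del: split_paired_All)

lemma rho_simps [simp]:
  "\<rho> x 0 = 0" "\<rho> x (u + w) = \<rho> x u + \<rho> x w" "\<rho> x (u - w) = \<rho> x u - \<rho> x w"
  "\<rho> x (s c u) = s c (\<rho> x u)"
  by (simp_all add: rho_hom[THEN module_hom.zero] rho_hom[THEN module_hom.add]
      rho_hom[THEN module_hom.diff] rho_hom[THEN module_hom.scale])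

lemma rho_add: "\<rho> (x + y) w = \<rho> x w + \<rho> y w"
  and rho_scale: "\<rho> (affine_scale c x) w = s c (\<rho> x w)"
  and rho_bracket: "\<rho> (affine_bracket x y) w = \<rho> x (\<rho> y w) - \<rho> y (\<rho> x w)"
proof -
  have "affine_module s \<rho>" using is_V by (simp add: is_V_def irreducible_module_def)
  then show "\<rho> (x + y) w = \<rho> x w + \<rho> y w" "\<rho> (affine_scale c x) w = s c (\<rho> x w)"
    "\<rho> (affine_bracket x y) w = \<rho> x (\<rho> y w) - \<rho> y (\<rho> x w)"
    by (simp_all add: affine_module_def del: split_paired_All)
qed

lemma rho_minus: "\<rho> (- x) w = - \<rho> x w"
  using rho_scale[of "- 1" x w] by simp

lemma rho_zero: "\<rho> 0 w = 0"
  using rho_scale[of 0 0 w] by simp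

lemma rho_comm: "\<rho> x (\<rho> y w) = \<rho> y (\<rho> x w) + \<rho> (affine_bracket x y) w"
  by (simp add: rho_bracket)

definition l0 :: nat where "l0 = (THE n. lam h\<^sub>0 = of_nat n)"
definition l1 :: nat where "l1 = (THE n. lam h\<^sub>1 = of_nat n)"

lemma lam_h: "lam h\<^sub>0 = of_nat l0" "lam h\<^sub>1 = of_nat l1"
  using dominant unfolding dominant_weights_def l0_def l1_def by (auto simp: Nats_def)

lemma lam_dual: "lam \<in> cartan_dual"
  using dominant by (simp add: dominant_weights_def weight_lattice_def)

text \<open>The cutoff is there because \<open>alpha0\<close> and \<open>alpha1\<close> do not
  vanish off \<open>cartan\<close>, while members of \<open>cartan_dual\<close> do.\<close>

definition wt :: "int \<Rightarrow> int \<Rightarrow> affine \<Rightarrow> complex" where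
  "wt m k x = (if x \<in> cartan then lam x - of_int m * alpha0 x - of_int k * alpha1 x else 0)"

lemma cartan_subspace: "affine.subspace cartan"
  unfolding cartan_def by (rule affine.subspace_span)

lemma cartan_dual_0: "\<mu> \<in> cartan_dual \<Longrightarrow> x \<notin> cartan \<Longrightarrow> \<mu> x = 0"
  unfolding cartan_dual_def by blast

lemma wt_dual: "wt m k \<in> cartan_dual"
  using lam_dual affine.subspace_add[OF cartan_subspace] affine.subspace_scale[OF cartan_subspace]
  unfolding cartan_dual_def mem_Collect_eq
  by (auto simp: wt_def alpha_linear algebra_simps)

lemma wt_lattice: "wt m k \<in> weight_lattice"
proof -
  have "lam h\<^sub>0 \<in> \<int>" "lam h\<^sub>1 \<in> \<int>" "lam affine_d \<in> \<int>"
    using dominant by (simp_all add: dominant_weights_def weight_lattice_def)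
  then show ?thesis
    by (simp add: weight_lattice_def wt_dual) (simp add: wt_def cartan_gens alpha_values)
qed

lemma wt_inject: "wt m k = wt m' k' \<longleftrightarrow> m = m' \<and> k = k'"
proof
  assume "wt m k = wt m' k'"
  then have "wt m k affine_d = wt m' k' affine_d" "wt m k h\<^sub>1 = wt m' k' h\<^sub>1" by simp_all
  then show "m = m' \<and> k = k'" by (auto simp: wt_def cartan_gens alpha_values)
qed simp

lemma wt_00: "wt 0 0 = lam"
  using lam_dual by (auto simp: wt_def cartan_dual_def)

lemma weight_lattice_infinite: "infinite weight_lattice"
proof -
  have "inj (\<lambda>m. wt m 0)" by (auto simp: inj_def wt_inject)
  then have "infinite (range (\<lambda>m. wt m 0))" by (simp add: finite_image_iff)
  then show ?thesis using wt_lattice by (meson finite_subset image_subsetI)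
qed

abbreviation W :: "(affine \<Rightarrow> complex) \<Rightarrow> 'v set" where "W \<equiv> weight_space s \<rho>"
definition V :: "int \<Rightarrow> int \<Rightarrow> 'v set" where "V m k = W (wt m k)"

lemma W_subspace: "subspace (W \<mu>)"
  by (rule subspaceI) (auto simp: weight_space_def scale_right_distrib mult.commute)

lemma V_iff: "w \<in> V m k \<longleftrightarrow>
    (\<forall>h\<in>cartan. \<rho> h w = s (lam h - of_int m * alpha0 h - of_int k * alpha1 h) w)"
  by (auto simp: V_def weight_space_def wt_def)

lemma V_cartan: "w \<in> V m k \<Longrightarrow> h \<in> cartan \<Longrightarrow>
    \<rho> h w = s (lam h - of_int m * alpha0 h - of_int k * alpha1 h) w"
  by (simp add: V_iff)

lemma root_vector_V:
  assumes w: "w \<in> V m k"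
    and y: "\<And>h. h \<in> cartan \<Longrightarrow> affine_bracket h y = affine_scale (of_int i * alpha0 h + of_int j * alpha1 h) y"
  shows "\<rho> y w \<in> V (m - i) (k - j)"
  unfolding V_iff
proof
  fix h assume h: "h \<in> cartan"
  have "\<rho> h (\<rho> y w) = s (lam h - of_int m * alpha0 h - of_int k * alpha1 h) (\<rho> y w)
      + s (of_int i * alpha0 h + of_int j * alpha1 h) (\<rho> y w)"
    unfolding rho_comm[of h y] y[OF h] rho_scale V_cartan[OF w h] rho_simps ..
  also have "\<dots> = s (lam h - of_int (m - i) * alpha0 h - of_int (k - j) * alpha1 h) (\<rho> y w)"
    unfolding scale_left_distrib[symmetric]
    by (rule arg_cong[where f = "\<lambda>c. s c (\<rho> y w)"]) (simp add: left_diff_distrib)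
  finally show "\<rho> h (\<rho> y w) = s (lam h - of_int (m - i) * alpha0 h - of_int (k - j) * alpha1 h) (\<rho> y w)" .
qed

lemma
  assumes "w \<in> V m k"
  shows E_V: "\<rho> (loop n sl2_e) w \<in> V (m - n) (k - n - 1)"
    and F_V: "\<rho> (loop n sl2_f) w \<in> V (m - n) (k - n + 1)"
    and H_V: "\<rho> (loop n sl2_h) w \<in> V (m - n) (k - n)"
  using root_vector_V[OF assms cartan_bracket(1), of n] root_vector_V[OF assms cartan_bracket(2), of n]
    root_vector_V[OF assms cartan_bracket(3), of n]
  by (simp_all add: algebra_simps)

lemma c_V: assumes "w \<in> V m k" shows "\<rho> affine_c w = s (of_nat (l0 + l1)) w"
proof -
  have c: "affine_c = h\<^sub>0 + h\<^sub>1" by (simp add: h\<^sub>0_def h\<^sub>1_def)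
  have "\<rho> h\<^sub>0 w + \<rho> h\<^sub>1 w = s (of_nat (l0 + l1)) w"
    unfolding V_cartan[OF assms cartan_gens(1)] V_cartan[OF assms cartan_gens(2)] scale_left_distrib[symmetric]
    by (rule arg_cong[where f = "\<lambda>c. s c w"]) (simp add: lam_h alpha_values)
  then show ?thesis unfolding c rho_add .
qed

subsection \<open>Independence of the weight spaces\<close>

text \<open>Applying h - mu(h) removes the term at mu, and any other functional differs from mu at
  some h.\<close>

lemma weights_independent:
  assumes "finite S" "S \<subseteq> cartan_dual" "\<And>\<nu>. \<nu> \<in> S \<Longrightarrow> f \<nu> \<in> W \<nu>" "(\<Sum>\<nu>\<in>S. f \<nu>) = 0"
  shows "\<forall>\<nu>\<in>S. f \<nu> = 0"
  using assms
proof (induction S arbitrary: f)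
  case (insert \<mu> S)
  have "s (\<nu> h - \<mu> h) (f \<nu>) = 0" if h: "h \<in> cartan" and \<nu>: "\<nu> \<in> S" for h \<nu>
  proof -
    have "\<rho> h (\<Sum>\<nu>\<in>insert \<mu> S. f \<nu>) = (\<Sum>\<nu>\<in>insert \<mu> S. s (\<nu> h) (f \<nu>))"
      using insert.prems(2) h
      by (subst module_hom.sum[OF rho_hom]) (auto simp: weight_space_def intro!: sum.cong)
    then have "(\<Sum>\<nu>\<in>insert \<mu> S. s (\<nu> h) (f \<nu>)) - s (\<mu> h) (\<Sum>\<nu>\<in>insert \<mu> S. f \<nu>) = 0"
      using insert.prems(3) by simp
    then have "(\<Sum>\<nu>\<in>insert \<mu> S. s (\<nu> h - \<mu> h) (f \<nu>)) = 0"
      by (simp add: scale_sum_right scale_left_diff_distrib sum_subtractf)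
    then have "(\<Sum>\<nu>\<in>S. s (\<nu> h - \<mu> h) (f \<nu>)) = 0"
      using insert.hyps by simp
    then show ?thesis
      using insert.IH[of "\<lambda>\<nu>. s (\<nu> h - \<mu> h) (f \<nu>)"] insert.prems \<nu> W_subspace
      by (simp add: subspace_scale)
  qed
  moreover have "\<exists>h\<in>cartan. \<nu> h \<noteq> \<mu> h" if "\<nu> \<in> S" for \<nu>
  proof (rule ccontr)
    assume "\<not> ?thesis"
    then have "\<nu> x = \<mu> x" for x
      using insert.prems(1) that cartan_dual_0[of \<nu> x] cartan_dual_0[of \<mu> x] by (cases "x \<in> cartan") auto
    then show False using that insert.hyps by (metis ext)
  qed
  ultimately have "\<forall>\<nu>\<in>S. f \<nu> = 0" by (metis scale_eq_0_iff right_minus_eq)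
  with insert show ?case by simp
qed simp

lemma span_weights:
  assumes "w \<in> span (\<Union>\<nu>\<in>T. W \<nu>)"
  shows "\<exists>S f. finite S \<and> S \<subseteq> T \<and> (\<forall>\<nu>. f \<nu> \<in> W \<nu>) \<and> w = (\<Sum>\<nu>\<in>S. f \<nu>)"
  using assms
proof (induction rule: span_induct_alt)
  case base
  show ?case by (intro exI[of _ "{}"] exI[of _ "\<lambda>_. 0"]) (simp add: subspace_0[OF W_subspace])
next
  case (step c x y)
  then obtain S f \<nu> where S: "finite S" "S \<subseteq> T" "\<And>\<nu>. f \<nu> \<in> W \<nu>" "y = (\<Sum>\<nu>\<in>S. f \<nu>)"
    and \<nu>: "\<nu> \<in> T" "x \<in> W \<nu>" by blast
  let ?f = "\<lambda>\<mu>. (if \<mu> \<in> S then f \<mu> else 0) + (if \<mu> = \<nu> then s c x else 0)"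
  have "(\<Sum>\<mu>\<in>insert \<nu> S. ?f \<mu>) = (\<Sum>\<mu>\<in>insert \<nu> S. if \<mu> \<in> S then f \<mu> else 0) + s c x"
    using S(1) by (simp add: sum.distrib)
  also have "(\<Sum>\<mu>\<in>insert \<nu> S. if \<mu> \<in> S then f \<mu> else 0) = y"
    unfolding S(4) using S(1) by (intro sum.mono_neutral_cong_right) auto
  finally have "s c x + y = (\<Sum>\<mu>\<in>insert \<nu> S. ?f \<mu>)" by simp
  moreover have "?f \<mu> \<in> W \<mu>" for \<mu>
    using S(3) \<nu> W_subspace by (auto intro!: subspace_add subspace_scale subspace_0)
  ultimately show ?case using S \<nu>
    by (intro exI[of _ "insert \<nu> S"] exI[of _ ?f]) auto
qed

lemma weight_span_disjoint:
  assumes w: "w \<in> W \<mu>" "w \<in> span (\<Union>\<nu>\<in>T. W \<nu>)" and T: "\<mu> \<in> cartan_dual" "T \<subseteq> cartan_dual" "\<mu> \<notin> T"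
  shows "w = 0"
proof -
  obtain S f where S: "finite S" "S \<subseteq> T" "\<And>\<nu>. f \<nu> \<in> W \<nu>" "w = (\<Sum>\<nu>\<in>S. f \<nu>)"
    using span_weights[OF w(2)] by blast
  have \<mu>: "\<mu> \<notin> S" using S T by blast
  have "\<forall>\<nu>\<in>insert \<mu> S. (if \<nu> = \<mu> then - w else f \<nu>) = 0"
  proof (rule weights_independent)
    have "(\<Sum>\<nu>\<in>S. if \<nu> = \<mu> then - w else f \<nu>) = w"
      unfolding S(4) using \<mu> by (intro sum.cong) auto
    then show "(\<Sum>\<nu>\<in>insert \<mu> S. if \<nu> = \<mu> then - w else f \<nu>) = 0"
      using S(1) \<mu> by simp
  qed (use S T w W_subspace in \<open>auto simp: subspace_neg\<close>)
  then show ?thesis by simp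
qed

subsection \<open>Modules generated by singular vectors\<close>

text \<open>Words in the lowering generators with their letters counted, so that the weight of the
  result is known.\<close>

inductive f_word :: "'v \<Rightarrow> nat \<Rightarrow> nat \<Rightarrow> 'v \<Rightarrow> bool" for w where
  base: "f_word w 0 0 w"
| step0: "f_word w i j x \<Longrightarrow> f_word w (Suc i) j (\<rho> f\<^sub>0 x)"
| step1: "f_word w i j x \<Longrightarrow> f_word w i (Suc j) (\<rho> f\<^sub>1 x)"

lemma f_word_V: "f_word w i j x \<Longrightarrow> w \<in> V m k \<Longrightarrow> x \<in> V (m + int i) (k + int j)"
proof (induction rule: f_word.induct)
  case (step0 i j x)
  then show ?case using E_V[of x "m + int i" "k + int j" "- 1"] by (simp add: f\<^sub>0_def algebra_simps)
next
  case (step1 i j x)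
  then show ?case using F_V[of x "m + int i" "k + int j" 0] by (simp add: f\<^sub>1_def algebra_simps)
qed simp

lemma chevalley_brackets:
  "affine_bracket e\<^sub>0 f\<^sub>0 = h\<^sub>0" "affine_bracket e\<^sub>1 f\<^sub>1 = h\<^sub>1"
  "affine_bracket e\<^sub>0 f\<^sub>1 = 0" "affine_bracket e\<^sub>1 f\<^sub>0 = 0"
  unfolding e\<^sub>0_def f\<^sub>0_def e\<^sub>1_def f\<^sub>1_def h\<^sub>0_def h\<^sub>1_def affine_bracket_loop
  by (auto simp: affine_eq_iff loop_def affine_c_def lookup_add lookup_minus lookup_single when_def
      sl2_eq_iff sl2_form_coord)

text \<open>By \<open>affine_generated\<close> it suffices that the Chevalley generators and d
  preserve the span. A raising generator is moved to the right through a word; the brackets that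
  appear lie in the Cartan subalgebra and act by scalars. Irreducibility does the rest.\<close>

lemma singular_generates:
  assumes w: "w \<in> V m k" "w \<noteq> 0" and e: "\<rho> e\<^sub>0 w = 0" "\<rho> e\<^sub>1 w = 0"
  shows "span {x. \<exists>i j. f_word w i j x} = UNIV"
proof -
  define R where "R = span {x. \<exists>i j. f_word w i j x}"
  have R: "subspace R" unfolding R_def by (rule subspace_span)
  have words: "x \<in> R" if "f_word w i j x" for i j x
    unfolding R_def using that by (blast intro: span_base)
  have stable: "\<forall>u\<in>R. \<rho> y u \<in> R" if "\<And>i j x. f_word w i j x \<Longrightarrow> \<rho> y x \<in> R" for y
  proof
    fix u assume "u \<in> R"
    then show "\<rho> y u \<in> R" unfolding R_def
    proof (induction rule: span_induct_alt)
      case (step c x z)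
      then show ?case using that R unfolding R_def[symmetric]
        by (auto intro!: subspace_add[OF R] subspace_scale[OF R])
    qed (simp add: span_zero)
  qed
  have f: "\<forall>u\<in>R. \<rho> f\<^sub>0 u \<in> R" "\<forall>u\<in>R. \<rho> f\<^sub>1 u \<in> R"
    by (auto intro!: stable words f_word.intros)
  have h: "\<rho> h x \<in> R" if "h \<in> cartan" "f_word w i j x" for h i j x
    using V_cartan[OF f_word_V[OF that(2) w(1)] that(1)] words[OF that(2)] R by (simp add: subspace_scale)
  have e0: "\<rho> e\<^sub>0 x \<in> R" if "f_word w i j x" for i j x
    using that
  proof (induction rule: f_word.induct)
    case (step0 i j x)
    then show ?case
      using f(1) h[OF cartan_gens(1) step0(1)] R by (subst rho_comm) (simp add: chevalley_brackets subspace_add)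
  next
    case (step1 i j x)
    then show ?case using f(2) by (subst rho_comm) (simp add: chevalley_brackets rho_zero)
  qed (simp add: e subspace_0[OF R])
  have e1: "\<rho> e\<^sub>1 x \<in> R" if "f_word w i j x" for i j x
    using that
  proof (induction rule: f_word.induct)
    case (step1 i j x)
    then show ?case
      using f(2) h[OF cartan_gens(2) step1(1)] R by (subst rho_comm) (simp add: chevalley_brackets subspace_add)
  next
    case (step0 i j x)
    then show ?case using f(1) by (subst rho_comm) (simp add: chevalley_brackets rho_zero)
  qed (simp add: e subspace_0[OF R])
  have "y \<in> {y. \<forall>u\<in>R. \<rho> y u \<in> R}" for y
  proof (rule affine_generated)
    show "affine.subspace {y. \<forall>u\<in>R. \<rho> y u \<in> R}"
      by (rule affine.subspaceI)
        (auto simp: rho_zero rho_add rho_scale intro: subspace_0[OF R] subspace_add[OF R] subspace_scale[OF R])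
    show "affine_bracket x y \<in> {y. \<forall>u\<in>R. \<rho> y u \<in> R}"
      if "x \<in> {y. \<forall>u\<in>R. \<rho> y u \<in> R}" "y \<in> {y. \<forall>u\<in>R. \<rho> y u \<in> R}" for x y
      using that by (auto simp: rho_bracket intro: subspace_diff[OF R])
  qed (use f in \<open>auto intro!: stable intro: e0 e1 h cartan_gens\<close>)
  then have "submodule s \<rho> R" using R by (simp add: submodule_def)
  moreover have "w \<in> R" using words[OF f_word.base] .
  ultimately show ?thesis
    using is_V w(2) unfolding is_V_def irreducible_module_def R_def by blast
qed

definition hwv :: 'v where "hwv = (SOME v. highest_weight_vector s \<rho> lam v)"

lemma hwv: "hwv \<in> V 0 0" "hwv \<noteq> 0" "\<rho> e\<^sub>0 hwv = 0" "\<rho> e\<^sub>1 hwv = 0"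
proof -
  have "\<exists>v. highest_weight_vector s \<rho> lam v"
    using is_V unfolding is_V_def highest_weight_module_def by blast
  then have "highest_weight_vector s \<rho> lam hwv" unfolding hwv_def by (rule someI_ex)
  then show "hwv \<in> V 0 0" "hwv \<noteq> 0" "\<rho> e\<^sub>0 hwv = 0" "\<rho> e\<^sub>1 hwv = 0"
    by (simp_all add: highest_weight_vector_def V_def wt_00)
qed

lemma singular_weights:
  assumes w: "w \<in> V m k" "w \<noteq> 0" and e: "\<rho> e\<^sub>0 w = 0" "\<rho> e\<^sub>1 w = 0"
  shows "span (\<Union>\<nu>\<in>{wt (m + int i) (k + int j) |i j. True}. W \<nu>) = UNIV"
proof -
  have "{x. \<exists>i j. f_word w i j x} \<subseteq> (\<Union>\<nu>\<in>{wt (m + int i) (k + int j) |i j. True}. W \<nu>)"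
    using f_word_V[OF _ w(1)] unfolding V_def by blast
  from span_mono[OF this] show ?thesis using singular_generates[OF assms] by blast
qed

lemma weights_of_V:
  assumes "w \<in> W \<mu>" "w \<noteq> 0" "\<mu> \<in> cartan_dual"
  shows "\<exists>i j::nat. \<mu> = wt (int i) (int j)"
proof (rule ccontr)
  assume "\<not> ?thesis"
  then have "\<mu> \<notin> {wt (0 + int i) (0 + int j) |i j. True}" by auto
  from weight_span_disjoint[OF assms(1) _ assms(3) _ this]
  show False using singular_weights[OF hwv] assms(2) wt_dual by blast
qed

lemma V_neg: assumes "w \<in> V m k" "m < 0 \<or> k < 0" shows "w = 0"
  using weights_of_V[of w "wt m k"] assms wt_dual by (force simp: V_def wt_inject)

text \<open>The empty word is the only one of weight lambda; all others lie in weight spaces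
  independent of that one.\<close>

lemma V_00: assumes x: "x \<in> V 0 0" shows "\<exists>c. x = s c hwv"
proof -
  define T where "T = {wt (int i) (int j) |i j. (i, j) \<noteq> (0, 0)}"
  have T: "T \<subseteq> cartan_dual" "wt 0 0 \<notin> T" by (auto simp: T_def wt_dual wt_inject)
  have "{x. \<exists>i j. f_word hwv i j x} \<subseteq> insert hwv (\<Union>\<nu>\<in>T. W \<nu>)"
  proof clarify
    fix x i j assume x: "f_word hwv i j x" "x \<notin> (\<Union>\<nu>\<in>T. W \<nu>)"
    then have "(i, j) = (0, 0)" using f_word_V[OF x(1) hwv(1)] by (auto simp: V_def T_def)
    with x(1) show "x = hwv" by (auto elim: f_word.cases)
  qed
  from span_mono[OF this] have "x \<in> span (insert hwv (\<Union>\<nu>\<in>T. W \<nu>))"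
    using singular_generates[OF hwv] by blast
  then obtain c where c: "x - s c hwv \<in> span (\<Union>\<nu>\<in>T. W \<nu>)" by (auto simp: span_breakdown_eq)
  have "x - s c hwv \<in> W (wt 0 0)"
    using x hwv(1) W_subspace unfolding V_def by (blast intro: subspace_diff subspace_scale)
  from weight_span_disjoint[OF this c wt_dual T] show ?thesis by (intro exI[of _ c]) simp
qed

text \<open>A nonzero singular vector generates the module by words, all of weights at or below its
  own. The highest weight vector could then not be reached.\<close>

lemma no_singular:
  assumes w: "w \<in> V m k" "(m, k) \<noteq> (0, 0)" and e: "\<rho> e\<^sub>0 w = 0" "\<rho> e\<^sub>1 w = 0"
  shows "w = 0"
proof (rule ccontr)
  assume nz: "w \<noteq> 0"
  then have mk: "m \<ge> 0" "k \<ge> 0" using V_neg[OF w(1)] by force+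
  have "wt 0 0 \<notin> {wt (m + int i) (k + int j) |i j. True}" using w(2) mk by (auto simp: wt_inject)
  from weight_span_disjoint[OF _ _ wt_dual _ this] show False
    using singular_weights[OF w(1) nz e] hwv(1,2) wt_dual unfolding V_def by blast
qed

lemma c_acts: "\<rho> affine_c w = s (of_nat (l0 + l1)) w"
proof -
  have "w \<in> span (\<Union>\<nu>\<in>{wt (0 + int i) (0 + int j) |i j. True}. W \<nu>)"
    using singular_weights[OF hwv] by blast
  then show ?thesis
  proof (induction rule: span_induct_alt)
    case (step c x y)
    then obtain m k where "x \<in> V m k" unfolding V_def by blast
    then show ?case using step(2) c_V by (simp add: scale_right_distrib mult.commute)
  qed simp
qed

lemma graded: "graded_affine_module s (\<lambda>n. \<rho> (loop n sl2_e)) (\<lambda>n. \<rho> (loop n sl2_f))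
  (\<lambda>n. \<rho> (loop n sl2_h)) V l0 l1 hwv"
proof (intro graded_affine_module.intro graded_affine_module_axioms.intro rho_hom)
  show "vector_space s" by (rule vector_space_axioms)
  fix m n k x
  have br: "affine_bracket (loop m sl2_e) (loop n sl2_e) = 0"
    "affine_bracket (loop m sl2_f) (loop n sl2_f) = 0"
    "affine_bracket (loop m sl2_e) (loop n sl2_f) = loop (m + n) sl2_h
       + affine_scale (if m = - n then of_int m else 0) affine_c"
    "affine_bracket (loop m sl2_h) (loop n sl2_e) = affine_scale 2 (loop (m + n) sl2_e)"
    "affine_bracket (loop m sl2_h) (loop n sl2_f) = affine_scale (- 2) (loop (m + n) sl2_f)"
    unfolding affine_bracket_loop
    by (auto simp: affine_eq_iff loop_def affine_c_def lookup_add lookup_minus lookup_single when_def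
        sl2_eq_iff sl2_form_coord)
  show "\<rho> (loop m sl2_e) (\<rho> (loop n sl2_e) x) = \<rho> (loop n sl2_e) (\<rho> (loop m sl2_e) x)"
    "\<rho> (loop m sl2_f) (\<rho> (loop n sl2_f) x) = \<rho> (loop n sl2_f) (\<rho> (loop m sl2_f) x)"
    "\<rho> (loop m sl2_e) (\<rho> (loop n sl2_f) x) = \<rho> (loop n sl2_f) (\<rho> (loop m sl2_e) x)
      + \<rho> (loop (m + n) sl2_h) x + s (if m = - n then of_int m * of_nat (l0 + l1) else 0) x"
    "\<rho> (loop m sl2_h) (\<rho> (loop n sl2_e) x) = \<rho> (loop n sl2_e) (\<rho> (loop m sl2_h) x)
      + s 2 (\<rho> (loop (m + n) sl2_e) x)"
    "\<rho> (loop m sl2_h) (\<rho> (loop n sl2_f) x) = \<rho> (loop n sl2_f) (\<rho> (loop m sl2_h) x)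
      - s 2 (\<rho> (loop (m + n) sl2_f) x)"
    by (subst rho_comm; simp add: br rho_zero rho_add rho_scale rho_minus c_acts)+
  show "subspace (V m k)" unfolding V_def by (rule W_subspace)
  show "hwv \<in> V 0 0" "hwv \<noteq> 0" by (rule hwv)+
  show "\<exists>n. (\<rho> (loop 0 sl2_e) ^^ n) x = 0" "\<exists>n. (\<rho> (loop 0 sl2_f) ^^ n) x = 0"
    "\<exists>n. (\<rho> (loop 1 sl2_f) ^^ n) x = 0" "\<exists>n. (\<rho> (loop (- 1) sl2_e) ^^ n) x = 0"
    using is_V unfolding is_V_def integrable_module_def e\<^sub>0_def f\<^sub>0_def e\<^sub>1_def f\<^sub>1_def by blast+
  show "\<exists>c. x = s c hwv" if "x \<in> V 0 0" using that by (rule V_00)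
  assume x: "x \<in> V m k"
  show "\<rho> (loop n sl2_e) x \<in> V (m - n) (k - n - 1)" "\<rho> (loop n sl2_f) x \<in> V (m - n) (k - n + 1)"
    "\<rho> (loop n sl2_h) x \<in> V (m - n) (k - n)"
    using x by (rule E_V F_V H_V)+
  have "\<rho> (loop 0 sl2_h) x = s (lam h\<^sub>1 - of_int m * alpha0 h\<^sub>1 - of_int k * alpha1 h\<^sub>1) x"
    using V_cartan[OF x cartan_gens(2)] by (simp add: h\<^sub>1_def)
  also have "lam h\<^sub>1 - of_int m * alpha0 h\<^sub>1 - of_int k * alpha1 h\<^sub>1 = of_int (int l1 + 2 * m - 2 * k)"
    by (simp add: lam_h alpha_values)
  finally show "\<rho> (loop 0 sl2_h) x = s (of_int (int l1 + 2 * m - 2 * k)) x" .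
  show "m < 0 \<or> k < 0 \<Longrightarrow> x = 0" by (rule V_neg[OF x])
  show "(m, k) \<noteq> (0, 0) \<Longrightarrow> \<rho> (loop 0 sl2_e) x = 0 \<Longrightarrow> \<rho> (loop 1 sl2_f) x = 0 \<Longrightarrow> x = 0"
    using no_singular[OF x] by (simp add: e\<^sub>0_def e\<^sub>1_def)
qed

sublocale graded: graded_affine_module s "\<lambda>n. \<rho> (loop n sl2_e)" "\<lambda>n. \<rho> (loop n sl2_f)"
  "\<lambda>n. \<rho> (loop n sl2_h)" V l0 l1 hwv
  by (rule graded)

section \<open>The completion\<close>

abbreviation "proj \<equiv> weight_projection s \<rho>"
abbreviation "action \<equiv> completion_action s \<rho>"

section \<open>Weight projections\<close>

lemma weights_span: "span (\<Union>\<nu>\<in>cartan_dual. W \<nu>) = UNIV"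
  using is_V unfolding is_V_def integrable_module_def by blast

lemma proj_eqI:
  assumes \<mu>: "\<mu> \<in> cartan_dual" and u: "u \<in> W \<mu>" "w - u \<in> span (\<Union>\<nu>\<in>cartan_dual - {\<mu>}. W \<nu>)"
  shows "proj \<mu> w = u"
  unfolding weight_projection_def
proof (rule the_equality)
  fix u' assume u': "u' \<in> W \<mu> \<and> w - u' \<in> span (\<Union>\<nu>\<in>cartan_dual - {\<mu>}. W \<nu>)"
  have "u' - u \<in> W \<mu>" using u(1) u' by (blast intro: subspace_diff[OF W_subspace])
  moreover have "(w - u) - (w - u') \<in> span (\<Union>\<nu>\<in>cartan_dual - {\<mu>}. W \<nu>)"
    using u(2) u' by (blast intro: span_diff)
  then have "u' - u \<in> span (\<Union>\<nu>\<in>cartan_dual - {\<mu>}. W \<nu>)" by simp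
  ultimately have "u' - u = 0" using \<mu> by (rule weight_span_disjoint) auto
  then show "u' = u" by simp
qed (use u in blast)

lemma proj_ex:
  assumes "\<mu> \<in> cartan_dual"
  shows "\<exists>u. u \<in> W \<mu> \<and> w - u \<in> span (\<Union>\<nu>\<in>cartan_dual - {\<mu>}. W \<nu>)"
proof -
  let ?R = "span (\<Union>\<nu>\<in>cartan_dual - {\<mu>}. W \<nu>)"
  have "w \<in> span (\<Union>\<nu>\<in>cartan_dual. W \<nu>)" using weights_span by blast
  then show ?thesis
  proof (induction rule: span_induct_alt)
    case base
    show ?case by (intro exI[of _ 0]) (simp add: subspace_0[OF W_subspace] span_zero)
  next
    case (step c x y)
    then obtain u \<nu> where u: "u \<in> W \<mu>" "y - u \<in> ?R" and x: "x \<in> W \<nu>" "\<nu> \<in> cartan_dual" by blast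
    show ?case
    proof (cases "\<nu> = \<mu>")
      case True
      then have "s c x + u \<in> W \<mu>" using u x W_subspace by (blast intro: subspace_add subspace_scale)
      then show ?thesis using u by (intro exI[of _ "s c x + u"]) simp
    next
      case False
      then have "s c x \<in> ?R" using x by (blast intro: span_base span_scale)
      then have "s c x + (y - u) \<in> ?R" using u(2) by (rule span_add)
      then show ?thesis using u by (intro exI[of _ u]) (simp add: algebra_simps)
    qed
  qed
qed

lemma proj:
  assumes "\<mu> \<in> cartan_dual"
  shows proj_W: "proj \<mu> w \<in> W \<mu>"
    and proj_rest: "w - proj \<mu> w \<in> span (\<Union>\<nu>\<in>cartan_dual - {\<mu>}. W \<nu>)"
  using proj_ex[OF assms, of w] proj_eqI[OF assms] by metis+

lemma proj_add:
  assumes "\<mu> \<in> cartan_dual"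
  shows "proj \<mu> (u + w) = proj \<mu> u + proj \<mu> w"
proof (rule proj_eqI[OF assms])
  show "proj \<mu> u + proj \<mu> w \<in> W \<mu>" using proj_W[OF assms] by (blast intro: subspace_add[OF W_subspace])
  have "(u - proj \<mu> u) + (w - proj \<mu> w) \<in> span (\<Union>\<nu>\<in>cartan_dual - {\<mu>}. W \<nu>)"
    by (intro span_add proj_rest assms)
  then show "u + w - (proj \<mu> u + proj \<mu> w) \<in> span (\<Union>\<nu>\<in>cartan_dual - {\<mu>}. W \<nu>)"
    by (simp add: algebra_simps)
qed

lemma proj_scale:
  assumes "\<mu> \<in> cartan_dual"
  shows "proj \<mu> (s c w) = s c (proj \<mu> w)"
proof (rule proj_eqI[OF assms])
  show "s c (proj \<mu> w) \<in> W \<mu>" using proj_W[OF assms] by (blast intro: subspace_scale[OF W_subspace])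
  have "s c (w - proj \<mu> w) \<in> span (\<Union>\<nu>\<in>cartan_dual - {\<mu>}. W \<nu>)"
    by (intro span_scale proj_rest assms)
  then show "s c w - s c (proj \<mu> w) \<in> span (\<Union>\<nu>\<in>cartan_dual - {\<mu>}. W \<nu>)"
    by (simp add: scale_right_diff_distrib)
qed

lemma proj_weight:
  assumes "\<mu> \<in> cartan_dual" "\<nu> \<in> cartan_dual" "w \<in> W \<nu>"
  shows "proj \<mu> w = (if \<nu> = \<mu> then w else 0)"
proof (rule proj_eqI[OF assms(1)])
  show "w - (if \<nu> = \<mu> then w else 0) \<in> span (\<Union>\<nu>\<in>cartan_dual - {\<mu>}. W \<nu>)"
    using assms by (auto intro: span_base span_zero)
qed (use assms subspace_0[OF W_subspace] in auto)

lemma proj_trivial: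
  assumes "\<mu> \<in> cartan_dual" "\<And>m k. \<mu> \<noteq> wt m k"
  shows "proj \<mu> w = 0"
  using weights_of_V[OF proj_W[OF assms(1), of w] _ assms(1)] assms(2) by blast

text \<open>For \<open>\<mu>\<close> that is no functional on the Cartan subalgebra the projection is the junk value of
  \<open>THE\<close>, which does not depend on the projected vector; the sum over the infinite weight lattice is
  then \<open>0\<close> in any case.\<close>

lemma action_junk:
  assumes "\<And>m k. \<mu> \<noteq> wt m k"
  shows "action x \<Phi> \<mu> = 0"
proof (cases "\<mu> \<in> cartan_dual")
  case True
  then show ?thesis using assms by (simp add: completion_action_def proj_trivial)
next
  case False
  then have "cartan_dual - {\<mu>} = cartan_dual" by blast
  then have "proj \<mu> w = (THE u. u \<in> W \<mu>)" for w
    unfolding weight_projection_def by (simp add: weights_span)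
  then obtain c where c: "\<And>w. proj \<mu> w = c" by blast
  then show ?thesis
    using weight_lattice_infinite by (cases "c = 0") (simp_all add: completion_action_def)
qed

text \<open>The index set of the sum in \<open>completion_action\<close>. Its finiteness has to be
  proved before any linearity in x, because an infinite sum takes the default value 0.\<close>

definition support :: "((affine \<Rightarrow> complex) \<Rightarrow> 'v) \<Rightarrow> int \<Rightarrow> int \<Rightarrow> affine \<Rightarrow> (affine \<Rightarrow> complex) set" where
  "support \<Phi> m k x = {\<nu> \<in> weight_lattice. proj (wt m k) (\<rho> x (\<Phi> \<nu>)) \<noteq> 0}"

lemma action_superset:
  assumes "finite S" "support \<Phi> m k x \<subseteq> S" "S \<subseteq> weight_lattice"
  shows "action x \<Phi> (wt m k) = (\<Sum>\<nu>\<in>S. proj (wt m k) (\<rho> x (\<Phi> \<nu>)))"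
  unfolding completion_action_def support_def[symmetric]
  by (rule sum.mono_neutral_left) (use assms in \<open>auto simp: support_def\<close>)

lemma completion_V: "\<Phi> \<in> completion s \<rho> \<Longrightarrow> \<Phi> (wt m k) \<in> V m k"
  using wt_lattice by (auto simp: completion_def V_def)

lemma completion_0: "\<Phi> \<in> completion s \<rho> \<Longrightarrow> (\<And>m k. \<mu> \<noteq> wt m k) \<Longrightarrow> \<Phi> \<mu> = 0"
  using weights_of_V[of "\<Phi> \<mu>" \<mu>] unfolding completion_def weight_lattice_def by blast

text \<open>A root vector shifts all weights by one root, so a single component of the family
  contributes.\<close>

lemma
  assumes \<Phi>: "\<Phi> \<in> completion s \<rho>"
    and x: "\<And>m k w. w \<in> V m k \<Longrightarrow> \<rho> x w \<in> V (m - i) (k - j)"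
  shows support_root: "support \<Phi> m k x \<subseteq> {wt (m + i) (k + j)}"
    and action_root: "action x \<Phi> (wt m k) = \<rho> x (\<Phi> (wt (m + i) (k + j)))"
proof -
  have p: "proj (wt m k) (\<rho> x (\<Phi> (wt m' k')))
      = (if m' - i = m \<and> k' - j = k then \<rho> x (\<Phi> (wt m' k')) else 0)" for m' k'
    using proj_weight[OF wt_dual wt_dual x[OF completion_V[OF \<Phi>, of m' k'], unfolded V_def], of m k]
    by (simp add: wt_inject)
  show sub: "support \<Phi> m k x \<subseteq> {wt (m + i) (k + j)}"
  proof
    fix \<nu> assume \<nu>: "\<nu> \<in> support \<Phi> m k x"
    then have "\<Phi> \<nu> \<noteq> 0"
      using proj_weight[OF wt_dual wt_dual subspace_0[OF W_subspace], of m k m k] by (auto simp: support_def)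
    then obtain m' k' where "\<nu> = wt m' k'" using completion_0[OF \<Phi>] by blast
    then show "\<nu> \<in> {wt (m + i) (k + j)}" using \<nu> p[of m' k'] by (auto simp: support_def split: if_splits)
  qed
  show "action x \<Phi> (wt m k) = \<rho> x (\<Phi> (wt (m + i) (k + j)))"
    using action_superset[OF _ sub] wt_lattice p[of "m + i" "k + j"] by simp
qed

text \<open>The elements with finite support form a subspace, and it contains the root vectors, c
  and d, each having at most one contributing component.\<close>

lemma support_finite:
  assumes \<Phi>: "\<Phi> \<in> completion s \<rho>"
  shows "finite (support \<Phi> m k x)"
proof -
  have "x \<in> {x. finite (support \<Phi> m k x)}"
  proof (rule affine_spanned)
    have p0: "proj (wt m k) 0 = 0" using proj_scale[OF wt_dual, of m k 0 0] by simp
    have sub_add: "support \<Phi> m k (x + y) \<subseteq> support \<Phi> m k x \<union> support \<Phi> m k y" for x y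
      by (auto simp: support_def rho_add proj_add wt_dual)
    have sub_scale: "support \<Phi> m k (affine_scale c x) \<subseteq> support \<Phi> m k x" for c x
      by (auto simp: support_def rho_scale proj_scale wt_dual)
    show "affine.subspace {x. finite (support \<Phi> m k x)}"
    proof (rule affine.subspaceI, unfold mem_Collect_eq)
      show "finite (support \<Phi> m k 0)" by (simp add: support_def rho_zero p0)
      show "finite (support \<Phi> m k (x + y))" if "finite (support \<Phi> m k x)" "finite (support \<Phi> m k y)" for x y
        by (rule finite_subset[OF sub_add]) (simp add: that)
      show "finite (support \<Phi> m k (affine_scale c x))" if "finite (support \<Phi> m k x)" for c x
        by (rule finite_subset[OF sub_scale that])
    qed
    have fin: "x \<in> {x. finite (support \<Phi> m k x)}"
      if "\<And>m k w. w \<in> V m k \<Longrightarrow> \<rho> x w \<in> V (m - i) (k - j)" for x i j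
      using finite_subset[OF support_root[OF \<Phi> that]] by simp
    show "loop n sl2_e \<in> {x. finite (support \<Phi> m k x)}" for n
      by (rule fin[of _ n "n + 1"]) (metis E_V diff_diff_eq)
    show "loop n sl2_f \<in> {x. finite (support \<Phi> m k x)}" for n
      by (rule fin[of _ n "n - 1"]) (use F_V in \<open>simp add: algebra_simps\<close>)
    show "loop n sl2_h \<in> {x. finite (support \<Phi> m k x)}" for n
      by (rule fin[of _ n n]) (rule H_V)
    have V: "subspace (V m k)" for m k unfolding V_def by (rule W_subspace)
    show "affine_c \<in> {x. finite (support \<Phi> m k x)}"
      by (rule fin[of _ 0 0]) (simp add: V_cartan[OF _ cartan_gens(4)] subspace_scale[OF V])
    show "affine_d \<in> {x. finite (support \<Phi> m k x)}"
      by (rule fin[of _ 0 0]) (simp add: V_cartan[OF _ cartan_gens(3)] subspace_scale[OF V])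
  qed
  then show ?thesis by simp
qed

lemma
  assumes \<Phi>: "\<Phi> \<in> completion s \<rho>"
  shows action_add: "action (x + y) \<Phi> \<mu> = action x \<Phi> \<mu> + action y \<Phi> \<mu>"
    and action_scale: "action (affine_scale c x) \<Phi> \<mu> = s c (action x \<Phi> \<mu>)"
proof -
  have "action (x + y) \<Phi> \<mu> = action x \<Phi> \<mu> + action y \<Phi> \<mu>
      \<and> action (affine_scale c x) \<Phi> \<mu> = s c (action x \<Phi> \<mu>)"
  proof (cases "\<exists>m k. \<mu> = wt m k")
    case True
    then obtain m k where \<mu>: "\<mu> = wt m k" by blast
    let ?S = "support \<Phi> m k (x + y) \<union> support \<Phi> m k x \<union> support \<Phi> m k y \<union> support \<Phi> m k (affine_scale c x)"
    have S: "finite ?S" "?S \<subseteq> weight_lattice"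
      using support_finite[OF \<Phi>] by (auto simp: support_def)
    note eq = action_superset[OF S(1) _ S(2)]
    have "action (x + y) \<Phi> \<mu> = (\<Sum>\<nu>\<in>?S. proj \<mu> (\<rho> (x + y) (\<Phi> \<nu>)))"
      "action x \<Phi> \<mu> = (\<Sum>\<nu>\<in>?S. proj \<mu> (\<rho> x (\<Phi> \<nu>)))"
      "action y \<Phi> \<mu> = (\<Sum>\<nu>\<in>?S. proj \<mu> (\<rho> y (\<Phi> \<nu>)))"
      "action (affine_scale c x) \<Phi> \<mu> = (\<Sum>\<nu>\<in>?S. proj \<mu> (\<rho> (affine_scale c x) (\<Phi> \<nu>)))"
      unfolding \<mu> by (rule eq; blast)+
    then show ?thesis
      by (simp only: rho_add rho_scale proj_add[OF wt_dual] proj_scale[OF wt_dual] \<mu> sum.distrib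
          scale_sum_right simp_thms)
  next
    case False
    then have "\<And>m k. \<mu> \<noteq> wt m k" by blast
    from action_junk[OF this] show ?thesis by simp
  qed
  then show "action (x + y) \<Phi> \<mu> = action x \<Phi> \<mu> + action y \<Phi> \<mu>"
    "action (affine_scale c x) \<Phi> \<mu> = s c (action x \<Phi> \<mu>)" by blast+
qed

lemma action_diff:
  assumes "\<Phi> \<in> completion s \<rho>"
  shows "action (x - y) \<Phi> \<mu> = action x \<Phi> \<mu> - action y \<Phi> \<mu>"
  using action_add[OF assms, of "x - y" y \<mu>] by simp

lemma action_fix:
  assumes \<Phi>: "\<Phi> \<in> completion s \<rho>"
  shows "action (fix_A n) \<Phi> (wt m k) = graded.A_op n (\<lambda>m k. \<Phi> (wt m k)) m k"
    "action (fix_G n) \<Phi> (wt m k) = graded.G_op n (\<lambda>m k. \<Phi> (wt m k)) m k"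
proof -
  have "action (loop n sl2_e) \<Phi> (wt m k) = \<rho> (loop n sl2_e) (\<Phi> (wt (m + n) (k + (n + 1))))"
    for n by (rule action_root[OF \<Phi>]) (metis E_V diff_diff_eq)
  moreover have "action (loop n sl2_f) \<Phi> (wt m k) = \<rho> (loop n sl2_f) (\<Phi> (wt (m + n) (k + (n - 1))))"
    for n by (rule action_root[OF \<Phi>]) (use F_V in \<open>simp add: algebra_simps\<close>)
  moreover have "action (loop n sl2_h) \<Phi> (wt m k) = \<rho> (loop n sl2_h) (\<Phi> (wt (m + n) (k + n)))"
    for n by (rule action_root[OF \<Phi>]) (rule H_V)
  ultimately show "action (fix_A n) \<Phi> (wt m k) = graded.A_op n (\<lambda>m k. \<Phi> (wt m k)) m k"
    "action (fix_G n) \<Phi> (wt m k) = graded.G_op n (\<lambda>m k. \<Phi> (wt m k)) m k"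
    by (simp_all add: fix_A_def fix_G_def action_diff[OF \<Phi>] graded.A_op_def graded.G_op_def algebra_simps)
qed

section \<open>Invariants in the completion\<close>

abbreviation "solution a\<^sub>0 a\<^sub>1 \<equiv> graded.solution (- \<i> * a\<^sub>0) (- \<i> * a\<^sub>1)"

lemma invariants_solution:
  assumes "\<Phi> \<in> completion_invariants s \<rho> (chi a\<^sub>0 a\<^sub>1)"
  shows "\<Phi> \<in> completion s \<rho>" "solution a\<^sub>0 a\<^sub>1 (\<lambda>m k. \<Phi> (wt m k))"
proof -
  show \<Phi>: "\<Phi> \<in> completion s \<rho>"
    using assms by (simp add: completion_invariants_def rep_invariants_def)
  have "action (fix_A n) \<Phi> = pointwise_scale s (chi a\<^sub>0 a\<^sub>1 (fix_A n)) \<Phi>" for n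
    using assms fix_A_fixed unfolding completion_invariants_def rep_invariants_def by blast
  then have "graded.defect (- \<i> * a\<^sub>0) (- \<i> * a\<^sub>1) (\<lambda>m k. \<Phi> (wt m k)) n m k = 0" for n m k
    unfolding graded.defect_def action_fix[OF \<Phi>, symmetric]
    by (simp add: pointwise_scale_def chi_fix graded.char_val_def)
  then show "solution a\<^sub>0 a\<^sub>1 (\<lambda>m k. \<Phi> (wt m k))"
    using completion_V[OF \<Phi>] by (simp add: graded.solution_def)
qed

lemma solution_invariants:
  assumes \<Phi>: "\<Phi> \<in> completion s \<rho>" and sol: "solution a\<^sub>0 a\<^sub>1 (\<lambda>m k. \<Phi> (wt m k))"
  shows "\<Phi> \<in> completion_invariants s \<rho> (chi a\<^sub>0 a\<^sub>1)"
proof -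
  let ?\<chi> = "chi a\<^sub>0 a\<^sub>1"
  \<comment> \<open>The eigenvalue equation is linear in x, so testing it on the spanning set is
    enough.\<close>
  define S where "S = {x \<in> fixed_algebra. \<forall>\<mu>. action x \<Phi> \<mu> = s (?\<chi> x) (\<Phi> \<mu>)}"
  note rep = one_dim_rep_simps[OF chi_is_rep(1)[of a\<^sub>0 a\<^sub>1]]
  note k = fixed_algebra_subspace
  have S: "affine.subspace S"
  proof (rule affine.subspaceI)
    show "0 \<in> S"
      using action_scale[OF \<Phi>, of 0 0] by (simp add: S_def affine.subspace_0[OF k] rep)
    show "x + y \<in> S" if "x \<in> S" "y \<in> S" for x y
      using that by (simp add: S_def affine.subspace_add[OF k] rep action_add[OF \<Phi>] scale_left_distrib)
    show "affine_scale c x \<in> S" if "x \<in> S" for c x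
      using that by (simp add: S_def affine.subspace_scale[OF k] rep action_scale[OF \<Phi>])
  qed
  have off: "action x \<Phi> \<mu> = s c (\<Phi> \<mu>)" if "\<And>m k. \<mu> \<noteq> wt m k" for x \<mu> c
    using action_junk[OF that] completion_0[OF \<Phi> that] by simp
  have "action (fix_A n) \<Phi> (wt m k) = s (?\<chi> (fix_A n)) (\<Phi> (wt m k))" for n m k
    using graded.solution_all(1)[OF sol, of n m k]
    by (simp add: graded.defect_def action_fix[OF \<Phi>] chi_fix graded.char_val_def)
  then have "action (fix_A n) \<Phi> \<mu> = s (?\<chi> (fix_A n)) (\<Phi> \<mu>)" for n \<mu>
    using off[of \<mu>] by (cases "\<exists>m k. \<mu> = wt m k") auto
  then have A: "fix_A n \<in> S" for n by (simp add: S_def fix_A_fixed)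
  have "action (fix_G n) \<Phi> (wt m k) = s (?\<chi> (fix_G n)) (\<Phi> (wt m k))" for n m k
    using graded.solution_all(2)[OF sol, of n m k] by (simp add: action_fix[OF \<Phi>] chi_fix)
  then have "action (fix_G n) \<Phi> \<mu> = s (?\<chi> (fix_G n)) (\<Phi> \<mu>)" for n \<mu>
    using off[of \<mu>] by (cases "\<exists>m k. \<mu> = wt m k") auto
  then have G: "fix_G n \<in> S" for n by (simp add: S_def fix_G_fixed)
  have "action x \<Phi> = pointwise_scale s (?\<chi> x) \<Phi>" if "x \<in> fixed_algebra" for x
    using fixed_algebra_spanned[OF S A G that] by (auto simp: S_def pointwise_scale_def)
  then show ?thesis using \<Phi> by (simp add: completion_invariants_def rep_invariants_def)
qed

section \<open>Linear structure and dimension of the space of invariants\<close>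

lemma completion_scale: "\<Phi> \<in> completion s \<rho> \<Longrightarrow> pointwise_scale s c \<Phi> \<in> completion s \<rho>"
  by (auto simp: completion_def pointwise_scale_def intro: subspace_scale[OF W_subspace])

lemma completion_diff: "\<Phi> \<in> completion s \<rho> \<Longrightarrow> \<Psi> \<in> completion s \<rho> \<Longrightarrow> \<Phi> - \<Psi> \<in> completion s \<rho>"
  by (auto simp: completion_def intro: subspace_diff[OF W_subspace])

lemma solution_scale: "solution a\<^sub>0 a\<^sub>1 \<Phi> \<Longrightarrow> solution a\<^sub>0 a\<^sub>1 (\<lambda>m k. s c (\<Phi> m k))"
  using graded.subspace_V
  by (auto simp: graded.solution_def graded.defect_def graded.A_op_def subspace_scale
      scale_left_commute simp flip: scale_right_diff_distrib)

lemma solution_diff: "solution a\<^sub>0 a\<^sub>1 \<Phi> \<Longrightarrow> solution a\<^sub>0 a\<^sub>1 \<Psi> \<Longrightarrow> solution a\<^sub>0 a\<^sub>1 (\<lambda>m k. \<Phi> m k - \<Psi> m k)"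
  using graded.subspace_V
  by (auto simp: graded.solution_def graded.defect_def graded.A_op_def subspace_diff
      scale_right_diff_distrib algebra_simps)

lemma invariants_scale:
  assumes "\<Phi> \<in> completion_invariants s \<rho> (chi a\<^sub>0 a\<^sub>1)"
  shows "pointwise_scale s c \<Phi> \<in> completion_invariants s \<rho> (chi a\<^sub>0 a\<^sub>1)"
proof -
  note sol = invariants_solution[OF assms]
  have "solution a\<^sub>0 a\<^sub>1 (\<lambda>m k. pointwise_scale s c \<Phi> (wt m k))"
    unfolding pointwise_scale_def by (rule solution_scale[OF sol(2)])
  then show ?thesis by (rule solution_invariants[OF completion_scale[OF sol(1)]])
qed

lemma invariants_diff:
  assumes "\<Phi> \<in> completion_invariants s \<rho> (chi a\<^sub>0 a\<^sub>1)" "\<Psi> \<in> completion_invariants s \<rho> (chi a\<^sub>0 a\<^sub>1)"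
  shows "\<Phi> - \<Psi> \<in> completion_invariants s \<rho> (chi a\<^sub>0 a\<^sub>1)"
proof -
  note sol = invariants_solution[OF assms(1)] invariants_solution[OF assms(2)]
  have "solution a\<^sub>0 a\<^sub>1 (\<lambda>m k. (\<Phi> - \<Psi>) (wt m k))"
    unfolding minus_apply by (rule solution_diff[OF sol(2,4)])
  then show ?thesis by (rule solution_invariants[OF completion_diff[OF sol(1,3)]])
qed

lemma invariants_eq_0:
  assumes "\<Phi> \<in> completion_invariants s \<rho> (chi a\<^sub>0 a\<^sub>1)" "\<Phi> lam = 0"
  shows "\<Phi> = 0"
proof
  fix \<mu>
  note sol = invariants_solution[OF assms(1)]
  have "\<Phi> (wt m k) = 0" for m k
    using graded.solution_unique[OF sol(2), of m k] assms(2) by (simp add: wt_00)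
  then show "\<Phi> \<mu> = 0 \<mu>" using completion_0[OF sol(1), of \<mu>] by (cases "\<exists>m k. \<mu> = wt m k") auto
qed

lemma invariants_0: "0 \<in> completion_invariants s \<rho> (chi a\<^sub>0 a\<^sub>1)"
proof (rule solution_invariants)
  show "0 \<in> completion s \<rho>" by (simp add: completion_def subspace_0[OF W_subspace])
  show "solution a\<^sub>0 a\<^sub>1 (\<lambda>m k. (0 :: (affine \<Rightarrow> complex) \<Rightarrow> 'v) (wt m k))"
    using subspace_0[OF graded.subspace_V]
    by (simp add: graded.solution_def graded.defect_def graded.A_op_def)
qed

lemma invariants_trivial:
  assumes "string_coeff l0 (- \<i> * a\<^sub>0) (Suc l0) \<noteq> 0 \<or> string_coeff l1 (- \<i> * a\<^sub>1) (Suc l1) \<noteq> 0"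
  shows "completion_invariants s \<rho> (chi a\<^sub>0 a\<^sub>1) = {0}"
proof -
  have "\<Phi> = 0" if \<Phi>: "\<Phi> \<in> completion_invariants s \<rho> (chi a\<^sub>0 a\<^sub>1)" for \<Phi>
  proof (rule invariants_eq_0[OF that], rule ccontr)
    note sol = invariants_solution[OF \<Phi>]
    assume "\<Phi> lam \<noteq> 0"
    obtain c where c: "\<Phi> lam = s c hwv"
      using graded.V_00[OF completion_V[OF sol(1), of 0 0]] by (auto simp: wt_00)
    have "c \<noteq> 0" using c \<open>\<Phi> lam \<noteq> 0\<close> by auto
    \<comment> \<open>Normalizes the top component to the highest weight vector, as
      \<open>solution_necessary\<close> requires.\<close>
    then have "s (1 / c) (\<Phi> (wt 0 0)) = hwv" by (simp add: wt_00 c)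
    from graded.solution_necessary[OF solution_scale[OF sol(2), of "1 / c"] this]
    show False using assms by blast
  qed
  then show ?thesis using invariants_0 by blast
qed

lemma invariants_one_dim:
  assumes "string_coeff l0 (- \<i> * a\<^sub>0) (Suc l0) = 0" "string_coeff l1 (- \<i> * a\<^sub>1) (Suc l1) = 0"
  shows "\<exists>\<Psi>. \<Psi> \<noteq> 0 \<and> completion_invariants s \<rho> (chi a\<^sub>0 a\<^sub>1) = range (\<lambda>c. pointwise_scale s c \<Psi>)"
proof -
  obtain F where F: "solution a\<^sub>0 a\<^sub>1 F" "F 0 0 = hwv"
    using graded.solution_exists[OF assms] by blast
  define \<Psi> where "\<Psi> \<mu> = (if \<exists>m k. \<mu> = wt m k then F (THE m. \<exists>k. \<mu> = wt m k) (THE k. \<exists>m. \<mu> = wt m k) else 0)" for \<mu>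
  have \<Psi>: "\<Psi> (wt m k) = F m k" for m k
    by (auto simp: \<Psi>_def wt_inject)
  have FV: "F m k \<in> W (wt m k)" for m k
    using F(1) by (simp add: graded.solution_def V_def)
  have "\<Psi> \<in> completion s \<rho>"
    unfolding completion_def
  proof (intro CollectI conjI ballI allI impI)
    show "\<Psi> \<mu> \<in> W \<mu>" for \<mu>
    proof (cases "\<exists>m k. \<mu> = wt m k")
      case True
      then show ?thesis using FV \<Psi> by fastforce
    next
      case False
      then show ?thesis using subspace_0[OF W_subspace] by (simp add: \<Psi>_def)
    qed
    show "\<Psi> \<mu> = 0" if "\<mu> \<notin> weight_lattice" for \<mu>
      using that wt_lattice by (auto simp: \<Psi>_def)
  qed
  then have inv: "\<Psi> \<in> completion_invariants s \<rho> (chi a\<^sub>0 a\<^sub>1)"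
    by (rule solution_invariants) (unfold \<Psi>, rule F(1))
  have lam: "\<Psi> lam = hwv" using \<Psi>[of 0 0] F(2) by (simp add: wt_00)
  have "\<Phi> \<in> range (\<lambda>c. pointwise_scale s c \<Psi>)" if \<Phi>: "\<Phi> \<in> completion_invariants s \<rho> (chi a\<^sub>0 a\<^sub>1)" for \<Phi>
  proof -
    obtain c where c: "\<Phi> lam = s c hwv"
      using graded.V_00[OF completion_V[OF invariants_solution(1)[OF \<Phi>], of 0 0]] by (auto simp: wt_00)
    have "\<Phi> - pointwise_scale s c \<Psi> = 0"
      by (rule invariants_eq_0[OF invariants_diff[OF \<Phi> invariants_scale[OF inv]]])
        (simp add: c lam pointwise_scale_def)
    then show ?thesis by simp
  qed
  moreover have "\<Psi> \<noteq> 0" using lam hwv(2) by auto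
  ultimately show ?thesis using invariants_scale[OF inv] by blast
qed

end

text \<open>For an integer a, one of l - a and l + a is l - |a|, and the other exceeds it by 2 |a|.
  Hence both are even and nonnegative as soon as the smaller one is.\<close>

lemma parity_condition:
  fixes a :: complex
  shows "(\<exists>p q::nat. of_nat l - a = 2 * of_nat p \<and> of_nat l + a = 2 * of_nat q) \<longleftrightarrow>
    a \<in> \<int> \<and> of_nat l - of_real (cmod a) \<in> range (\<lambda>n::nat. 2 * of_nat n :: complex)"
    (is "?L \<longleftrightarrow> ?R")
proof
  assume ?L
  then obtain p q :: nat where pq: "of_nat l - a = 2 * of_nat p" "of_nat l + a = 2 * of_nat q" by blast
  have "2 * a = (of_nat l + a) - (of_nat l - a)" by simp
  also have "\<dots> = 2 * (of_int (int q - int p))" unfolding pq by simp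
  finally have a: "a = of_int (int q - int p)" by (simp only: mult_cancel_left) simp
  have "cmod a = of_int \<bar>int q - int p\<bar>" unfolding a norm_of_int by simp
  then have "of_real (cmod a) = a \<or> of_real (cmod a) = - a" unfolding a by (auto simp: abs_if)
  then show ?R using pq a by (metis Ints_of_int diff_minus_eq_add rangeI)
next
  assume R: ?R
  then obtain z where z: "a = of_int z" by (auto elim: Ints_cases)
  obtain n :: nat where n: "of_nat l - of_real (cmod a) = (2 * of_nat n :: complex)" using R by blast
  have c: "of_real (cmod a) = (of_int \<bar>z\<bar> :: complex)"
  proof -
    have "cmod a = of_int \<bar>z\<bar>" unfolding z norm_of_int by simp
    then show ?thesis by (simp only: of_real_of_int_eq)
  qed
  have l: "of_nat l = of_int \<bar>z\<bar> + (2 * of_nat n :: complex)"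
    using n unfolding c by (simp add: algebra_simps)
  show ?L
  proof (cases "z \<ge> 0")
    case True
    then show ?thesis unfolding l z
      by (intro exI[of _ n] exI[of _ "n + nat z"]) (simp add: algebra_simps)
  next
    case False
    then show ?thesis unfolding l z
      by (intro exI[of _ "n + nat (- z)"] exI[of _ n]) (simp add: algebra_simps)
  qed
qed

theorem proposition2p4:
  fixes s :: "complex \<Rightarrow> 'v \<Rightarrow> 'v::ab_group_add"
    and \<rho> :: "affine \<Rightarrow> 'v \<Rightarrow> 'v"
    and lam :: "affine \<Rightarrow> complex"
    and a\<^sub>0 a\<^sub>1 :: complex
  assumes "lam \<in> dominant_weights"
    and "is_V s \<rho> lam"
  shows "(a\<^sub>0 \<notin> \<int> \<or> a\<^sub>1 \<notin> \<int> \<longrightarrow> completion_invariants s \<rho> (chi a\<^sub>0 a\<^sub>1) = {0})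
    \<and> (a\<^sub>0 \<in> \<int> \<and> a\<^sub>1 \<in> \<int> \<longrightarrow>
        has_dim (pointwise_scale s) (completion_invariants s \<rho> (chi a\<^sub>0 a\<^sub>1))
          (if lam h\<^sub>0 - of_real (cmod a\<^sub>0) \<in> range (\<lambda>n::nat. 2 * of_nat n)
              \<and> lam h\<^sub>1 - of_real (cmod a\<^sub>1) \<in> range (\<lambda>n::nat. 2 * of_nat n)
           then 1 else 0))"
proof -
  have vs: "vector_space s"
    using assms(2) by (simp add: is_V_def irreducible_module_def affine_module_def)
  then interpret standard_module s \<rho> lam
    using assms by (simp add: standard_module_def standard_module_axioms_def)
  interpret P: vector_space "pointwise_scale s :: complex \<Rightarrow> ((affine \<Rightarrow> complex) \<Rightarrow> 'v) \<Rightarrow> _"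
    by unfold_locales (simp_all add: pointwise_scale_def fun_eq_iff scale_right_distrib scale_left_distrib)
  let ?I = "completion_invariants s \<rho> (chi a\<^sub>0 a\<^sub>1)"
  let ?c0 = "lam h\<^sub>0 - of_real (cmod a\<^sub>0) \<in> range (\<lambda>n::nat. 2 * of_nat n)"
  let ?c1 = "lam h\<^sub>1 - of_real (cmod a\<^sub>1) \<in> range (\<lambda>n::nat. 2 * of_nat n)"
  have coeff: "string_coeff l0 (- \<i> * a\<^sub>0) (Suc l0) = 0 \<longleftrightarrow> a\<^sub>0 \<in> \<int> \<and> ?c0"
    "string_coeff l1 (- \<i> * a\<^sub>1) (Suc l1) = 0 \<longleftrightarrow> a\<^sub>1 \<in> \<int> \<and> ?c1"
    unfolding string_coeff_terminates_iff parity_condition lam_h by (rule refl)+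
  have triv: "?I = {0}" if "\<not> (a\<^sub>0 \<in> \<int> \<and> ?c0 \<and> a\<^sub>1 \<in> \<int> \<and> ?c1)"
    using that invariants_trivial coeff by blast
  have zero: "has_dim (pointwise_scale s) ?I 0" if "?I = {0}"
  proof -
    have "P.dim {0 :: (affine \<Rightarrow> complex) \<Rightarrow> 'v} = 0"
      using P.dim_span[of "{}"] P.dim_eq_card_independent[OF P.independent_empty]
      unfolding P.span_empty by simp
    then show ?thesis unfolding that has_dim_def by (intro conjI exI[of _ "{}"]) simp_all
  qed
  have one: "has_dim (pointwise_scale s) ?I 1" if c: "a\<^sub>0 \<in> \<int> \<and> ?c0 \<and> a\<^sub>1 \<in> \<int> \<and> ?c1"
  proof -
    have "string_coeff l0 (- \<i> * a\<^sub>0) (Suc l0) = 0" "string_coeff l1 (- \<i> * a\<^sub>1) (Suc l1) = 0"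
      unfolding coeff using c by (simp_all only: simp_thms)
    from invariants_one_dim[OF this]
    obtain \<Psi> where \<Psi>: "\<Psi> \<noteq> 0" "?I = range (\<lambda>c. pointwise_scale s c \<Psi>)" by (elim exE conjE)
    have "P.dim ?I = 1"
      unfolding \<Psi>(2) P.span_singleton[symmetric] P.dim_span
      using P.dim_eq_card_independent[of "{\<Psi>}"] \<Psi>(1) by simp
    then show ?thesis unfolding has_dim_def \<Psi>(2) P.span_singleton[symmetric] by blast
  qed
  show ?thesis
  proof (intro conjI impI)
    show "?I = {0}" if "a\<^sub>0 \<notin> \<int> \<or> a\<^sub>1 \<notin> \<int>" using that triv by blast
    show "has_dim (pointwise_scale s) ?I (if ?c0 \<and> ?c1 then 1 else 0)" if "a\<^sub>0 \<in> \<int> \<and> a\<^sub>1 \<in> \<int>"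
    proof (cases "?c0 \<and> ?c1")
      case True
      then show ?thesis unfolding if_P[OF True] using that one by blast
    next
      case False
      then show ?thesis unfolding if_not_P[OF False] using triv zero by blast
    qed
  qed
qed

end
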